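(* Assume that $\mathbb{E}[\|Y\|_\infty]<\infty$, where $\|Y\|_\infty=\sup_{t\in[0,T]}|Y_t|$. For $l\in T((\mathbb{R}^{1+d})^* )$ let $$\tau_l := \inf\{t\in[0,T] : \langle l,\hat{\mathbb{X}}^{<\infty}_{0,t}\rangle\ge 1\},\qquad \inf\emptyset=+\infty.$$ Then $$\sup_{\tau\in\mathcal{S}}\mathbb{E}[Y_{\tau\wedge T}] = \sup_{l\in T((\mathbb{R}^{1+d})^* )}\mathbb{E}[Y_{\tau_l\wedge T}].$$
   Context: Fix $p\ge 1$, $T>0$, $d\ge 1$, and let $V=\mathbb{R}^{1+d}$ with standard basis $e_1,\dots,e_{1+d}$. Tensor algebra: $T((V))=\prod_{n\ge0}V^{\otimes n}$, $T^N(V)=\bigoplus_{n=0}^N V^{\otimes n}$, $T(V^* )=\bigoplus_{n\ge0}(V^* )^{\otimes n}$ (finite sums), with $V^{\otimes 0}=\mathbb{R}$, product $\otimes$, unit $\mathbf{1}=(1,0,0,\dots)$, projections $\pi_n:T((V))\to V^{\otimes n}$ and $\pi_{\le N}:T((V))\to T^N(V)$, and natural pairing $\langle\cdot,\cdot\rangle:T(V^* )\times T((V))\to\mathbb{R}$. $T(V^* )$ is identified with the linear span of words in the letters $1,\dots,1+d$ via $e_{i_1}^*\otimes\cdots\otimes e_{i_n}^*\leftrightarrow i_1\cdots i_n$. The shuffle product is the bilinear product with $w\sqcup\!\sqcup\varnothing=\varnothing\sqcup\!\sqcup w=w$ and $wi\sqcup\!\sqcup vj=(w\sqcup\!\sqcup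 vj)i+(wi\sqcup\!\sqcup v)j$. $G(V)$ is the group (under $\otimes$) of all $\mathbf{a}\in T((V))\setminus\{\mathbf 0\}$ with $\langle l_1\sqcup\!\sqcup l_2,\mathbf{a}\rangle=\langle l_1,\mathbf{a}\rangle\langle l_2,\mathbf{a}\rangle$ for all $l_1,l_2\in T(V^* )$, and $G^N(V)=\pi_{\le N}(G(V))$ (a group under truncated multiplication). Rough paths: on $V^{\otimes n}$ use the maximum norm of coordinates. For a path $\mathbb{X}$ in $G^{N}(V)$ put $\mathbb{X}_{s,t}=\mathbb{X}_s^{-1}\otimes\mathbb{X}_t$. For two-parameter functions with values in $T^N(V)$, $\|\mathbb{X}\|_{p\text{-var};[s,t]}=\max_{1\le k\le N}\sup_{\mathcal{D}}\big(\sum_{t_i\in\mathcal{D}}|\pi_k(\mathbb{X}_{t_i,t_{i+1}})|^{p/k}\big)^{k/p}$ (supremum over partitions $\mathcal{D}$ of $[s,t]$) and $d_{p\text{-var};[s,t]}(\mathbb{X},\mathbb{Y})=\|\mathbb{X}-\mathbb{Y}\|_{p\text{-var};[s,t]}$. For a continuous bounded variation path $Z:[0,T]\to V$, its signature is $\pi_k(\mathbb{Z}^{<\infty}_t)=\int_{0<t_1<\dots<t_k<t}dZ_{t_1}\otimes\cdots\otimes dZ_{t_k}$, and $\mathbb{Z}^{\le N}=\pi_{\le N}(\mathbb{Z}^{<\infty})$. $\hat\Omega^p_T$ is the closure with respect to $d_{p\text{-var};[0,T]}$ (among continuous paths $[0,T]\to G^{\lfloor p\rfloor}(V)$ started at $\mathbf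 1$ with finite $p$-variation) of the set of lifts $\hat{\mathbb{X}}^{\le\lfloor p\rfloor}$ of paths $\hat X_t=(t,X_t)\in\mathbb{R}^{1+d}$ with $X:[0,T]\to\mathbb{R}^d$ piecewise smooth. By Lyons' extension theorem each $\hat{\mathbb{X}}\in\hat\Omega^p_T$ has a unique lift to a path $\hat{\mathbb{X}}^{<\infty}$ in $G(V)$ with $\pi_{\le\lfloor p\rfloor}(\hat{\mathbb{X}}^{<\infty})=\hat{\mathbb{X}}$ and $\pi_{\le N}(\hat{\mathbb{X}}^{<\infty})$ of finite $p$-variation for all $N$; it is called the signature of $\hat{\mathbb{X}}$, and $\hat{\mathbb{X}}^{<\infty}_{0,t}=\hat{\mathbb{X}}^{<\infty}_{t}$. Stochastic setting: $(\Omega,\mathcal{F},\mathbb{P})$ is a probability space, $\hat{\mathbb{X}}$ is a stochastic process with sample paths in $\hat\Omega^p_T$ (a random element of $\hat\Omega^p_T$), $\mathcal{F}_t=\sigma(\hat{\mathbb{X}}_{0,s}:0\le s\le t)$ for $t\in[0,T]$, $Y:[0,T]\times\Omega\to\mathbb{R}$ is a continuous $(\mathcal{F}_t)$-adapted process, and $\mathcal{S}$ is the set of all $(\mathcal{F}_t)_{t\in[0,T]}$-stopping times (values in $[0,T]\cup\{+\infty\}$). *)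

theory Defs
  imports "HOL-Probability.Probability" "HOL-Library.Poly_Mapping"
begin

section \<open>The tensor algebra\<close>

text \<open>
  For a finite alphabet \<open>'a\<close>, let \<open>V\<close> be \<open>real ^ 'a\<close> with its standard basis. An element of
  \<open>T((V))\<close> is given by its coordinates with respect to the induced basis, that is, by a function
  from words to reals; \<open>T(V\<^sup>*)\<close>, the linear span of words, consists of the finitely supported
  functions. The truncated algebra \<open>T\<^sup>N(V)\<close> is identified with the series that vanish on words
  longer than \<open>N\<close>.
\<close>

type_synonym 'a tseries = "'a list \<Rightarrow> real"
type_synonym 'a tpoly = "'a list \<Rightarrow>\<^sub>0 real"

definition tunit :: "'a tseries" where
  "tunit w = (if w = [] then 1 else 0)"

definition tmult :: "'a tseries \<Rightarrow> 'a tseries \<Rightarrow> 'a tseries"  (infixl \<open>\<otimes>\<^sub>t\<close> 70) where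
  "(a \<otimes>\<^sub>t b) w = (\<Sum>i\<le>length w. a (take i w) * b (drop i w))"

definition trunc :: "nat \<Rightarrow> 'a tseries \<Rightarrow> 'a tseries" where
  "trunc N a = (\<lambda>w. if length w \<le> N then a w else 0)"

definition pairing :: "'a tpoly \<Rightarrow> 'a tseries \<Rightarrow> real" where
  "pairing l a = (\<Sum>w\<in>Poly_Mapping.keys l. Poly_Mapping.lookup l w * a w)"

text \<open>The linear extension of \<open>w \<mapsto> w i\<close> to \<open>T(V\<^sup>*)\<close>.\<close>

definition snoc_letter :: "'a tpoly \<Rightarrow> 'a \<Rightarrow> 'a tpoly" where
  "snoc_letter l i =
     (\<Sum>w\<in>Poly_Mapping.keys l. Poly_Mapping.single (w @ [i]) (Poly_Mapping.lookup l w))"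

function shuffle_words :: "'a list \<Rightarrow> 'a list \<Rightarrow> 'a tpoly" where
  "shuffle_words w [] = Poly_Mapping.single w 1"
| "shuffle_words [] (v @ [j]) = Poly_Mapping.single (v @ [j]) 1"
| "shuffle_words (w @ [i]) (v @ [j]) =
     snoc_letter (shuffle_words w (v @ [j])) i + snoc_letter (shuffle_words (w @ [i]) v) j"
  by (auto, metis rev_exhaust)
termination
  by (relation "Wellfounded.measure (\<lambda>(w, v). length w + length v)") auto

definition shuffle :: "'a tpoly \<Rightarrow> 'a tpoly \<Rightarrow> 'a tpoly" where
  "shuffle l1 l2 =
     (\<Sum>w\<in>Poly_Mapping.keys l1. \<Sum>v\<in>Poly_Mapping.keys l2.
        Poly_Mapping.map ((*) (Poly_Mapping.lookup l1 w * Poly_Mapping.lookup l2 v))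
          (shuffle_words w v))"

definition grouplike :: "'a tseries set" where
  "grouplike = {a. a \<noteq> (\<lambda>w. 0) \<and>
     (\<forall>l1 l2. pairing (shuffle l1 l2) a = pairing l1 a * pairing l2 a)}"

definition grouplike_trunc :: "nat \<Rightarrow> 'a tseries set" where
  "grouplike_trunc N = trunc N ` grouplike"

definition trunc_inv :: "nat \<Rightarrow> 'a tseries \<Rightarrow> 'a tseries" where
  "trunc_inv N a = (THE b. b \<in> grouplike_trunc N \<and>
     trunc N (a \<otimes>\<^sub>t b) = tunit \<and> trunc N (b \<otimes>\<^sub>t a) = tunit)"

section \<open>Rough paths\<close>

text \<open>
  Paths over \<open>[0,T]\<close> are functions on \<open>real\<close> of which only the values on \<open>{0..T}\<close> matter.
\<close>

definition level_norm :: "nat \<Rightarrow> 'a::finite tseries \<Rightarrow> real" where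
  "level_norm k a = Max {\<bar>a w\<bar> | w. length w = k}"

definition incr :: "nat \<Rightarrow> (real \<Rightarrow> 'a tseries) \<Rightarrow> real \<Rightarrow> real \<Rightarrow> 'a tseries" where
  "incr N X s t = trunc N (trunc_inv N (X s) \<otimes>\<^sub>t X t)"

definition partitions :: "real \<Rightarrow> real \<Rightarrow> real list set" where
  "partitions s t = {D. D \<noteq> [] \<and> hd D = s \<and> last D = t \<and> sorted_wrt (<) D}"

definition pvar_norm ::
    "real \<Rightarrow> nat \<Rightarrow> real \<Rightarrow> real \<Rightarrow> (real \<Rightarrow> real \<Rightarrow> 'a::finite tseries) \<Rightarrow> ennreal" where
  "pvar_norm p N s t A =
     (SUP k\<in>{1..N}. SUP D\<in>partitions s t.
        ennreal ((\<Sum>i<length D - 1. level_norm k (A (D ! i) (D ! Suc i)) powr (p / real k))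
                   powr (real k / p)))"

definition pvar_dist ::
    "real \<Rightarrow> nat \<Rightarrow> real \<Rightarrow> (real \<Rightarrow> 'a::finite tseries) \<Rightarrow> (real \<Rightarrow> 'a tseries) \<Rightarrow> ennreal" where
  "pvar_dist p N T X Y = pvar_norm p N 0 T (\<lambda>s t w. incr N X s t w - incr N Y s t w)"

text \<open>
  Continuous paths in \<open>G\<^sup>N(V)\<close> that start at the unit and have finite \<open>p\<close>-variation.
\<close>

definition pvar_paths :: "real \<Rightarrow> nat \<Rightarrow> real \<Rightarrow> (real \<Rightarrow> 'a::finite tseries) set" where
  "pvar_paths p N T = {X.
     (\<forall>t\<in>{0..T}. X t \<in> grouplike_trunc N) \<and>
     (\<forall>w. continuous_on {0..T} (\<lambda>t. X t w)) \<and>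
     X 0 = tunit \<and>
     pvar_norm p N 0 T (incr N X) < \<infinity>}"

section \<open>Signatures of paths of bounded variation\<close>

text \<open>The Riemann--Stieltjes integral of \<open>f\<close> against \<open>g\<close>, as a limit over vanishing mesh.\<close>

definition has_RS_integral ::
    "(real \<Rightarrow> real) \<Rightarrow> (real \<Rightarrow> real) \<Rightarrow> real \<Rightarrow> real \<Rightarrow> real \<Rightarrow> bool" where
  "has_RS_integral f g a b I \<longleftrightarrow>
     (\<forall>\<epsilon>>0. \<exists>\<delta>>0. \<forall>P. P tagged_division_of {a..b} \<and> (\<lambda>x. ball x \<delta>) fine P \<longrightarrow>
        \<bar>(\<Sum>(x, K)\<in>P. f x * (g (Sup K) - g (Inf K))) - I\<bar> < \<epsilon>)"

definition RS_integral :: "(real \<Rightarrow> real) \<Rightarrow> (real \<Rightarrow> real) \<Rightarrow> real \<Rightarrow> real \<Rightarrow> real" where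
  "RS_integral f g a b = (THE I. has_RS_integral f g a b I)"

text \<open>
  The last letter of a word belongs to the outermost integral, so the recursion runs over the
  reversed word.
\<close>

primrec iterated_integral :: "(real \<Rightarrow> real ^ 'a) \<Rightarrow> 'a list \<Rightarrow> real \<Rightarrow> real" where
  "iterated_integral Z [] t = 1"
| "iterated_integral Z (i # w) t = RS_integral (iterated_integral Z w) (\<lambda>s. Z s $ i) 0 t"

definition bv_signature :: "(real \<Rightarrow> real ^ 'a) \<Rightarrow> real \<Rightarrow> 'a tseries" where
  "bv_signature Z t w = iterated_integral Z (rev w) t"

text \<open>
  \<open>C\<^sup>\<infinity>\<close> on a compact interval, with one-sided derivatives of all orders at the endpoints.
  Consecutive pieces of a piecewise smooth path share their endpoints, so it is continuous.
\<close>

definition smooth_on_interval :: "real \<Rightarrow> real \<Rightarrow> (real \<Rightarrow> 'v::real_normed_vector) \<Rightarrow> bool" where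
  "smooth_on_interval a b f \<longleftrightarrow>
     (\<exists>D :: nat \<Rightarrow> real \<Rightarrow> 'v. (\<forall>t\<in>{a..b}. D 0 t = f t) \<and>
        (\<forall>n. \<forall>t\<in>{a..b}. (D n has_vector_derivative D (Suc n) t) (at t within {a..b})))"

definition piecewise_smooth :: "real \<Rightarrow> (real \<Rightarrow> 'v::real_normed_vector) \<Rightarrow> bool" where
  "piecewise_smooth T f \<longleftrightarrow>
     (\<exists>D\<in>partitions 0 T. \<forall>i<length D - 1. smooth_on_interval (D ! i) (D ! Suc i) f)"

text \<open>
  The alphabet of \<open>real ^ (1 + d)\<close> is \<open>'d option\<close> with \<open>d = CARD('d)\<close>: \<open>None\<close> is the time letter
  and \<open>Some j\<close> are the letters of the space components.
\<close>

definition time_augment :: "(real \<Rightarrow> real ^ 'd) \<Rightarrow> real \<Rightarrow> real ^ 'd option" where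
  "time_augment X t = (\<chi> i. case i of None \<Rightarrow> t | Some j \<Rightarrow> X t $ j)"

section \<open>The path space and the signature of a rough path\<close>

definition Omega_hat :: "real \<Rightarrow> real \<Rightarrow> (real \<Rightarrow> 'd::finite option tseries) set" where
  "Omega_hat p T = (let N = nat \<lfloor>p\<rfloor> in
     {X \<in> pvar_paths p N T. \<forall>\<epsilon>>0. \<exists>Z :: real \<Rightarrow> real ^ 'd. piecewise_smooth T Z \<and>
        pvar_dist p N T X (\<lambda>t. trunc N (bv_signature (time_augment Z) t)) < ennreal \<epsilon>})"

text \<open>
  Lyons' lift. Continuity and the initial value \<open>1\<close> are part of the notion of a path here: without
  them the lift is not unique, since the levels above \<open>p\<close> could carry jumps or an arbitrary
  initial value.
\<close>

definition is_lyons_lift ::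
    "real \<Rightarrow> real \<Rightarrow> (real \<Rightarrow> 'a::finite tseries) \<Rightarrow> (real \<Rightarrow> 'a tseries) \<Rightarrow> bool" where
  "is_lyons_lift p T X S \<longleftrightarrow>
     (\<forall>t\<in>{0..T}. S t \<in> grouplike) \<and>
     (\<forall>t\<in>{0..T}. trunc (nat \<lfloor>p\<rfloor>) (S t) = X t) \<and>
     (\<forall>N. (\<lambda>t. trunc N (S t)) \<in> pvar_paths p N T)"

text \<open>The lift is unique on \<open>{0..T}\<close> only, hence a description of its value at \<open>t\<close>.\<close>

definition rp_signature ::
    "real \<Rightarrow> real \<Rightarrow> (real \<Rightarrow> 'a::finite tseries) \<Rightarrow> real \<Rightarrow> 'a tseries" where
  "rp_signature p T X t = (THE a. \<exists>S. is_lyons_lift p T X S \<and> S t = a)"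

section \<open>Stopping times\<close>

text \<open>
  \<open>X t \<omega>\<close> is the value at time \<open>t\<close> of the sample path of \<open>\<omega>\<close>. The filtration is indexed by
  \<open>ereal\<close>, so that \<^const>\<open>stopping_time\<close> covers times with values in \<open>[0,T] \<union> {\<infinity>}\<close>. It is
  \<open>\<sigma>(X\<^bsub>0,s\<^esub> : 0 \<le> s \<le> t)\<close> for \<open>t \<in> [0,T]\<close>, trivial before \<open>0\<close> and constant after \<open>T\<close>; so
  outside \<open>[0,T]\<close> it imposes no further condition on such times.
\<close>

definition rp_filtration ::
    "real \<Rightarrow> real \<Rightarrow> 'w measure \<Rightarrow> (real \<Rightarrow> 'w \<Rightarrow> 'a tseries) \<Rightarrow> ereal \<Rightarrow> 'w measure" where
  "rp_filtration p T M X t = sigma (space M)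
     {{\<omega> \<in> space M. incr (nat \<lfloor>p\<rfloor>) (\<lambda>r. X r \<omega>) 0 s w \<in> B} | s w B.
        s \<in> {0..T} \<and> ereal s \<le> t \<and> B \<in> sets borel}"

definition rp_stopping_times ::
    "real \<Rightarrow> real \<Rightarrow> 'w measure \<Rightarrow> (real \<Rightarrow> 'w \<Rightarrow> 'a tseries) \<Rightarrow> ('w \<Rightarrow> ereal) set" where
  "rp_stopping_times p T M X = {\<tau>.
     (\<forall>\<omega>\<in>space M. \<tau> \<omega> \<in> ereal ` {0..T} \<union> {\<infinity>}) \<and>
     stopping_time (rp_filtration p T M X) \<tau>}"

definition hitting_time ::
    "real \<Rightarrow> real \<Rightarrow> (real \<Rightarrow> 'w \<Rightarrow> 'a::finite tseries) \<Rightarrow> 'a tpoly \<Rightarrow> 'w \<Rightarrow> ereal" where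
  "hitting_time p T X l \<omega> =
     Inf (ereal ` {t \<in> {0..T}. pairing l (rp_signature p T (\<lambda>r. X r \<omega>) t) \<ge> 1})"

text \<open>\<open>Y\<close> evaluated at \<open>\<tau> \<and> T\<close>.\<close>

definition stopped_value :: "real \<Rightarrow> (real \<Rightarrow> 'w \<Rightarrow> real) \<Rightarrow> ('w \<Rightarrow> ereal) \<Rightarrow> 'w \<Rightarrow> real" where
  "stopped_value T Y \<tau> \<omega> = Y (real_of_ereal (min (\<tau> \<omega>) (ereal T))) \<omega>"

end

theory Submission
  imports Defs
begin

text \<open>
  The signature of \<open>(t, X\<^sub>t)\<close> determines its own past: since the first letter is time,
  \<open>\<langle>l None, S\<^sub>t\<rangle> = \<integral>\<^sub>0\<^sup>t \<langle>l, S\<^sub>u\<rangle> du\<close>, so averaging against polynomials in \<open>u\<close> recovers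
  \<open>X\<^sub>r\<close> for \<open>r < t\<close>, and the shuffle identity makes the processes \<open>\<langle>l, S\<^sub>t\<rangle>\<close> an algebra. By Weierstrass
  and a monotone class argument they approximate, uniformly in \<open>t\<close> and in probability, every process
  \<open>\<phi>(t) 1\<^sub>A\<close> with \<open>A \<in> \<F>\<^sub>s\<close> and \<open>\<phi> = 0\<close> on \<open>[0,s]\<close>, hence also \<open>K (t - \<tau>)\<^sup>+\<close> for a
  stopping time \<open>\<tau>\<close>. A functional close to the latter first reaches \<open>1\<close> shortly after \<open>\<tau>\<close>, and
  dominated convergence gives one inequality. The other one holds because \<open>\<langle>l, S\<^sub>t\<rangle>\<close> is continuous and
  adapted, so that its hitting times of a closed set are stopping times.

  All of this needs Lyons' lift \<open>S\<close> to exist, to be unique, and to be adapted. A level \<open>n > p\<close> is obtained by sewing: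
  the increments of the path prolonged by \<open>0\<close> fail to be additive by at most
  \<open>C \<omega>(s,t)\<^bsup>n/p\<^esup>\<close> for a control \<open>\<omega>\<close>. Conversely the increments of any lift on such a level
  have vanishing sums, which expresses it as a limit of Riemann sums in lower levels.
\<close>

section \<open>Shuffles and group-like series\<close>

text \<open>The supremum over partitions that serves as control is superadditive, but its continuity
  near the diagonal is not at hand. Smallness with the mesh is therefore taken from the uniform
  continuity of the paths and paid for with part of the exponent: a quantity bounded by a small
  constant and by \<open>A * \<omega> s t powr \<theta>'\<close> is at most
  \<open>\<epsilon> * \<omega> s t powr \<theta>\<close> when \<open>\<theta> < \<theta>'\<close>.
  Beyond level \<open>p\<close> the exponent \<open>(n + 1) / p\<close> exceeds 1, which leaves room
  for such a \<open>\<theta>\<close> above 1.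

  The lift comes out of choices made level by level, which say nothing about measurability in the
  sample point. Adaptedness is instead read off from the formula that yields uniqueness: Riemann
  sums along fixed partitions are measurable, and so are their limits.

  Functionals of the signature are continuous in time and may lack moments. So a jump at
  \<open>\<tau>\<close> is replaced by a steep ramp, and closeness is measured in probability. The
  factor \<open>\<phi>\<close> makes an event of time \<open>s\<close> reachable: before
  \<open>s\<close> it cannot be read off from the signature, and there it is multiplied by
  0.\<close>

lemma pairing_superset:
  assumes "finite K" "Poly_Mapping.keys l \<subseteq> K"
  shows "pairing l a = (\<Sum>w\<in>K. Poly_Mapping.lookup l w * a w)"
  unfolding pairing_def
  by (rule sum.mono_neutral_left) (use assms in \<open>auto simp: in_keys_iff\<close>)

lemma pairing_zero [simp]: "pairing 0 a = 0"
  by (simp add: pairing_def)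

lemma pairing_single [simp]: "pairing (Poly_Mapping.single w c) a = c * a w"
  by (simp add: pairing_def)

lemma pairing_plus: "pairing (l + m) a = pairing l a + pairing m a"
proof -
  let ?K = "Poly_Mapping.keys l \<union> Poly_Mapping.keys m"
  have "pairing (l + m) a = (\<Sum>w\<in>?K. Poly_Mapping.lookup (l + m) w * a w)"
    by (rule pairing_superset) (auto simp: keys_add)
  moreover have "pairing l a = (\<Sum>w\<in>?K. Poly_Mapping.lookup l w * a w)"
    by (rule pairing_superset) auto
  moreover have "pairing m a = (\<Sum>w\<in>?K. Poly_Mapping.lookup m w * a w)"
    by (rule pairing_superset) auto
  ultimately show ?thesis
    by (simp add: lookup_add sum.distrib distrib_right)
qed

lemma pairing_sum: "pairing (\<Sum>i\<in>I. l i) a = (\<Sum>i\<in>I. pairing (l i) a)"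
  by (induction I rule: infinite_finite_induct) (auto simp: pairing_plus)

lemma pairing_map: "pairing (Poly_Mapping.map ((*) c) l) a = c * pairing l a"
proof -
  have *: "Poly_Mapping.lookup (Poly_Mapping.map ((*) c) l) w = c * Poly_Mapping.lookup l w" for w
    by (simp add: Poly_Mapping.map.rep_eq when_def)
  have "pairing (Poly_Mapping.map ((*) c) l) a = (\<Sum>w\<in>Poly_Mapping.keys l.
      Poly_Mapping.lookup (Poly_Mapping.map ((*) c) l) w * a w)"
    by (rule pairing_superset) (auto simp: in_keys_iff *)
  then show ?thesis
    by (simp add: * pairing_def sum_distrib_left mult.assoc)
qed

lemma pairing_linear: "pairing l (\<lambda>w. a w + c * b w) = pairing l a + c * pairing l b"
  by (simp add: pairing_def algebra_simps sum.distrib sum_distrib_left)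

lemma pairing_snoc_letter: "pairing (snoc_letter l i) a = pairing l (\<lambda>w. a (w @ [i]))"
  by (simp add: snoc_letter_def pairing_sum) (simp add: pairing_def)

text \<open>Appending a letter to words is adjoint to the shift
  \<open>\<lambda>w. a (w @ [i])\<close> of the series. Tested against \<open>a\<close>, the shuffle
  recursion becomes one that shifts \<open>a\<close>, and polynomials in words no longer
  appear.\<close>

definition shuffle_eval :: "'a tseries \<Rightarrow> 'a list \<Rightarrow> 'a list \<Rightarrow> real" where
  "shuffle_eval a w v = pairing (shuffle_words w v) a"

lemma shuffle_words_Nil_left: "shuffle_words [] v = Poly_Mapping.single v 1"
  by (cases v rule: rev_cases) auto

lemma shuffle_eval_Nil [simp]:
  "shuffle_eval a w [] = a w" "shuffle_eval a [] w = a w"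
  by (simp_all add: shuffle_eval_def shuffle_words_Nil_left)

lemma shuffle_eval_snoc:
  "shuffle_eval a (w @ [i]) (v @ [j]) =
     shuffle_eval (\<lambda>u. a (u @ [i])) w (v @ [j]) + shuffle_eval (\<lambda>u. a (u @ [j])) (w @ [i]) v"
  by (simp add: shuffle_eval_def pairing_plus pairing_snoc_letter)

lemma shuffle_eval_linear:
  "shuffle_eval (\<lambda>u. a u + c * b u) w v = shuffle_eval a w v + c * shuffle_eval b w v"
  by (simp add: shuffle_eval_def pairing_linear)

text \<open>All words in the shuffle of \<open>w\<close> and \<open>v\<close> have length
  \<open>length w + length v\<close>. Hence truncation leaves the shuffle identities of low levels
  intact.\<close>

lemma shuffle_eval_cong:
  assumes "\<And>u. length u = length w + length v \<Longrightarrow> a u = b u"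
  shows "shuffle_eval a w v = shuffle_eval b w v"
  using assms
proof (induction w v arbitrary: a b rule: shuffle_words.induct)
  case (3 w i v j)
  show ?case unfolding shuffle_eval_snoc
    by (intro arg_cong2[of _ _ _ _ "(+)"] 3) (auto simp: "3.prems")
qed auto

lemma pairing_shuffle:
  "pairing (shuffle l m) a = (\<Sum>w\<in>Poly_Mapping.keys l. \<Sum>v\<in>Poly_Mapping.keys m.
     Poly_Mapping.lookup l w * Poly_Mapping.lookup m v * shuffle_eval a w v)"
  by (simp add: shuffle_def pairing_sum pairing_map shuffle_eval_def)

section \<open>Product and inverse of series\<close>

lemma tmult_Nil [simp]: "(a \<otimes>\<^sub>t b) [] = a [] * b []"
  by (simp add: tmult_def)

lemma tmult_Cons: "(a \<otimes>\<^sub>t b) (x # w) = a [] * b (x # w) + ((\<lambda>u. a (x # u)) \<otimes>\<^sub>t b) w"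
  by (simp add: tmult_def sum.atMost_Suc_shift del: sum.atMost_Suc)

lemma tmult_snoc: "(a \<otimes>\<^sub>t b) (w @ [x]) = a (w @ [x]) * b [] + (a \<otimes>\<^sub>t (\<lambda>u. b (u @ [x]))) w"
  by (simp add: tmult_def)

lemma tmult_linear_left: "((\<lambda>u. a u + c * b u) \<otimes>\<^sub>t d) w = (a \<otimes>\<^sub>t d) w + c * (b \<otimes>\<^sub>t d) w"
  by (simp add: tmult_def algebra_simps sum.distrib sum_distrib_left)

lemma tmult_assoc: "(a \<otimes>\<^sub>t b) \<otimes>\<^sub>t c = a \<otimes>\<^sub>t (b \<otimes>\<^sub>t c)"
proof
  fix w show "((a \<otimes>\<^sub>t b) \<otimes>\<^sub>t c) w = (a \<otimes>\<^sub>t (b \<otimes>\<^sub>t c)) w"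
  proof (induction w arbitrary: a b)
    case (Cons x w)
    have *: "(\<lambda>u. (a \<otimes>\<^sub>t b) (x # u)) = (\<lambda>u. ((\<lambda>u. a (x # u)) \<otimes>\<^sub>t b) u + a [] * b (x # u))"
      by (simp add: tmult_Cons add.commute)
    show ?case
      by (simp only: tmult_Cons[of "a \<otimes>\<^sub>t b"] * tmult_linear_left Cons.IH)
        (simp add: tmult_Cons algebra_simps)
  qed simp
qed

lemma tmult_cong:
  assumes "\<And>v. length v \<le> length w \<Longrightarrow> a v = a' v" "\<And>v. length v \<le> length w \<Longrightarrow> b v = b' v"
  shows "(a \<otimes>\<^sub>t b) w = (a' \<otimes>\<^sub>t b') w"
  unfolding tmult_def by (intro sum.cong) (auto simp: assms)

lemma tmult_tunit [simp]: "a \<otimes>\<^sub>t tunit = a" "tunit \<otimes>\<^sub>t a = a"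
proof -
  show "a \<otimes>\<^sub>t tunit = a"
  proof
    fix w show "(a \<otimes>\<^sub>t tunit) w = a w"
    proof -
      have "(a \<otimes>\<^sub>t tunit) w = (\<Sum>i\<le>length w. if i = length w then a w else 0)"
        unfolding tmult_def by (intro sum.cong) (auto simp: tunit_def)
      then show ?thesis by simp
    qed
  qed
  show "tunit \<otimes>\<^sub>t a = a"
  proof
    fix w show "(tunit \<otimes>\<^sub>t a) w = a w"
    proof -
      have "(tunit \<otimes>\<^sub>t a) w = (\<Sum>i\<le>length w. if i = 0 then a w else 0)"
        unfolding tmult_def by (intro sum.cong) (auto simp: tunit_def)
      then show ?thesis by simp
    qed
  qed
qed

lemma tunit_Nil [simp]: "tunit [] = 1"
  by (simp add: tunit_def)

text \<open>The equation \<open>a \<otimes>\<^sub>t b = tunit\<close> is solved for \<open>b\<close>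
  in order of word length, with \<open>a []\<close> read as 1.\<close>

function tinv :: "'a tseries \<Rightarrow> 'a tseries" where
  "tinv a w = (if w = [] then 1 else - (\<Sum>i\<in>{1..length w}. a (take i w) * tinv a (drop i w)))"
  by auto
termination by (relation "Wellfounded.measure (\<lambda>(a, w). length w)") auto

declare tinv.simps [simp del]

lemma tinv_Nil [simp]: "tinv a [] = 1"
  by (simp add: tinv.simps)

lemma tinv_right:
  assumes "a [] = 1" shows "a \<otimes>\<^sub>t tinv a = tunit"
proof
  fix w show "(a \<otimes>\<^sub>t tinv a) w = tunit w"
  proof (cases "w = []")
    case False
    have "(a \<otimes>\<^sub>t tinv a) w = (\<Sum>i\<in>insert 0 {1..length w}. a (take i w) * tinv a (drop i w))"
      unfolding tmult_def by (intro sum.cong) auto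
    also have "\<dots> = tinv a w + (\<Sum>i\<in>{1..length w}. a (take i w) * tinv a (drop i w))"
      by (subst sum.insert) (auto simp: assms)
    also have "\<dots> = 0"
      using False by (subst tinv.simps) simp
    finally show ?thesis using False by (simp add: tunit_def)
  qed (simp add: assms)
qed

text \<open>A right inverse that has a right inverse itself is two-sided: by associativity
  \<open>tinv (tinv a)\<close> must be \<open>a\<close>.\<close>

lemma tinv_left:
  assumes "a [] = 1" shows "tinv a \<otimes>\<^sub>t a = tunit"
proof -
  have r: "tinv a \<otimes>\<^sub>t tinv (tinv a) = tunit"
    by (rule tinv_right) simp
  have "a = a \<otimes>\<^sub>t (tinv a \<otimes>\<^sub>t tinv (tinv a))"
    by (simp add: r)
  also have "\<dots> = (a \<otimes>\<^sub>t tinv a) \<otimes>\<^sub>t tinv (tinv a)"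
    by (simp only: tmult_assoc)
  also have "\<dots> = tinv (tinv a)"
    by (simp add: tinv_right[of a, OF assms])
  finally have "tinv (tinv a) = a" by simp
  with r show ?thesis by simp
qed

lemma tinv_cong:
  assumes "\<And>v. length v \<le> length w \<Longrightarrow> a v = a' v"
  shows "tinv a w = tinv a' w"
  using assms
proof (induction "length w" arbitrary: w rule: less_induct)
  case less
  show ?case
    unfolding tinv.simps[of _ w]
    by (auto intro!: sum.cong less arg_cong2[of _ _ _ _ "(*)"])
qed

lemma tinv_tunit [simp]: "tinv tunit = tunit"
  using tinv_right[of tunit] by simp

text \<open>Compatibility of shuffle and deconcatenation: splitting a shuffle of \<open>w\<close>
  and \<open>v\<close> into prefix and suffix amounts to splitting \<open>w\<close> and
  \<open>v\<close> and shuffling the parts separately. The shuffle recursion acts on last letters,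
  which lie in the factor \<open>b\<close> unless its part is empty; the exceptional term carries
  the factor \<open>b []\<close>.\<close>

lemma shuffle_eval_tmult:
  "shuffle_eval (a \<otimes>\<^sub>t b) w v =
     (\<Sum>k\<le>length w. \<Sum>l\<le>length v. shuffle_eval a (take k w) (take l v) * shuffle_eval b (drop k w) (drop l v))"
proof (induction w v arbitrary: a b rule: shuffle_words.induct)
  case (1 w)
  then show ?case by (simp add: tmult_def)
next
  case (2 v j)
  then show ?case by (simp only: shuffle_eval_Nil tmult_def) simp
next
  case (3 w i v j)
  let ?bi = "\<lambda>u. b (u @ [i])" and ?bj = "\<lambda>u. b (u @ [j])"
  let ?ai = "\<lambda>u. a (u @ [i])" and ?aj = "\<lambda>u. a (u @ [j])"
  have s: "(\<lambda>u. (a \<otimes>\<^sub>t b) (u @ [x])) = (\<lambda>u. (a \<otimes>\<^sub>t (\<lambda>u. b (u @ [x]))) u + b [] * a (u @ [x]))" for x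
    by (simp add: tmult_snoc fun_eq_iff)
  let ?L = "\<lambda>k l. shuffle_eval a (take k w) (take l v)"
  have "shuffle_eval (a \<otimes>\<^sub>t b) (w @ [i]) (v @ [j]) =
      shuffle_eval (a \<otimes>\<^sub>t ?bi) w (v @ [j]) + shuffle_eval (a \<otimes>\<^sub>t ?bj) (w @ [i]) v
      + b [] * shuffle_eval a (w @ [i]) (v @ [j])"
    by (simp only: shuffle_eval_snoc s shuffle_eval_linear) (simp add: algebra_simps)
  also have "shuffle_eval (a \<otimes>\<^sub>t ?bi) w (v @ [j]) =
     (\<Sum>k\<le>length w. \<Sum>l\<le>length v. ?L k l * shuffle_eval ?bi (drop k w) (drop l v @ [j]))
     + (\<Sum>k\<le>length w. shuffle_eval a (take k w) (v @ [j]) * b (drop k w @ [i]))"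
    by (simp add: 3 sum.distrib)
  also have "shuffle_eval (a \<otimes>\<^sub>t ?bj) (w @ [i]) v =
     (\<Sum>k\<le>length w. \<Sum>l\<le>length v. ?L k l * shuffle_eval ?bj (drop k w @ [i]) (drop l v))
     + (\<Sum>l\<le>length v. shuffle_eval a (w @ [i]) (take l v) * b (drop l v @ [j]))"
    by (simp add: 3 sum.distrib)
  finally show ?case
    by (simp add: sum.distrib shuffle_eval_snoc algebra_simps)
qed

section \<open>Group-like series, one level at a time\<close>

definition grouplike_upto :: "nat \<Rightarrow> 'a tseries \<Rightarrow> bool" where
  "grouplike_upto n a \<longleftrightarrow> a [] = 1 \<and>
     (\<forall>w v. length w + length v \<le> n \<longrightarrow> shuffle_eval a w v = a w * a v)"

lemma grouplike_upto_mono: "grouplike_upto n a \<Longrightarrow> m \<le> n \<Longrightarrow> grouplike_upto m a"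
  by (auto simp: grouplike_upto_def)

lemma grouplike_upto_cong:
  assumes "grouplike_upto n a" "\<And>w. length w \<le> n \<Longrightarrow> a w = b w"
  shows "grouplike_upto n b"
  using assms(1) unfolding grouplike_upto_def
  by (auto simp: assms(2)[symmetric] intro!: trans[OF shuffle_eval_cong[of _ _ b a]])

text \<open>By bilinearity the character property can be tested on words, and
  \<open>a \<noteq> 0\<close> is exchanged for the normalisation \<open>a [] = 1\<close>. In this
  form it can be established one level at a time.\<close>

lemma grouplike_iff: "a \<in> grouplike \<longleftrightarrow> (\<forall>n. grouplike_upto n a)"
proof
  assume a: "a \<in> grouplike"
  have *: "shuffle_eval a w v = a w * a v" for w v
  proof -
    have "pairing (shuffle (Poly_Mapping.single w 1) (Poly_Mapping.single v 1)) a = a w * a v"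
      using a by (simp add: grouplike_def)
    then show ?thesis by (simp add: pairing_shuffle)
  qed
  have "a \<noteq> (\<lambda>w. 0)" using a by (simp add: grouplike_def)
  then obtain w where "a w \<noteq> 0" by auto
  \<comment> \<open>The empty word is the unit of the shuffle, so
    \<open>a w = a w * a []\<close>.\<close>
  with *[of w "[]"] have "a [] = 1" by simp
  with * show "\<forall>n. grouplike_upto n a" by (simp add: grouplike_upto_def)
next
  assume a: "\<forall>n. grouplike_upto n a"
  then have *: "shuffle_eval a w v = a w * a v" for w v
    unfolding grouplike_upto_def by blast
  have "pairing (shuffle l m) a = pairing l a * pairing m a" for l m
    unfolding pairing_shuffle * by (simp add: pairing_def sum_product algebra_simps)
  moreover have "a \<noteq> (\<lambda>w. 0)"
    using a by (auto simp: grouplike_upto_def dest: fun_cong[of _ _ "[]"])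
  ultimately show "a \<in> grouplike"
    by (simp add: grouplike_def)
qed

lemma grouplike_upto_tunit [simp]: "grouplike_upto n tunit"
proof -
  have "shuffle_eval tunit w v = tunit w * tunit v" for w v :: "'a list"
  proof (induction w v rule: shuffle_words.induct)
    case (3 w i v j)
    have "(\<lambda>u. tunit (u @ [x])) = (\<lambda>u. 0)" for x :: 'a by (simp add: tunit_def)
    then show ?case by (simp add: shuffle_eval_snoc) (simp add: shuffle_eval_def pairing_def tunit_def)
  qed (auto simp: tunit_def)
  then show ?thesis by (simp add: grouplike_upto_def)
qed

lemma tmult_product:
  "(a \<otimes>\<^sub>t b) w * (c \<otimes>\<^sub>t d) v =
     (\<Sum>k\<le>length w. \<Sum>l\<le>length v. (a (take k w) * c (take l v)) * (b (drop k w) * d (drop l v)))"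
  unfolding tmult_def sum_product by (intro sum.cong) (auto simp: algebra_simps)

lemma grouplike_upto_tmult:
  assumes "grouplike_upto n a" "grouplike_upto n b"
  shows "grouplike_upto n (a \<otimes>\<^sub>t b)"
  using assms unfolding grouplike_upto_def
  by (auto simp: shuffle_eval_tmult tmult_product intro!: sum.cong)

lemma sum_product_split_first:
  fixes f :: "nat \<Rightarrow> nat \<Rightarrow> real"
  shows "(\<Sum>k\<le>m. \<Sum>l\<le>n. f k l) = f 0 0 + (\<Sum>(k, l)\<in>{..m} \<times> {..n} - {(0, 0)}. f k l)"
proof -
  have "(\<Sum>k\<le>m. \<Sum>l\<le>n. f k l) = (\<Sum>(k, l)\<in>{..m} \<times> {..n}. f k l)"
    by (simp add: sum.cartesian_product)
  also have "\<dots> = f 0 0 + (\<Sum>(k, l)\<in>{..m} \<times> {..n} - {(0, 0)}. f k l)"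
    by (subst sum.remove[of _ "(0, 0)"]) auto
  finally show ?thesis .
qed

text \<open>The product \<open>a \<otimes>\<^sub>t tinv a\<close> is the unit, for which the shuffle
  identity holds. Expanded, both sides of that identity share the remainder \<open>S\<close>, since
  by induction the shuffle identity is known for the shorter suffixes; what is left over is the
  identity for \<open>tinv a\<close> at \<open>w\<close> and \<open>v\<close>.\<close>

lemma grouplike_upto_tinv:
  assumes a: "grouplike_upto n a"
  shows "grouplike_upto n (tinv a)"
proof -
  have a1: "a [] = 1" using a by (simp add: grouplike_upto_def)
  have "shuffle_eval (tinv a) w v = tinv a w * tinv a v" if "length w + length v \<le> n" for w v
    using that
  proof (induction "length w + length v" arbitrary: w v rule: less_induct)
    case less
    define I where "I = {..length w} \<times> {..length v} - {(0::nat, 0::nat)}"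
    define S where "S = (\<lambda>(k, l). a (take k w) * a (take l v) * (tinv a (drop k w) * tinv a (drop l v)))"
    have un: "shuffle_eval tunit w v = tunit w * tunit v"
      using grouplike_upto_tunit[of "length w + length v"] unfolding grouplike_upto_def by blast
    have sa: "shuffle_eval a (take k w) (take l v) = a (take k w) * a (take l v)" for k l
      using a less.prems by (simp add: grouplike_upto_def)
    have "shuffle_eval (a \<otimes>\<^sub>t tinv a) w v = shuffle_eval (tinv a) w v + (\<Sum>(k, l)\<in>I.
        shuffle_eval a (take k w) (take l v) * shuffle_eval (tinv a) (drop k w) (drop l v))"
      unfolding shuffle_eval_tmult I_def by (subst sum_product_split_first) (simp add: a1)
    also have "(\<Sum>(k, l)\<in>I. shuffle_eval a (take k w) (take l v) * shuffle_eval (tinv a) (drop k w) (drop l v))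
       = sum S I"
      unfolding S_def
      by (intro sum.cong refl) (use less in \<open>auto simp: I_def sa intro!: less(1)\<close>)
    finally have 1: "shuffle_eval (a \<otimes>\<^sub>t tinv a) w v = shuffle_eval (tinv a) w v + sum S I" .
    have "(a \<otimes>\<^sub>t tinv a) w * (a \<otimes>\<^sub>t tinv a) v = tinv a w * tinv a v + sum S I"
      unfolding tmult_product I_def S_def by (subst sum_product_split_first) (simp add: a1)
    with 1 un show ?case by (simp add: tinv_right[of a] a1)
  qed
  then show ?thesis by (simp add: grouplike_upto_def)
qed

text \<open>On the lowest level where the identity may fail, every splitting other than the two
  trivial ones involves only levels up to \<open>n\<close> and cancels. The failure therefore adds
  up under multiplication, so that along a path it behaves like an additive increment.\<close>

lemma shuffle_defect_tmult:
  assumes a: "grouplike_upto n a" and b: "grouplike_upto n b"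
    and l: "length w + length v = Suc n" and ne: "w \<noteq> []" "v \<noteq> []"
  shows "shuffle_eval (a \<otimes>\<^sub>t b) w v - (a \<otimes>\<^sub>t b) w * (a \<otimes>\<^sub>t b) v =
    (shuffle_eval a w v - a w * a v) + (shuffle_eval b w v - b w * b v)"
proof -
  have a1: "a [] = 1" and b1: "b [] = 1" using a b by (auto simp: grouplike_upto_def)
  let ?f = "\<lambda>k l. shuffle_eval a (take k w) (take l v) * shuffle_eval b (drop k w) (drop l v)
     - a (take k w) * a (take l v) * (b (drop k w) * b (drop l v))"
  have z: "?f k l = 0" if "k \<le> length w" "l \<le> length v" "(k, l) \<noteq> (0, 0)" "(k, l) \<noteq> (length w, length v)" for k l
  proof -
    have "shuffle_eval a (take k w) (take l v) = a (take k w) * a (take l v)"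
      using a that assms(3) by (auto simp: grouplike_upto_def)
    moreover have "shuffle_eval b (drop k w) (drop l v) = b (drop k w) * b (drop l v)"
      using b that assms(3) by (auto simp: grouplike_upto_def)
    ultimately show ?thesis by simp
  qed
  have "shuffle_eval (a \<otimes>\<^sub>t b) w v - (a \<otimes>\<^sub>t b) w * (a \<otimes>\<^sub>t b) v =
      (\<Sum>k\<le>length w. \<Sum>l\<le>length v. ?f k l)"
    by (simp add: shuffle_eval_tmult tmult_product sum_subtractf)
  also have "\<dots> = (\<Sum>(k, l)\<in>{..length w} \<times> {..length v}. ?f k l)"
    by (simp add: sum.cartesian_product)
  also have "\<dots> = (\<Sum>(k, l)\<in>{(0, 0), (length w, length v)}. ?f k l)"
    by (rule sum.mono_neutral_right) (auto intro: z simp del: right_minus_eq)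
  also have "\<dots> = ?f 0 0 + ?f (length w) (length v)"
    using ne by (subst sum.insert) auto
  finally show ?thesis by (simp add: a1 b1)
qed

section \<open>Truncation and group increments\<close>

lemma trunc_Nil [simp]: "trunc N a [] = a []"
  by (simp add: trunc_def)

lemma grouplike_trunc_upto: "a \<in> grouplike_trunc N \<Longrightarrow> grouplike_upto N a"
  unfolding grouplike_trunc_def
  by (erule imageE) (rule grouplike_upto_cong, auto simp: grouplike_iff trunc_def)

lemma grouplike_trunc_beyond: "a \<in> grouplike_trunc N \<Longrightarrow> length w > N \<Longrightarrow> a w = 0"
  by (auto simp: grouplike_trunc_def trunc_def)

lemma trunc_cong: "(\<And>w. length w \<le> N \<Longrightarrow> a w = b w) \<Longrightarrow> trunc N a = trunc N b"
  by (auto simp: trunc_def)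

lemma trunc_tunit [simp]: "trunc N tunit = tunit"
  by (auto simp: trunc_def tunit_def)

lemma trunc_tmult_trunc: "trunc N (trunc N a \<otimes>\<^sub>t b) = trunc N (a \<otimes>\<^sub>t b)"
   "trunc N (a \<otimes>\<^sub>t trunc N b) = trunc N (a \<otimes>\<^sub>t b)"
  by (rule trunc_cong, rule tmult_cong; simp add: trunc_def)+

text \<open>Truncation is compatible with the product, so the inverse can be computed in the full
  algebra. It stays in the truncated group because \<open>tinv\<close> preserves group-like series;
  uniqueness follows on multiplying by \<open>tinv a\<close> from the left.\<close>

lemma trunc_inv_eq:
  assumes "a \<in> grouplike_trunc N"
  shows "trunc_inv N a = trunc N (tinv a)"
proof -
  obtain g where g: "g \<in> grouplike" "a = trunc N g" using assms by (auto simp: grouplike_trunc_def)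
  have g1: "g [] = 1" and a1: "a [] = 1" using g by (auto simp: grouplike_iff grouplike_upto_def)
  have eq: "trunc N (tinv a) = trunc N (tinv g)"
    using g by (intro trunc_cong tinv_cong) (auto simp: trunc_def)
  show ?thesis unfolding trunc_inv_def
  proof (rule the_equality)
    have "trunc N (tinv g) \<in> grouplike_trunc N"
      using g grouplike_upto_tinv unfolding grouplike_trunc_def
      by (intro imageI) (auto simp: grouplike_iff)
    then show "trunc N (tinv a) \<in> grouplike_trunc N \<and>
        trunc N (a \<otimes>\<^sub>t trunc N (tinv a)) = tunit \<and> trunc N (trunc N (tinv a) \<otimes>\<^sub>t a) = tunit"
      by (simp add: eq[symmetric] trunc_tmult_trunc tinv_left tinv_right a1)
  next
    fix b assume b: "b \<in> grouplike_trunc N \<and> trunc N (a \<otimes>\<^sub>t b) = tunit \<and> trunc N (b \<otimes>\<^sub>t a) = tunit"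
    have "trunc N (tinv a) = trunc N (tinv a \<otimes>\<^sub>t trunc N (a \<otimes>\<^sub>t b))"
      using b by simp
    also have "\<dots> = trunc N b"
      by (simp add: trunc_tmult_trunc tmult_assoc[symmetric] tinv_left a1)
    also have "\<dots> = b" using b by (auto simp: trunc_def fun_eq_iff grouplike_trunc_beyond)
    finally show "b = trunc N (tinv a)" by simp
  qed
qed

text \<open>Increments are taken in the full algebra: a word of length \<open>k\<close> sees only
  the levels up to \<open>k\<close>, so no truncation has to be carried along. The link to
  \<open>incr\<close> is \<open>incr_eq\<close>.\<close>

definition group_incr :: "(real \<Rightarrow> 'a tseries) \<Rightarrow> real \<Rightarrow> real \<Rightarrow> 'a tseries" where
  "group_incr X s t = tinv (X s) \<otimes>\<^sub>t X t"

lemma incr_eq: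
  assumes "X s \<in> grouplike_trunc N"
  shows "incr N X s t = trunc N (group_incr X s t)"
  by (simp add: incr_def trunc_inv_eq[OF assms] trunc_tmult_trunc group_incr_def)

lemma tunit_grouplike_trunc [simp]: "tunit \<in> grouplike_trunc N"
  unfolding grouplike_trunc_def by (rule image_eqI[of _ _ tunit]) (auto simp: grouplike_iff)

lemma group_incr_Nil [simp]: "group_incr X s t [] = X t []"
  by (simp add: group_incr_def)

lemma group_incr_refl: "X s [] = 1 \<Longrightarrow> group_incr X s s = tunit"
  by (simp add: group_incr_def tinv_left)

lemma group_incr_start: "X s [] = 1 \<Longrightarrow> X s \<otimes>\<^sub>t group_incr X s t = X t"
  by (simp add: group_incr_def tmult_assoc[symmetric] tinv_right)

lemma group_incr_chen:
  "X u [] = 1 \<Longrightarrow> group_incr X s u \<otimes>\<^sub>t group_incr X u t = group_incr X s t"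
  by (simp add: group_incr_start tmult_assoc group_incr_def[of X s])

lemma group_incr_cong:
  assumes "\<And>v. length v \<le> length w \<Longrightarrow> X s v = Y s v" "\<And>v. length v \<le> length w \<Longrightarrow> X t v = Y t v"
  shows "group_incr X s t w = group_incr Y s t w"
  unfolding group_incr_def by (intro tmult_cong tinv_cong) (auto simp: assms)

lemma tmult_middle:
  assumes "a [] = 1" "b [] = 1" "w \<noteq> []"
  shows "(a \<otimes>\<^sub>t b) w = a w + b w + (\<Sum>k\<in>{1..<length w}. a (take k w) * b (drop k w))"
proof -
  have "{..length w} = insert 0 (insert (length w) {1..<length w})" by auto
  then show ?thesis using assms by (auto simp: tmult_def)
qed

text \<open>The top level enters a product only next to the coefficient 1 of the empty word, so a
  change made on that level alone changes increments additively. This is why a level can be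
  corrected by a scalar function of time for each word.\<close>

lemma group_incr_top:
  assumes "\<And>v. length v < length w \<Longrightarrow> X s v = Y s v" "\<And>v. length v < length w \<Longrightarrow> X t v = Y t v"
    and "X s [] = 1" "X t [] = 1" "w \<noteq> []" "Y s [] = 1" "Y t [] = 1"
  shows "group_incr X s t w - group_incr Y s t w = (X t w - Y t w) - (X s w - Y s w)"
proof -
  have *: "group_incr Z s t w = Z t w - Z s w - (\<Sum>k\<in>{1..<length w}. Z s (take k w) * group_incr Z s t (drop k w))"
    if "Z s [] = 1" "Z t [] = 1" for Z
    using arg_cong[OF group_incr_start[of Z s t], of "\<lambda>a. a w"] that assms(5) by (simp add: tmult_middle)
  have "(\<Sum>k\<in>{1..<length w}. X s (take k w) * group_incr X s t (drop k w)) =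
      (\<Sum>k\<in>{1..<length w}. Y s (take k w) * group_incr Y s t (drop k w))"
    by (intro sum.cong arg_cong2[of _ _ _ _ "(*)"] group_incr_cong) (auto simp: assms)
  then show ?thesis using *[of X] *[of Y] assms by simp
qed

section \<open>Sewing\<close>

fun chain_sum :: "(real \<Rightarrow> real \<Rightarrow> real) \<Rightarrow> real list \<Rightarrow> real" where
  "chain_sum F (x # y # xs) = F x y + chain_sum F (y # xs)"
| "chain_sum F _ = 0"

lemma chain_sum_nth: "chain_sum F D = (\<Sum>i<length D - 1. F (D ! i) (D ! Suc i))"
  by (induction F D rule: chain_sum.induct) (simp_all add: sum.lessThan_Suc_shift del: sum.lessThan_Suc)

lemma chain_sum_append:
  "chain_sum F (xs @ a # ys) = chain_sum F (xs @ [a]) + chain_sum F (a # ys)"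
proof (induction xs rule: induct_list012)
  case (2 x) then show ?case by (cases ys) auto
qed auto

lemma chain_sum_add: "chain_sum (\<lambda>x y. F x y + G x y) D = chain_sum F D + chain_sum G D"
  by (simp add: chain_sum_nth sum.distrib)

lemma chain_sum_cmult: "chain_sum (\<lambda>x y. c * F x y) D = c * chain_sum F D"
  by (simp add: chain_sum_nth sum_distrib_left)

lemma chain_sum_abs: "\<bar>chain_sum F D\<bar> \<le> chain_sum (\<lambda>x y. \<bar>F x y\<bar>) D"
  unfolding chain_sum_nth by (rule sum_abs)

lemma chain_sum_telescope: "D \<noteq> [] \<Longrightarrow> chain_sum (\<lambda>x y. h y - h x) D = h (last D) - h (hd D)"
  by (induction "\<lambda>x y::real. h y - h x" D rule: chain_sum.induct) auto

lemma chain_sum_nonneg: "(\<And>x y. F x y \<ge> 0) \<Longrightarrow> chain_sum F D \<ge> 0"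
  unfolding chain_sum_nth by (intro sum_nonneg) auto

definition mesh_le :: "real \<Rightarrow> real list \<Rightarrow> bool" where
  "mesh_le \<delta> D \<longleftrightarrow> (\<forall>i<length D - 1. D ! Suc i - D ! i \<le> \<delta>)"

lemma mesh_le_Cons [simp]: "mesh_le \<delta> (x # y # xs) \<longleftrightarrow> y - x \<le> \<delta> \<and> mesh_le \<delta> (y # xs)"
  by (auto simp: mesh_le_def less_Suc_eq_0_disj)

lemma mesh_le_single [simp]: "mesh_le \<delta> [x]"
  by (auto simp: mesh_le_def)

lemma partitions_mem:
  assumes "D \<in> partitions s t" "x \<in> set D"
  shows "s \<le> x" "x \<le> t"
proof -
  obtain i where i: "i < length D" "x = D ! i" using assms(2) by (auto simp: in_set_conv_nth)
  have st: "sorted D" using assms(1) by (simp add: partitions_def strict_sorted_imp_sorted)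
  have "D ! 0 \<le> D ! i" by (rule sorted_nth_mono[OF st]) (use i in auto)
  moreover have "D ! i \<le> D ! (length D - 1)" by (rule sorted_nth_mono[OF st]) (use i in auto)
  ultimately show "s \<le> x" "x \<le> t"
    using i assms(1) by (auto simp: partitions_def hd_conv_nth last_conv_nth)
qed

lemma partitions_le: "D \<in> partitions s t \<Longrightarrow> s \<le> t"
  using partitions_mem(2)[of D s t "hd D"] by (auto simp: partitions_def)

lemma partitions_Cons [simp]:
  "x # y # xs \<in> partitions s t \<longleftrightarrow> x = s \<and> s < y \<and> y # xs \<in> partitions y t"
  by (auto simp: partitions_def intro: order_less_trans)

lemma partitions_single [simp]: "[x] \<in> partitions s t \<longleftrightarrow> x = s \<and> t = s"
  by (auto simp: partitions_def)

lemma partitions_nth: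
  assumes "D \<in> partitions s t" "i < length D - 1"
  shows "s \<le> D ! i" "D ! i < D ! Suc i" "D ! Suc i \<le> t"
  using assms partitions_mem[OF assms(1)]
  by (auto simp: partitions_def sorted_wrt_iff_nth_less)

lemma chain_sum_mono:
  assumes "D \<in> partitions s t" "\<And>x y. s \<le> x \<Longrightarrow> x < y \<Longrightarrow> y \<le> t \<Longrightarrow> F x y \<le> G x y"
  shows "chain_sum F D \<le> chain_sum G D"
  unfolding chain_sum_nth
  by (intro sum_mono assms(2) partitions_nth[OF assms(1)]) auto

lemma chain_sum_mono_mesh:
  assumes "D \<in> partitions s t" "mesh_le \<delta> D"
    "\<And>x y. s \<le> x \<Longrightarrow> x < y \<Longrightarrow> y \<le> t \<Longrightarrow> y - x \<le> \<delta> \<Longrightarrow> F x y \<le> G x y"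
  shows "chain_sum F D \<le> chain_sum G D"
  unfolding chain_sum_nth
  by (intro sum_mono assms(3) partitions_nth[OF assms(1)]) (use assms(2) in \<open>auto simp: mesh_le_def\<close>)

lemma partitions_append:
  assumes "xs @ [a] \<in> partitions s a" "a # ys \<in> partitions a t"
  shows "xs @ a # ys \<in> partitions s t"
  using assms
proof (induction xs arbitrary: s rule: induct_list012)
  case 1 then show ?case by simp
next
  case (2 x) then show ?case by simp
next
  case (3 x y zs) then show ?case by simp
qed

lemma partitions_split:
  assumes "xs @ a # ys \<in> partitions s t"
  shows "xs @ [a] \<in> partitions s a" "a # ys \<in> partitions a t"
proof -
  have "xs @ [a] \<in> partitions s a \<and> a # ys \<in> partitions a t"
    using assms
  proof (induction xs arbitrary: s rule: induct_list012)
    case 1 then show ?case by (auto simp: partitions_def)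
  next
    case (2 x) then show ?case by auto
  next
    case (3 x y zs) then show ?case by auto
  qed
  then show "xs @ [a] \<in> partitions s a" "a # ys \<in> partitions a t" by auto
qed

lemma partitions_eq_refl: "D \<in> partitions s s \<Longrightarrow> D = [s]"
proof (induction D rule: induct_list012)
  case (3 x y zs) then show ?case using partitions_le[of "y # zs" y s] by auto
qed (auto simp: partitions_def)

lemma uniform_partition:
  fixes s t :: real
  assumes "s \<le> t" "\<delta> > 0"
  shows "\<exists>D\<in>partitions s t. mesh_le \<delta> D"
proof -
  have "\<exists>D\<in>partitions s t. mesh_le \<delta> D" if "t - s \<le> real n * \<delta>" "s \<le> t" for n t
    using that
  proof (induction n arbitrary: t)
    case 0
    then have "s = t" by simp
    then show ?case by (intro bexI[of _ "[s]"]) auto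
  next
    case (Suc n)
    show ?case
    proof (cases "t - s \<le> \<delta>")
      case True
      then show ?thesis using Suc.prems
        by (cases "s = t") (force intro: bexI[of _ "[s]"], force intro!: bexI[of _ "[s, t]"])
    next
      case False
      then obtain D where D: "D \<in> partitions s (t - \<delta>)" "mesh_le \<delta> D"
        using Suc.IH[of "t - \<delta>"] Suc.prems by (auto simp: algebra_simps)
      obtain xs where xs: "D = xs @ [t - \<delta>]"
        using D(1) by (cases D rule: rev_cases) (auto simp: partitions_def)
      have "xs @ (t - \<delta>) # [t] \<in> partitions s t"
        by (rule partitions_append) (use D xs assms in auto)
      moreover have "mesh_le \<delta> (xs @ (t - \<delta>) # [t])"
        using D(2) unfolding xs by (induction xs rule: induct_list012) auto
      ultimately show ?thesis by blast
    qed
  qed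
  moreover obtain n :: nat where "(t - s) / \<delta> \<le> real n" using real_arch_simple by blast
  ultimately show ?thesis using assms by (auto simp: field_simps)
qed

lemma mesh_le_append:
  "mesh_le \<delta> (xs @ [a]) \<Longrightarrow> mesh_le \<delta> (a # ys) \<Longrightarrow> mesh_le \<delta> (xs @ a # ys)"
  by (induction xs rule: induct_list012) auto

lemma common_refinement:
  assumes "D \<in> partitions s t" "E \<in> partitions s t"
  shows "sorted_list_of_set (set D \<union> set E) \<in> partitions s t"
proof -
  let ?L = "sorted_list_of_set (set D \<union> set E)"
  have m: "s \<in> set D" "t \<in> set D" using assms(1) by (auto simp: partitions_def)
  have set: "set ?L = set D \<union> set E" by simp
  then have ne: "?L \<noteq> []" using m by (metis UnCI empty_iff empty_set)
  have st: "sorted ?L" by simp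
  have lo: "\<forall>x\<in>set ?L. s \<le> x \<and> x \<le> t"
    using partitions_mem assms unfolding set by blast
  have "hd ?L \<le> s"
    using sorted_nth_mono[OF st, of 0] m(1) set ne
    by (metis (no_types, lifting) UnCI hd_conv_nth in_set_conv_nth le0)
  moreover have "t \<le> last ?L"
  proof -
    obtain i where "i < length ?L" "?L ! i = t" using m(2) set by (metis UnCI in_set_conv_nth)
    then show ?thesis using sorted_nth_mono[OF st, of i "length ?L - 1"] ne by (simp add: last_conv_nth)
  qed
  ultimately have "hd ?L = s" "last ?L = t"
    using lo ne by (meson antisym hd_in_set last_in_set)+
  then show ?thesis using ne by (auto simp: partitions_def)
qed

section \<open>Controls and sewing\<close>

definition superadditive :: "real \<Rightarrow> (real \<Rightarrow> real \<Rightarrow> real) \<Rightarrow> bool" where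
  "superadditive T \<omega> \<longleftrightarrow> (\<forall>s t. 0 \<le> s \<and> s \<le> t \<and> t \<le> T \<longrightarrow> 0 \<le> \<omega> s t) \<and>
     (\<forall>s u t. 0 \<le> s \<and> s \<le> u \<and> u \<le> t \<and> t \<le> T \<longrightarrow> \<omega> s u + \<omega> u t \<le> \<omega> s t)"

lemma superadditiveD:
  assumes "superadditive T \<omega>"
  shows "0 \<le> s \<Longrightarrow> s \<le> t \<Longrightarrow> t \<le> T \<Longrightarrow> 0 \<le> \<omega> s t"
    and "0 \<le> s \<Longrightarrow> s \<le> u \<Longrightarrow> u \<le> t \<Longrightarrow> t \<le> T \<Longrightarrow> \<omega> s u + \<omega> u t \<le> \<omega> s t"
  using assms by (auto simp: superadditive_def)

lemma superadditive_mono: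
  assumes "superadditive T \<omega>" "0 \<le> s'" "s' \<le> s" "s \<le> t" "t \<le> t'" "t' \<le> T"
  shows "\<omega> s t \<le> \<omega> s' t'"
  using superadditiveD(1)[OF assms(1), of s' s] superadditiveD(1)[OF assms(1), of t t']
    superadditiveD(2)[OF assms(1), of s' s t'] superadditiveD(2)[OF assms(1), of s t t'] assms
  by auto

lemma superadditive_chain_sum:
  assumes w: "superadditive T \<omega>" and D: "D \<in> partitions s t" and "0 \<le> s" "t \<le> T"
  shows "chain_sum \<omega> D \<le> \<omega> s t"
  using D \<open>0 \<le> s\<close>
proof (induction D arbitrary: s rule: induct_list012)
  case (2 x)
  then show ?case using superadditiveD(1)[OF w, of s t] \<open>t \<le> T\<close> by auto
next
  case (3 x y xs)
  have "y \<le> t" using 3 by (auto dest: partitions_le)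
  moreover have "chain_sum \<omega> (y # xs) \<le> \<omega> y t" using 3 by auto
  ultimately show ?case
    using superadditiveD(2)[OF w, of s y t] 3(3,4) \<open>t \<le> T\<close> by auto
qed (auto simp: partitions_def)

text \<open>One factor \<open>\<omega> x y\<close> is kept for superadditivity, and the remaining
  power, with exponent \<open>\<theta> - 1 \<ge> 0\<close>, is bounded by its value on
  \<open>[s,t]\<close>.\<close>

lemma superadditive_chain_sum_powr:
  assumes w: "superadditive T \<omega>" and D: "D \<in> partitions s t" and st: "0 \<le> s" "t \<le> T" and "\<theta> \<ge> 1"
  shows "chain_sum (\<lambda>x y. \<omega> x y powr \<theta>) D \<le> \<omega> s t powr \<theta>"
proof -
  have "s \<le> t" using D by (rule partitions_le)
  have "chain_sum (\<lambda>x y. \<omega> x y powr \<theta>) D \<le> chain_sum (\<lambda>x y. \<omega> s t powr (\<theta> - 1) * \<omega> x y) D"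
  proof (rule chain_sum_mono[OF D])
    fix x y assume xy: "s \<le> x" "x < y" "y \<le> t"
    have n: "0 \<le> \<omega> x y" using xy st by (intro superadditiveD(1)[OF w]) auto
    have "\<omega> x y powr \<theta> = \<omega> x y powr (\<theta> - 1) * \<omega> x y"
      using n by (cases "\<omega> x y = 0") (auto simp: powr_mult_base[symmetric] powr_diff)
    also have "\<dots> \<le> \<omega> s t powr (\<theta> - 1) * \<omega> x y"
      using superadditive_mono[OF w, of s x y t] xy st n \<open>\<theta> \<ge> 1\<close>
      by (intro mult_right_mono powr_mono2) auto
    finally show "\<omega> x y powr \<theta> \<le> \<omega> s t powr (\<theta> - 1) * \<omega> x y" .
  qed
  also have "\<dots> = \<omega> s t powr (\<theta> - 1) * chain_sum \<omega> D" by (rule chain_sum_cmult)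
  also have "\<dots> \<le> \<omega> s t powr (\<theta> - 1) * \<omega> s t"
    by (intro mult_left_mono superadditive_chain_sum[OF w D st]) auto
  also have "\<dots> = \<omega> s t powr \<theta>"
    using superadditiveD(1)[OF w, of s t] st \<open>s \<le> t\<close>
    by (cases "\<omega> s t = 0") (auto simp: powr_mult_base[symmetric] powr_diff)
  finally show ?thesis .
qed

text \<open>
  A partition is cut at the first point past half of the control; the two outer pieces then carry at most
  half of it each, and \<open>2 (1/2)\<^sup>\<theta> < 1\<close> lets the constant reproduce itself.
\<close>

definition sewing_const :: "real \<Rightarrow> real" where
  "sewing_const \<theta> = 2 / (1 - 2 powr (1 - \<theta>))"

lemma sewing_const_pos: "\<theta> > 1 \<Longrightarrow> sewing_const \<theta> > 0"
  by (simp add: sewing_const_def powr_less_one)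

lemma sewing_maximal_inequality:
  assumes w: "superadditive T \<omega>" and "\<theta> > 1" and "C \<ge> 0"
    and D: "D \<in> partitions s t" and st: "0 \<le> s" "t \<le> T"
    and diag: "\<And>x. \<Xi> x x = 0"
    and \<Xi>: "\<And>x u y. s \<le> x \<Longrightarrow> x \<le> u \<Longrightarrow> u \<le> y \<Longrightarrow> y \<le> t \<Longrightarrow>
        \<bar>\<Xi> x y - \<Xi> x u - \<Xi> u y\<bar> \<le> C * \<omega> x y powr \<theta>"
  shows "\<bar>chain_sum \<Xi> D - \<Xi> s t\<bar> \<le> C * sewing_const \<theta> * \<omega> s t powr \<theta>"
  using D st \<Xi>
proof (induction "length D" arbitrary: D s t rule: less_induct)
  case less
  note D = \<open>D \<in> partitions s t\<close>
  have K: "sewing_const \<theta> > 0" by (rule sewing_const_pos) fact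
  define W where "W = \<omega> s t"
  have "s \<le> t" using D by (rule partitions_le)
  have W: "W \<ge> 0" unfolding W_def using less.prems \<open>s \<le> t\<close> by (intro superadditiveD(1)[OF w]) auto
  show ?case
  proof (cases "s = t")
    case True
    then have "D = [t]" using D partitions_eq_refl by blast
    then show ?thesis using True \<open>C \<ge> 0\<close> K diag by simp
  next
    case False
    with \<open>s \<le> t\<close> have "s < t" by simp
    \<comment> \<open>The alternative \<open>x = t\<close> guarantees a cut point also when
      \<open>W = 0\<close>, where \<open>t\<close> is not past half of the control.\<close>
    let ?P = "\<lambda>x. x \<noteq> s \<and> (\<omega> s x > W / 2 \<or> x = t)"
    have "\<exists>x\<in>set D. ?P x"
      using D False by (intro bexI[of _ t]) (auto simp: partitions_def)
    then obtain xs b zs where b: "D = xs @ b # zs" "?P b" "\<forall>x\<in>set xs. \<not> ?P x"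
      by (rule split_list_first_propE)
    have "xs \<noteq> []" using b D by (auto simp: partitions_def)
    then obtain ys a where xs: "xs = ys @ [a]" by (metis rev_exhaust)
    have a: "\<not> ?P a" using b(3) xs by simp
    have D': "D = ys @ a # (b # zs)" using b xs by simp
    have p1: "ys @ [a] \<in> partitions s a" and p2: "a # b # zs \<in> partitions a t"
      using partitions_split[of ys a "b # zs" s t] D D' by auto
    have p3: "b # zs \<in> partitions b t" and ab: "a < b" using p2 by auto
    have sa: "s \<le> a" and bt: "b \<le> t" using p1 p3 partitions_le by auto
    have wsa: "\<omega> s a \<le> W / 2 \<or> s = a" using a sa by auto
    have cs: "chain_sum \<Xi> D = chain_sum \<Xi> (ys @ [a]) + \<Xi> a b + chain_sum \<Xi> (b # zs)"
      unfolding D' by (subst chain_sum_append) simp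
    let ?h = "(W / 2) powr \<theta>" and ?K = "C * sewing_const \<theta>"
    have h0: "?K * ?h \<ge> 0" using \<open>C \<ge> 0\<close> K by simp
    have 1: "\<bar>chain_sum \<Xi> (ys @ [a]) - \<Xi> s a\<bar> \<le> ?K * ?h"
    proof (cases "s = a")
      case True
      then have "ys @ [a] = [a]" using p1 partitions_eq_refl by blast
      then show ?thesis using h0 True diag by simp
    next
      case False
      have "\<bar>chain_sum \<Xi> (ys @ [a]) - \<Xi> s a\<bar> \<le> ?K * \<omega> s a powr \<theta>"
        by (rule less.hyps[OF _ p1]) (use less.prems ab bt in \<open>auto simp: D'\<close>)
      also have "\<dots> \<le> ?K * ?h"
        using wsa False \<open>C \<ge> 0\<close> K less.prems sa ab bt \<open>\<theta> > 1\<close>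
        by (intro mult_left_mono powr_mono2 superadditiveD(1)[OF w]) auto
      finally show ?thesis .
    qed
    have 2: "\<bar>chain_sum \<Xi> (b # zs) - \<Xi> b t\<bar> \<le> ?K * ?h"
    proof (cases "b = t")
      case True
      then have "b # zs = [b]" using p3 partitions_eq_refl by blast
      then show ?thesis using h0 True diag by simp
    next
      case False
      then have "\<omega> b t \<le> W / 2"
        using superadditiveD(2)[OF w, of s b t] less.prems sa ab bt b(2) by (auto simp: W_def)
      have "\<bar>chain_sum \<Xi> (b # zs) - \<Xi> b t\<bar> \<le> ?K * \<omega> b t powr \<theta>"
        by (rule less.hyps[OF _ p3]) (use less.prems sa ab in \<open>auto simp: D'\<close>)
      also have "\<dots> \<le> ?K * ?h"
        using \<open>\<omega> b t \<le> W / 2\<close> \<open>C \<ge> 0\<close> K less.prems sa ab bt \<open>\<theta> > 1\<close>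
        by (intro mult_left_mono powr_mono2 superadditiveD(1)[OF w]) auto
      finally show ?thesis .
    qed
    \<comment> \<open>Inserting \<open>a\<close> into \<open>[s,t]\<close> and then \<open>b\<close>
      into \<open>[a,t]\<close> costs one defect each; these two are the 2 in
      \<open>sewing_const\<close>.\<close>
    have 3: "\<bar>\<Xi> s t - \<Xi> s a - \<Xi> a t\<bar> \<le> C * W powr \<theta>"
      unfolding W_def using less.prems sa ab bt by (intro less.prems) auto
    have "\<bar>\<Xi> a t - \<Xi> a b - \<Xi> b t\<bar> \<le> C * \<omega> a t powr \<theta>"
      using less.prems sa ab bt by (intro less.prems) auto
    also have "\<dots> \<le> C * W powr \<theta>"
      unfolding W_def using \<open>C \<ge> 0\<close> less.prems sa ab bt \<open>\<theta> > 1\<close>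
      by (intro mult_left_mono powr_mono2 superadditiveD(1)[OF w] superadditive_mono[OF w]) auto
    finally have 4: "\<bar>\<Xi> a t - \<Xi> a b - \<Xi> b t\<bar> \<le> C * W powr \<theta>" .
    have "\<bar>chain_sum \<Xi> D - \<Xi> s t\<bar> \<le> 2 * (?K * ?h) + 2 * (C * W powr \<theta>)"
      using 1 2 3 4 unfolding cs by linarith
    also have "\<dots> = ?K * W powr \<theta>"
    proof -
      \<comment> \<open>The constant is the fixed point of \<open>K = K * q + 2\<close>, where
        \<open>q = 2 * (1 / 2) powr \<theta>\<close> is the factor contributed by the two outer
        pieces.\<close>
      define q where "q = 2 powr (1 - \<theta>)"
      have "q < 1" unfolding q_def using \<open>\<theta> > 1\<close> by (simp add: powr_less_one)
      then have S: "sewing_const \<theta> * q + 2 = sewing_const \<theta>"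
        unfolding sewing_const_def q_def[symmetric] by (simp add: divide_simps)
      have h: "?h = W powr \<theta> * q / 2"
        using W by (simp add: q_def powr_divide powr_diff)
      have "2 * (?K * ?h) + 2 * (C * W powr \<theta>) = C * W powr \<theta> * (sewing_const \<theta> * q + 2)"
        unfolding h by (simp add: algebra_simps)
      then show ?thesis unfolding S by (simp only: mult_ac)
    qed
    finally show ?thesis by (simp add: W_def)
  qed
qed


text \<open>The maximal inequality is applied in each cell of \<open>D\<close>, and the cells are
  summed by superadditivity. No interval longer than the mesh of \<open>D\<close> is ever split,
  hence the defect bound is asked for on short intervals only.\<close>

lemma refinement_bound:
  assumes w: "superadditive T \<omega>" and th: "\<theta> > 1" and C: "C \<ge> 0"
    and D: "D \<in> partitions s t" and E: "E \<in> partitions s t" and sub: "set D \<subseteq> set E"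
    and mesh: "mesh_le \<delta> D" and st: "0 \<le> s" "t \<le> T"
    and diag: "\<And>x. \<Xi> x x = 0"
    and \<Xi>: "\<And>x u y. 0 \<le> x \<Longrightarrow> x \<le> u \<Longrightarrow> u \<le> y \<Longrightarrow> y \<le> T \<Longrightarrow> y - x \<le> \<delta> \<Longrightarrow>
        \<bar>\<Xi> x y - \<Xi> x u - \<Xi> u y\<bar> \<le> C * \<omega> x y powr \<theta>"
  shows "\<bar>chain_sum \<Xi> E - chain_sum \<Xi> D\<bar> \<le> C * sewing_const \<theta> * \<omega> s t powr \<theta>"
proof -
  have K: "sewing_const \<theta> > 0" by (rule sewing_const_pos) fact
  have "\<bar>chain_sum \<Xi> E - chain_sum \<Xi> D\<bar> \<le> chain_sum (\<lambda>x y. C * sewing_const \<theta> * \<omega> x y powr \<theta>) D"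
    using D E sub mesh st(1)
  proof (induction D arbitrary: s E rule: induct_list012)
    case 1
    then show ?case by (simp add: partitions_def)
  next
    case (2 x)
    then have "E = [x]" by (auto dest: partitions_eq_refl)
    then show ?case by simp
  next
    case (3 x y xs)
    from 3 have xs: "x = s" "s < y" "y # xs \<in> partitions y t" by auto
    have yt: "y \<le> t" using xs(3) by (rule partitions_le)
    have "y \<in> set E" using 3 by auto
    then obtain as bs where E: "E = as @ y # bs" by (meson split_list)
    have p: "as @ [y] \<in> partitions s y" "y # bs \<in> partitions y t"
      using partitions_split[of as y bs s t] 3 E by auto
    have "z \<notin> set as" if "z \<in> set (y # xs)" for z
    proof -
      have "y \<le> z" using that partitions_mem(1)[OF xs(3)] by auto
      moreover have "z < y" if "z \<in> set as"
        using p(1) that by (auto simp: partitions_def sorted_wrt_append)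
      ultimately show ?thesis by auto
    qed
    then have sub: "set (y # xs) \<subseteq> set (y # bs)" using 3 unfolding E by auto
    have 1: "\<bar>chain_sum \<Xi> (y # bs) - chain_sum \<Xi> (y # xs)\<bar> \<le>
        chain_sum (\<lambda>x y. C * sewing_const \<theta> * \<omega> x y powr \<theta>) (y # xs)"
      by (rule "3.IH"(2)[OF xs(3) p(2) sub]) (use 3 xs in auto)
    have 2: "\<bar>chain_sum \<Xi> (as @ [y]) - \<Xi> s y\<bar> \<le> C * sewing_const \<theta> * \<omega> s y powr \<theta>"
      by (rule sewing_maximal_inequality[OF w th C p(1)])
        (use 3 yt st diag xs in \<open>auto intro!: \<Xi>\<close>)
    have "chain_sum \<Xi> E = chain_sum \<Xi> (as @ [y]) + chain_sum \<Xi> (y # bs)"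
      unfolding E by (rule chain_sum_append)
    then show ?case using 1 2 xs(1) by simp
  qed
  also have "\<dots> = C * sewing_const \<theta> * chain_sum (\<lambda>x y. \<omega> x y powr \<theta>) D"
    by (rule chain_sum_cmult)
  also have "\<dots> \<le> C * sewing_const \<theta> * \<omega> s t powr \<theta>"
    using C K th by (intro mult_left_mono superadditive_chain_sum_powr[OF w D st]) auto
  finally show ?thesis .
qed

text \<open>The constant in front of the control becomes small on short intervals. This stands in
  for a continuous control: it brings chain sums of small mesh close to each other, while
  \<open>\<theta> > 1\<close> keeps the accumulated error bounded.\<close>

definition small_defect :: "real \<Rightarrow> (real \<Rightarrow> real \<Rightarrow> real) \<Rightarrow> real \<Rightarrow> (real \<Rightarrow> real \<Rightarrow> real) \<Rightarrow> bool" where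
  "small_defect T \<omega> \<theta> \<Xi> \<longleftrightarrow> (\<forall>\<epsilon>>0. \<exists>\<delta>>0. \<forall>x u y. 0 \<le> x \<and> x \<le> u \<and> u \<le> y \<and> y \<le> T \<and> y - x \<le> \<delta> \<longrightarrow>
     \<bar>\<Xi> x y - \<Xi> x u - \<Xi> u y\<bar> \<le> \<epsilon> * \<omega> x y powr \<theta>)"

text \<open>Two fine partitions are compared through their common refinement. Either comparison
  costs \<open>e * A\<close>, where \<open>A\<close> does not depend on the partitions and
  \<open>e\<close> is small with the mesh.\<close>

lemma chain_sum_Cauchy:
  assumes w: "superadditive T \<omega>" and th: "\<theta> > 1" and small: "small_defect T \<omega> \<theta> \<Xi>"
    and diag: "\<And>x. \<Xi> x x = 0" and st: "0 \<le> s" "s \<le> t" "t \<le> T" and "\<epsilon> > 0"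
  shows "\<exists>\<delta>>0. \<forall>D\<in>partitions s t. \<forall>E\<in>partitions s t. mesh_le \<delta> D \<and> mesh_le \<delta> E \<longrightarrow>
    \<bar>chain_sum \<Xi> D - chain_sum \<Xi> E\<bar> \<le> \<epsilon>"
proof -
  have K: "sewing_const \<theta> > 0" by (rule sewing_const_pos) fact
  define A where "A = sewing_const \<theta> * \<omega> s t powr \<theta>"
  have A: "A \<ge> 0" using K by (simp add: A_def)
  define e where "e = \<epsilon> / (2 * (A + 1))"
  have e: "e > 0" "2 * (e * A) \<le> \<epsilon>" using A \<open>\<epsilon> > 0\<close> by (auto simp: e_def field_simps)
  obtain \<delta> where d: "\<delta> > 0" "\<And>x u y. 0 \<le> x \<Longrightarrow> x \<le> u \<Longrightarrow> u \<le> y \<Longrightarrow> y \<le> T \<Longrightarrow> y - x \<le> \<delta> \<Longrightarrow>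
     \<bar>\<Xi> x y - \<Xi> x u - \<Xi> u y\<bar> \<le> e * \<omega> x y powr \<theta>"
    using small e(1) unfolding small_defect_def by meson
  have "\<bar>chain_sum \<Xi> D - chain_sum \<Xi> E\<bar> \<le> \<epsilon>"
    if "D \<in> partitions s t" "E \<in> partitions s t" "mesh_le \<delta> D" "mesh_le \<delta> E" for D E
  proof -
    let ?F = "sorted_list_of_set (set D \<union> set E)"
    have F: "?F \<in> partitions s t" using that by (intro common_refinement)
    have "\<bar>chain_sum \<Xi> ?F - chain_sum \<Xi> D\<bar> \<le> e * sewing_const \<theta> * \<omega> s t powr \<theta>"
      by (rule refinement_bound[OF w th _ that(1) F _ that(3)]) (use e d diag st in auto)
    moreover have "\<bar>chain_sum \<Xi> ?F - chain_sum \<Xi> E\<bar> \<le> e * sewing_const \<theta> * \<omega> s t powr \<theta>"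
      by (rule refinement_bound[OF w th _ that(2) F _ that(4)]) (use e d diag st in auto)
    ultimately show ?thesis using e(2) unfolding A_def by (simp add: mult.assoc)
  qed
  then show ?thesis using d(1) by blast
qed

text \<open>Chain sums converge by the Cauchy property, and concatenating partitions makes the
  limits \<open>I s t\<close> additive. They are therefore the increments of \<open>I 0 t\<close>,
  which is normalised to vanish at 0.\<close>

lemma sewing:
  assumes w: "superadditive T \<omega>" and th: "\<theta> > 1" and small: "small_defect T \<omega> \<theta> \<Xi>"
    and diag: "\<And>x. \<Xi> x x = 0"
  shows "\<exists>h. h 0 = 0 \<and> (\<forall>s t \<epsilon>. 0 \<le> s \<and> s \<le> t \<and> t \<le> T \<and> \<epsilon> > 0 \<longrightarrow>
    (\<exists>\<delta>>0. \<forall>D\<in>partitions s t. mesh_le \<delta> D \<longrightarrow> \<bar>chain_sum \<Xi> D - (h t - h s)\<bar> \<le> \<epsilon>))"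
proof -
  have "\<exists>I. \<forall>\<epsilon>>0. \<exists>\<delta>>0. \<forall>D\<in>partitions s t. mesh_le \<delta> D \<longrightarrow> \<bar>chain_sum \<Xi> D - I\<bar> \<le> \<epsilon>"
    if st: "0 \<le> s" "s \<le> t" "t \<le> T" for s t
  proof -
    have "\<exists>D. D \<in> partitions s t \<and> mesh_le (1 / real (Suc n)) D" for n
      using uniform_partition[OF st(2), of "1 / real (Suc n)"] by auto
    then obtain D where D: "\<And>n. D n \<in> partitions s t" "\<And>n. mesh_le (1 / real (Suc n)) (D n)"
      by metis
    have mono: "mesh_le d E" if "mesh_le d' E" "d' \<le> d" for d d' E
      using that by (force simp: mesh_le_def)
    have fine: "\<exists>n0. \<forall>n\<ge>n0. mesh_le d (D n)" if "d > 0" for d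
    proof -
      obtain n0 where n0: "1 / real (Suc n0) < d" using reals_Archimedean[OF \<open>d > 0\<close>] by (auto simp: inverse_eq_divide)
      have "mesh_le d (D n)" if "n \<ge> n0" for n
      proof (rule mono[OF D(2)])
        have "1 / real (Suc n) \<le> 1 / real (Suc n0)" using that by (intro divide_left_mono) auto
        then show "1 / real (Suc n) \<le> d" using n0 by simp
      qed
      then show ?thesis by blast
    qed
    have "Cauchy (\<lambda>n. chain_sum \<Xi> (D n))"
    proof (rule metric_CauchyI)
      fix e :: real assume "e > 0"
      then obtain d where d: "d > 0" "\<And>D E. D\<in>partitions s t \<Longrightarrow> E\<in>partitions s t \<Longrightarrow> mesh_le d D \<Longrightarrow> mesh_le d E \<Longrightarrow>
          \<bar>chain_sum \<Xi> D - chain_sum \<Xi> E\<bar> \<le> e / 2"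
        using chain_sum_Cauchy[OF w th small diag st, of "e / 2"] by auto
      obtain n0 where n0: "\<And>n. n \<ge> n0 \<Longrightarrow> mesh_le d (D n)" using fine[OF d(1)] by auto
      have "dist (chain_sum \<Xi> (D m)) (chain_sum \<Xi> (D n)) < e" if "m \<ge> n0" "n \<ge> n0" for m n
        using d(2)[OF D(1)[of m] D(1)[of n] n0[OF that(1)] n0[OF that(2)]] \<open>e > 0\<close> by (simp add: dist_real_def)
      then show "\<exists>M. \<forall>m\<ge>M. \<forall>n\<ge>M. dist (chain_sum \<Xi> (D m)) (chain_sum \<Xi> (D n)) < e" by blast
    qed
    then obtain I where I: "(\<lambda>n. chain_sum \<Xi> (D n)) \<longlonglongrightarrow> I"
      using Cauchy_convergent convergent_def by blast
    have "\<exists>\<delta>>0. \<forall>D\<in>partitions s t. mesh_le \<delta> D \<longrightarrow> \<bar>chain_sum \<Xi> D - I\<bar> \<le> \<epsilon>" if "\<epsilon> > 0" for \<epsilon>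
    proof -
      obtain d where d: "d > 0" "\<And>D E. D\<in>partitions s t \<Longrightarrow> E\<in>partitions s t \<Longrightarrow> mesh_le d D \<Longrightarrow> mesh_le d E \<Longrightarrow>
          \<bar>chain_sum \<Xi> D - chain_sum \<Xi> E\<bar> \<le> \<epsilon>"
        using chain_sum_Cauchy[OF w th small diag st \<open>\<epsilon> > 0\<close>] by auto
      obtain n0 where n0: "\<And>n. n \<ge> n0 \<Longrightarrow> mesh_le d (D n)" using fine[OF d(1)] by auto
      have "\<bar>chain_sum \<Xi> E - I\<bar> \<le> \<epsilon>" if E: "E \<in> partitions s t" "mesh_le d E" for E
      proof (rule LIMSEQ_le_const2)
        show "(\<lambda>n. \<bar>chain_sum \<Xi> E - chain_sum \<Xi> (D n)\<bar>) \<longlonglongrightarrow> \<bar>chain_sum \<Xi> E - I\<bar>"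
          by (intro tendsto_intros I)
        show "\<exists>N. \<forall>n\<ge>N. \<bar>chain_sum \<Xi> E - chain_sum \<Xi> (D n)\<bar> \<le> \<epsilon>"
          using d(2)[OF E(1) D(1) E(2) n0] by blast
      qed
      then show ?thesis using d(1) by blast
    qed
    then show ?thesis by blast
  qed
  then obtain I where I: "\<And>s t \<epsilon>. 0 \<le> s \<Longrightarrow> s \<le> t \<Longrightarrow> t \<le> T \<Longrightarrow> \<epsilon> > 0 \<Longrightarrow>
      \<exists>\<delta>>0. \<forall>D\<in>partitions s t. mesh_le \<delta> D \<longrightarrow> \<bar>chain_sum \<Xi> D - I s t\<bar> \<le> \<epsilon>"
    by metis
  have add: "I 0 s + I s t = I 0 t" if st: "0 \<le> s" "s \<le> t" "t \<le> T" for s t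
  proof -
    have "\<bar>I 0 s + I s t - I 0 t\<bar> \<le> e" if "e > 0" for e
    proof -
      have e3: "e / 3 > 0" using that by simp
      obtain d1 where d1: "d1 > 0" "\<And>D. D \<in> partitions 0 s \<Longrightarrow> mesh_le d1 D \<Longrightarrow> \<bar>chain_sum \<Xi> D - I 0 s\<bar> \<le> e / 3"
        using I[of 0 s "e / 3"] st e3 by auto
      obtain d2 where d2: "d2 > 0" "\<And>D. D \<in> partitions s t \<Longrightarrow> mesh_le d2 D \<Longrightarrow> \<bar>chain_sum \<Xi> D - I s t\<bar> \<le> e / 3"
        using I[of s t "e / 3"] st e3 by auto
      obtain d3 where d3: "d3 > 0" "\<And>D. D \<in> partitions 0 t \<Longrightarrow> mesh_le d3 D \<Longrightarrow> \<bar>chain_sum \<Xi> D - I 0 t\<bar> \<le> e / 3"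
        using I[of 0 t "e / 3"] st e3 by auto
      let ?d = "min d1 (min d2 d3)"
      obtain D where D: "D \<in> partitions 0 s" "mesh_le ?d D"
        using uniform_partition[of 0 s ?d] st d1 d2 d3 by auto
      obtain E where E: "E \<in> partitions s t" "mesh_le ?d E"
        using uniform_partition[of s t ?d] st d1 d2 d3 by auto
      obtain xs where xs: "D = xs @ [s]" using D(1) by (cases D rule: rev_cases) (auto simp: partitions_def)
      obtain ys where ys: "E = s # ys" using E(1) by (cases E) (auto simp: partitions_def)
      have p: "xs @ s # ys \<in> partitions 0 t" using D(1) E(1) unfolding xs ys by (rule partitions_append)
      have m: "mesh_le ?d (xs @ s # ys)" using D(2) E(2) unfolding xs ys by (rule mesh_le_append)
      have ml: "mesh_le d1 D" "mesh_le d2 E" "mesh_le d3 (xs @ s # ys)"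
        using D(2) E(2) m by (auto simp: mesh_le_def)
      show ?thesis
        using d1(2)[OF D(1) ml(1)] d2(2)[OF E(1) ml(2)] d3(2)[OF p ml(3)] chain_sum_append[of \<Xi> xs s ys]
        unfolding xs ys by linarith
    qed
    then have "\<bar>I 0 s + I s t - I 0 t\<bar> \<le> 0" by (rule field_le_epsilon[of _ 0, simplified])
    then show ?thesis by simp
  qed
  have "(I 0 t - I 0 0) - (I 0 s - I 0 0) = I s t" if "0 \<le> s" "s \<le> t" "t \<le> T" for s t
    using add[OF that] by simp
  then show ?thesis
    by (intro exI[of _ "\<lambda>t. I 0 t - I 0 0"]) (use I in simp)
qed

text \<open>The maximal inequality holds with the same bound for every partition and so survives in
  the limit. The limit is a hypothesis here, so that the bound is available for exponents and
  constants other than those which produced it.\<close>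

lemma sewing_bound:
  assumes lim: "\<And>\<epsilon>. \<epsilon> > 0 \<Longrightarrow> \<exists>\<delta>>0. \<forall>D\<in>partitions s t. mesh_le \<delta> D \<longrightarrow> \<bar>chain_sum \<Xi> D - I\<bar> \<le> \<epsilon>"
    and w: "superadditive T \<omega>" and th: "\<theta> > 1" and C: "C \<ge> 0"
    and st: "0 \<le> s" "s \<le> t" "t \<le> T" and diag: "\<And>x. \<Xi> x x = 0"
    and \<Xi>: "\<And>x u y. s \<le> x \<Longrightarrow> x \<le> u \<Longrightarrow> u \<le> y \<Longrightarrow> y \<le> t \<Longrightarrow>
        \<bar>\<Xi> x y - \<Xi> x u - \<Xi> u y\<bar> \<le> C * \<omega> x y powr \<theta>"
  shows "\<bar>I - \<Xi> s t\<bar> \<le> C * sewing_const \<theta> * \<omega> s t powr \<theta>"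
proof (rule field_le_epsilon)
  fix e :: real assume "e > 0"
  then obtain d where d: "d > 0" "\<And>D. D \<in> partitions s t \<Longrightarrow> mesh_le d D \<Longrightarrow> \<bar>chain_sum \<Xi> D - I\<bar> \<le> e"
    using lim by blast
  obtain D where D: "D \<in> partitions s t" "mesh_le d D" using uniform_partition[OF st(2) d(1)] by auto
  have "\<bar>chain_sum \<Xi> D - \<Xi> s t\<bar> \<le> C * sewing_const \<theta> * \<omega> s t powr \<theta>"
    by (rule sewing_maximal_inequality[OF w th C D(1) st(1,3) diag \<Xi>])
  then show "\<bar>I - \<Xi> s t\<bar> \<le> C * sewing_const \<theta> * \<omega> s t powr \<theta> + e"
    using d(2)[OF D] by linarith
qed

text \<open>Telescoping over a fine partition bounds \<open>h t - h 0\<close> by an arbitrarily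
  small multiple of \<open>\<omega> 0 t powr \<theta>\<close>.\<close>

lemma sewing_uniqueness:
  assumes w: "superadditive T \<omega>" and th: "\<theta> \<ge> 1" and t: "0 \<le> t" "t \<le> T"
    and small: "\<And>\<epsilon>. \<epsilon> > 0 \<Longrightarrow> \<exists>\<delta>>0. \<forall>x y. 0 \<le> x \<and> x < y \<and> y \<le> T \<and> y - x \<le> \<delta> \<longrightarrow>
       \<bar>h y - h x\<bar> \<le> \<epsilon> * \<omega> x y powr \<theta>"
  shows "h t = (h 0 :: real)"
proof -
  define A where "A = \<omega> 0 t powr \<theta>"
  have "\<bar>h t - h 0\<bar> \<le> 0 + e" if "e > 0" for e
  proof -
    have A: "A \<ge> 0" by (simp add: A_def)
    then have e: "e / (A + 1) > 0" "e / (A + 1) * A \<le> e" using that by (auto simp: field_simps)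
    obtain d where d: "d > 0" "\<And>x y. 0 \<le> x \<Longrightarrow> x < y \<Longrightarrow> y \<le> T \<Longrightarrow> y - x \<le> d \<Longrightarrow>
       \<bar>h y - h x\<bar> \<le> e / (A + 1) * \<omega> x y powr \<theta>" using small[OF e(1)] by auto
    obtain D where D: "D \<in> partitions 0 t" "mesh_le d D" using uniform_partition[OF t(1) d(1)] by auto
    have "\<bar>h t - h 0\<bar> = \<bar>chain_sum (\<lambda>x y. h y - h x) D\<bar>"
      using D(1) by (subst chain_sum_telescope) (auto simp: partitions_def)
    also have "\<dots> \<le> chain_sum (\<lambda>x y. \<bar>h y - h x\<bar>) D" by (rule chain_sum_abs)
    also have "\<dots> \<le> chain_sum (\<lambda>x y. e / (A + 1) * \<omega> x y powr \<theta>) D"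
      by (rule chain_sum_mono_mesh[OF D]) (use d t in auto)
    also have "\<dots> = e / (A + 1) * chain_sum (\<lambda>x y. \<omega> x y powr \<theta>) D" by (rule chain_sum_cmult)
    also have "\<dots> \<le> e / (A + 1) * A"
      unfolding A_def using e t th A_def
      by (intro mult_left_mono superadditive_chain_sum_powr[OF w D(1)]) auto
    finally show ?thesis using e(2) by simp
  qed
  then have "\<bar>h t - h 0\<bar> \<le> 0" by (rule field_le_epsilon)
  then show ?thesis by simp
qed

section \<open>Signatures of piecewise smooth paths\<close>

lemma has_RS_integral_unique:
  assumes "has_RS_integral f g a b I" "has_RS_integral f g a b J"
  shows "I = J"
proof -
  have "\<bar>I - J\<bar> \<le> 0 + e" if "e > 0" for e
  proof -
    have e2: "e / 2 > 0" using that by simp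
    let ?S = "\<lambda>P. \<Sum>(x, K)\<in>P. f x * (g (Sup K) - g (Inf K))"
    obtain d1 where d1: "d1 > 0" "\<And>P. P tagged_division_of {a..b} \<Longrightarrow> (\<lambda>x. ball x d1) fine P \<Longrightarrow> \<bar>?S P - I\<bar> < e / 2"
      using assms(1) e2 unfolding has_RS_integral_def by meson
    obtain d2 where d2: "d2 > 0" "\<And>P. P tagged_division_of {a..b} \<Longrightarrow> (\<lambda>x. ball x d2) fine P \<Longrightarrow> \<bar>?S P - J\<bar> < e / 2"
      using assms(2) e2 unfolding has_RS_integral_def by meson
    have "gauge (\<lambda>x. ball x (min d1 d2))" using d1 d2 by (intro gauge_ball) auto
    then obtain P where P: "P tagged_division_of {a..b}" "(\<lambda>x. ball x (min d1 d2)) fine P"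
      by (rule fine_division_exists_real)
    have f: "(\<lambda>x. ball x d1) fine P" "(\<lambda>x. ball x d2) fine P"
      using P(2) unfolding fine_def by (fastforce simp: subset_eq)+
    show ?thesis using d1(2)[OF P(1) f(1)] d2(2)[OF P(1) f(2)] by linarith
  qed
  then have "\<bar>I - J\<bar> \<le> 0" by (rule field_le_epsilon)
  then show ?thesis by simp
qed

lemma RS_integral_eq: "has_RS_integral f g a b I \<Longrightarrow> RS_integral f g a b = I"
  unfolding RS_integral_def by (blast intro: has_RS_integral_unique)

lemma RS_integral_refl: "RS_integral f g a a = 0"
proof (rule RS_integral_eq)
  have "(\<Sum>(x, K)\<in>P. f x * (g (Sup K) - g (Inf K))) = 0" if P: "P tagged_division_of {a..a}" for P
  proof (rule sum.neutral, clarify)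
    fix x K assume "(x, K) \<in> P"
    then have "x \<in> K" "K \<subseteq> {a}" using tagged_division_ofD(2,3)[OF P] by auto
    then have "K = {a}" by auto
    then show "f x * (g (Sup K) - g (Inf K)) = 0" by simp
  qed
  then show "has_RS_integral f g a a 0"
    unfolding has_RS_integral_def by (auto intro!: exI[of _ 1])
qed

text \<open>A density is asked for, not a derivative: its integral over every subinterval is
  prescribed, while its values at single points are free up to boundedness. Thus the pieces of a
  piecewise smooth path can be glued without regard to the break points.\<close>

definition bounded_density :: "real \<Rightarrow> real \<Rightarrow> (real \<Rightarrow> real) \<Rightarrow> (real \<Rightarrow> real) \<Rightarrow> bool" where
  "bounded_density a b g g' \<longleftrightarrow> (\<exists>L. \<forall>u\<in>{a..b}. \<bar>g' u\<bar> \<le> L) \<and>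
     (\<forall>x y. a \<le> x \<and> x \<le> y \<and> y \<le> b \<longrightarrow> (g' has_integral g y - g x) {x..y})"

lemma bounded_density_product_integrable:
  assumes "bounded_density a b g g'" "continuous_on {a..b} f" "a \<le> x" "x \<le> y" "y \<le> b"
  shows "(\<lambda>u. f u * g' u) integrable_on {x..y}"
proof -
  obtain L where L: "\<forall>u\<in>{a..b}. \<bar>g' u\<bar> \<le> L" using assms by (auto simp: bounded_density_def)
  have c: "continuous_on {x..y} f" by (rule continuous_on_subset[OF assms(2)]) (use assms in auto)
  have "(\<lambda>u. f u * g' u) absolutely_integrable_on {x..y}"
  proof (rule absolutely_integrable_bounded_measurable_product_real)
    show "f \<in> borel_measurable (lebesgue_on {x..y})"
      by (rule continuous_imp_measurable_on_sets_lebesgue[OF c]) auto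
    show "bounded (f ` {x..y})" by (intro compact_imp_bounded compact_continuous_image c) auto
    have "g' integrable_on {x..y}" using assms by (auto simp: bounded_density_def)
    then show "g' absolutely_integrable_on {x..y}"
      by (rule absolutely_integrable_integrable_bound[of _ _ "\<lambda>_. L", rotated]) (use L assms in auto)
  qed auto
  then show ?thesis by (rule set_lebesgue_integral_eq_integral(1))
qed

text \<open>On a cell with tag \<open>x\<close> the error is the integral of
  \<open>(f x - f u) * g' u\<close>. Uniform continuity of \<open>f\<close> bounds it by
  \<open>c * L\<close> times the length of the cell, and the lengths add up to
  \<open>b - a\<close>.\<close>

lemma has_RS_integral_density:
  assumes g: "bounded_density a b g g'" and f: "continuous_on {a..b} f" and "a \<le> b"
  shows "has_RS_integral f g a b (integral {a..b} (\<lambda>u. f u * g' u))"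
  unfolding has_RS_integral_def
proof (intro allI impI)
  fix e :: real assume "e > 0"
  obtain L where L: "\<And>u. u \<in> {a..b} \<Longrightarrow> \<bar>g' u\<bar> \<le> L" using g unfolding bounded_density_def by blast
  have L0: "L \<ge> 0" using L[of a] \<open>a \<le> b\<close> by auto
  \<comment> \<open>The added ones keep the denominator positive and make the inequality
    \<open>c * L * (b - a) < e\<close> strict.\<close>
  define c where "c = e / ((L + 1) * (b - a + 1))"
  have pos: "(L + 1) * (b - a + 1) > 0" using L0 \<open>a \<le> b\<close> by simp
  have c0: "c > 0" using pos \<open>e > 0\<close> by (simp add: c_def)
  have "L * (b - a) < (L + 1) * (b - a + 1)"
    using L0 \<open>a \<le> b\<close> by (intro mult_strict_mono) auto
  then have "c * L * (b - a) < c * ((L + 1) * (b - a + 1))"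
    using c0 by (simp only: mult.assoc mult_less_cancel_left_pos)
  also have "\<dots> = e" using pos L0 \<open>a \<le> b\<close> by (auto simp: c_def)
  finally have ce: "c * L * (b - a) < e" .
  have "uniformly_continuous_on {a..b} f" using f by (intro compact_uniformly_continuous) auto
  then obtain d where d: "d > 0" "\<And>x x'. x \<in> {a..b} \<Longrightarrow> x' \<in> {a..b} \<Longrightarrow> dist x' x < d \<Longrightarrow> dist (f x') (f x) < c"
    unfolding uniformly_continuous_on_def using c0 by metis
  have "\<bar>(\<Sum>(x, K)\<in>P. f x * (g (Sup K) - g (Inf K))) - integral {a..b} (\<lambda>u. f u * g' u)\<bar> < e"
    if P: "P tagged_division_of {a..b}" and fine: "(\<lambda>x. ball x d) fine P" for P
  proof -
    have int: "(\<lambda>u. f u * g' u) integrable_on {a..b}"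
      using bounded_density_product_integrable[OF g f] \<open>a \<le> b\<close> by simp
    have "integral {a..b} (\<lambda>u. f u * g' u) = (\<Sum>(x, K)\<in>P. integral K (\<lambda>u. f u * g' u))"
      using integral_combine_tagged_division_topdown[of "\<lambda>u. f u * g' u" a b P] int P by simp
    then have "\<bar>(\<Sum>(x, K)\<in>P. f x * (g (Sup K) - g (Inf K))) - integral {a..b} (\<lambda>u. f u * g' u)\<bar>
      = \<bar>\<Sum>(x, K)\<in>P. f x * (g (Sup K) - g (Inf K)) - integral K (\<lambda>u. f u * g' u)\<bar>"
      by (simp add: sum_subtractf case_prod_unfold)
    also have "\<dots> \<le> (\<Sum>(x, K)\<in>P. \<bar>f x * (g (Sup K) - g (Inf K)) - integral K (\<lambda>u. f u * g' u)\<bar>)"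
      by (rule order_trans[OF sum_abs]) (simp add: case_prod_unfold)
    also have "\<dots> \<le> (\<Sum>(x, K)\<in>P. c * L * measure lborel K)"
    proof (rule sum_mono, clarify)
      fix x K assume xK: "(x, K) \<in> P"
      obtain l r where K: "K = {l..r}" using tagged_division_ofD(4)[OF P xK] by auto
      have x: "x \<in> {l..r}" "K \<subseteq> {a..b}" using tagged_division_ofD(2,3)[OF P xK] K by auto
      then have lr: "l \<le> r" "a \<le> l" "r \<le> b" using K by auto
      have K_ball: "K \<subseteq> ball x d" using fine xK by (auto simp: fine_def)
      have gi: "(g' has_integral g r - g l) {l..r}" using g lr by (auto simp: bounded_density_def)
      have fi: "(\<lambda>u. f u * g' u) integrable_on {l..r}"
        using bounded_density_product_integrable[OF g f] lr by simp
      have "((\<lambda>u. f x * g' u - f u * g' u) has_integral f x * (g r - g l) - integral {l..r} (\<lambda>u. f u * g' u)) {l..r}"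
        using gi fi by (intro has_integral_diff has_integral_mult_right integrable_integral)
      then have "norm (f x * (g r - g l) - integral {l..r} (\<lambda>u. f u * g' u)) \<le> c * L * measure lborel {l..r}"
      proof (rule has_integral_bound_real[rotated 2])
        fix u assume u: "u \<in> {l..r} - {}"
        then have "dist u x < d" using K_ball K by (auto simp: dist_commute)
        then have "\<bar>f x - f u\<bar> \<le> c"
          using d(2)[of x u] u x K lr by (auto simp: dist_real_def abs_minus_commute)
        moreover have "\<bar>g' u\<bar> \<le> L" using L u lr by auto
        ultimately show "norm (f x * g' u - f u * g' u) \<le> c * L"
          using c0 by (simp add: left_diff_distrib[symmetric] abs_mult mult_mono)
      qed (use c0 L0 in auto)
      then show "\<bar>f x * (g (Sup K) - g (Inf K)) - integral K (\<lambda>u. f u * g' u)\<bar> \<le> c * L * measure lborel K"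
        using K lr by simp
    qed
    also have "\<dots> = c * L * (b - a)"
      using additive_content_tagged_division[of P a b] P \<open>a \<le> b\<close>
      by (simp add: sum_distrib_left[symmetric] case_prod_unfold)
    finally show ?thesis using ce by simp
  qed
  then show "\<exists>\<delta>>0. \<forall>P. P tagged_division_of {a..b} \<and> (\<lambda>x. ball x \<delta>) fine P \<longrightarrow>
      \<bar>(\<Sum>(x, K)\<in>P. f x * (g (Sup K) - g (Inf K))) - integral {a..b} (\<lambda>u. f u * g' u)\<bar> < e"
    using d(1) by blast
qed

lemma bounded_density_glue:
  assumes 1: "bounded_density a c g g1" and 2: "bounded_density c b g g2" and "a \<le> c" "c \<le> b"
  shows "bounded_density a b g (\<lambda>u. if u \<le> c then g1 u else g2 u)"
  unfolding bounded_density_def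
proof (intro conjI allI impI)
  let ?h = "\<lambda>u. if u \<le> c then g1 u else g2 u"
  obtain L1 L2 where "\<forall>u\<in>{a..c}. \<bar>g1 u\<bar> \<le> L1" "\<forall>u\<in>{c..b}. \<bar>g2 u\<bar> \<le> L2"
    using 1 2 by (auto simp: bounded_density_def)
  then show "\<exists>L. \<forall>u\<in>{a..b}. \<bar>?h u\<bar> \<le> L"
    by (intro exI[of _ "max L1 L2"]) (auto simp: le_max_iff_disj)
  have l: "(?h has_integral g y - g x) {x..y}" if "a \<le> x" "x \<le> y" "y \<le> c" for x y
    using 1 that by (intro has_integral_spike_finite[of "{}" _ ?h g1]) (auto simp: bounded_density_def)
  have r: "(?h has_integral g y - g x) {x..y}" if "c \<le> x" "x \<le> y" "y \<le> b" for x y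
    using 2 that by (intro has_integral_spike_finite[of "{c}" _ ?h g2]) (auto simp: bounded_density_def)
  fix x y assume xy: "a \<le> x \<and> x \<le> y \<and> y \<le> b"
  consider "y \<le> c" | "c \<le> x" | "x \<le> c" "c \<le> y" by linarith
  then show "(?h has_integral g y - g x) {x..y}"
  proof cases
    case 3
    then have "(?h has_integral (g c - g x) + (g y - g c)) {x..y}"
      using xy by (intro has_integral_combine[of x c y] l r) auto
    then show ?thesis by simp
  qed (use xy l r in auto)
qed

lemma smooth_bounded_density:
  fixes f :: "real \<Rightarrow> real ^ 'd"
  assumes "smooth_on_interval a b f"
  shows "\<exists>g'. bounded_density a b (\<lambda>t. f t $ j) g'"
proof -
  obtain D where D: "\<And>t. t \<in> {a..b} \<Longrightarrow> D 0 t = f t"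
    "\<And>n t. t \<in> {a..b} \<Longrightarrow> (D n has_vector_derivative D (Suc n) t) (at t within {a..b})"
    using assms unfolding smooth_on_interval_def by blast
  have comp: "((\<lambda>t. D n t $ j) has_vector_derivative D (Suc n) t $ j) (at t within {a..b})"
    if "t \<in> {a..b}" for n t
    using bounded_linear.has_vector_derivative[OF bounded_linear_vec_nth D(2)[OF that]] .
  have "continuous_on {a..b} (\<lambda>t. D 1 t $ j)"
    by (auto simp: continuous_on_eq_continuous_within intro!: has_vector_derivative_continuous comp)
  then have "bounded ((\<lambda>t. D 1 t $ j) ` {a..b})"
    by (intro compact_imp_bounded compact_continuous_image) auto
  then have "\<exists>L. \<forall>u\<in>{a..b}. \<bar>D 1 u $ j\<bar> \<le> L" by (auto simp: bounded_iff)
  moreover have "((\<lambda>t. D 1 t $ j) has_integral f y $ j - f x $ j) {x..y}"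
    if "a \<le> x" "x \<le> y" "y \<le> b" for x y
  proof -
    have "((\<lambda>t. D 1 t $ j) has_integral D 0 y $ j - D 0 x $ j) {x..y}"
      using comp[of _ 0] that
      by (intro fundamental_theorem_of_calculus)
        (auto intro!: has_vector_derivative_within_subset[of _ _ _ "{a..b}" "{x..y}"])
    then show ?thesis using that D(1) by simp
  qed
  ultimately have "bounded_density a b (\<lambda>t. f t $ j) (\<lambda>t. D 1 t $ j)"
    by (simp add: bounded_density_def)
  then show ?thesis by blast
qed

lemma piecewise_smooth_bounded_density:
  fixes f :: "real \<Rightarrow> real ^ 'd"
  assumes "piecewise_smooth T f"
  shows "\<exists>g'. bounded_density 0 T (\<lambda>t. f t $ j) g'"
proof -
  obtain D where D: "D \<in> partitions 0 T" "\<forall>i<length D - 1. smooth_on_interval (D ! i) (D ! Suc i) f"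
    using assms by (auto simp: piecewise_smooth_def)
  have "\<exists>g'. bounded_density s T (\<lambda>t. f t $ j) g'"
    if "sorted_wrt (<) D" "D \<noteq> []" "hd D = s" "last D = T"
      "\<forall>i<length D - 1. smooth_on_interval (D ! i) (D ! Suc i) f" for s
    using that
  proof (induction D arbitrary: s rule: induct_list012)
    case (2 x)
    have "u = v" if "s \<le> u" "u \<le> v" "v \<le> T" for u v using 2 that by auto
    then have "bounded_density s T (\<lambda>t. f t $ j) (\<lambda>_. 0)"
      unfolding bounded_density_def by (metis abs_zero cancel_comm_monoid_add_class.diff_cancel has_integral_0 order_refl)
    then show ?case by blast
  next
    case (3 x y zs)
    have "\<exists>g'. bounded_density y T (\<lambda>t. f t $ j) g'"
      by (rule 3(2)) (use 3(3-) in \<open>force+\<close>)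
    moreover have "smooth_on_interval x y f" using 3(7) by force
    then have "\<exists>g'. bounded_density x y (\<lambda>t. f t $ j) g'" by (rule smooth_bounded_density)
    moreover have "x \<le> y" "y \<le> T" "x = s"
      using 3(3-6) by (auto split: if_splits) (meson last_in_set less_imp_le)+
    ultimately show ?case using bounded_density_glue by blast
  qed simp
  then show ?thesis using D by (auto simp: partitions_def)
qed

lemma bounded_density_ident: "bounded_density a b (\<lambda>s. s) (\<lambda>_. 1)"
  unfolding bounded_density_def
proof (intro conjI allI impI)
  fix x y :: real assume "a \<le> x \<and> x \<le> y \<and> y \<le> b"
  then show "((\<lambda>_. 1) has_integral y - x) {x..y}"
    using has_integral_const_real[of "1::real" x y] by simp
qed auto

lemma time_augment_bounded_density:
  fixes Z :: "real \<Rightarrow> real ^ 'd"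
  assumes "piecewise_smooth T Z"
  shows "\<exists>g'. bounded_density 0 T (\<lambda>s. time_augment Z s $ i) g'"
proof (cases i)
  case None
  have "bounded_density 0 T (\<lambda>s. time_augment Z s $ i) (\<lambda>_. 1)"
    using bounded_density_ident[of 0 T] by (simp add: None time_augment_def)
  then show ?thesis by blast
next
  case (Some j)
  then show ?thesis
    using piecewise_smooth_bounded_density[OF assms, of j] by (simp add: time_augment_def)
qed

section \<open>Iterated integrals and the time letter\<close>

lemma iterated_integral_continuous:
  assumes "\<And>i. \<exists>g'. bounded_density 0 T (\<lambda>s. Z s $ i) g'"
  shows "continuous_on {0..T} (iterated_integral Z w)"
proof (induction w)
  case (Cons i w)
  obtain g' where g': "bounded_density 0 T (\<lambda>s. Z s $ i) g'" using assms by blast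
  have "iterated_integral Z (i # w) t = integral {0..t} (\<lambda>u. iterated_integral Z w u * g' u)"
    if "t \<in> {0..T}" for t
    unfolding iterated_integral.simps
  proof (intro RS_integral_eq has_RS_integral_density)
    show "bounded_density 0 t (\<lambda>s. Z s $ i) g'" using g' that by (fastforce simp: bounded_density_def)
    show "continuous_on {0..t} (iterated_integral Z w)"
      by (rule continuous_on_subset[OF Cons.IH]) (use that in auto)
  qed (use that in auto)
  moreover have "continuous_on {0..T} (\<lambda>t. integral {0..t} (\<lambda>u. iterated_integral Z w u * g' u))"
  proof (cases "0 \<le> T")
    case True
    then show ?thesis
      by (intro indefinite_integral_continuous_1 bounded_density_product_integrable[OF g' Cons.IH]) auto
  qed auto
  ultimately show ?case by (subst continuous_on_cong[OF refl]) auto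
qed simp

text \<open>The last letter belongs to the outermost integral, and the time component has density
  1.\<close>

lemma bv_signature_time_letter:
  fixes Z :: "real \<Rightarrow> real ^ 'd"
  assumes Z: "piecewise_smooth T Z" and t: "t \<in> {0..T}"
  shows "bv_signature (time_augment Z) t (w @ [None]) = integral {0..t} (\<lambda>u. bv_signature (time_augment Z) u w)"
proof -
  have c: "continuous_on {0..T} (iterated_integral (time_augment Z) (rev w))"
    by (rule iterated_integral_continuous) (rule time_augment_bounded_density[OF Z])
  have "bounded_density 0 t (\<lambda>s. time_augment Z s $ None) (\<lambda>_. 1)"
    using bounded_density_ident[of 0 t] by (simp add: time_augment_def)
  then have "has_RS_integral (iterated_integral (time_augment Z) (rev w)) (\<lambda>s. time_augment Z s $ None) 0 t
     (integral {0..t} (\<lambda>u. iterated_integral (time_augment Z) (rev w) u * 1))"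
    by (rule has_RS_integral_density[OF _ continuous_on_subset[OF c]]) (use t in auto)
  then show ?thesis by (simp add: bv_signature_def RS_integral_eq)
qed

lemma bv_signature_start: "bv_signature Z 0 = tunit"
proof
  fix w show "bv_signature Z 0 w = tunit w"
    by (cases w rule: rev_cases) (auto simp: bv_signature_def tunit_def RS_integral_refl)
qed

lemma bv_signature_continuous:
  fixes Z :: "real \<Rightarrow> real ^ 'd"
  assumes Z: "piecewise_smooth T Z"
  shows "continuous_on {0..T} (\<lambda>t. bv_signature (time_augment Z) t w)"
  unfolding bv_signature_def using iterated_integral_continuous time_augment_bounded_density[OF Z] by blast

section \<open>From the p-variation distance to uniform closeness\<close>

lemma finite_words: "finite {w :: 'a::finite list. length w = k}"
  using finite_lists_length_eq[of "UNIV :: 'a set" k] by simp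

lemma level_norm_ge: "length w = k \<Longrightarrow> \<bar>a w\<bar> \<le> level_norm k a"
  unfolding level_norm_def by (intro Max_ge) (auto simp: finite_words)

lemma level_norm_nonneg: "level_norm k a \<ge> 0"
  using level_norm_ge[of "replicate k undefined" k a] by (meson abs_ge_zero length_replicate order_trans)

lemma level_norm_le: "(\<And>w. length w = k \<Longrightarrow> \<bar>a w\<bar> \<le> B) \<Longrightarrow> level_norm k a \<le> B"
proof -
  have "{\<bar>a w\<bar> |w. length w = k} \<noteq> {}" using length_replicate[of k undefined] by blast
  then show "(\<And>w. length w = k \<Longrightarrow> \<bar>a w\<bar> \<le> B) \<Longrightarrow> level_norm k a \<le> B"
    unfolding level_norm_def by (subst Max_le_iff) (auto simp: finite_words)
qed

lemma pvar_norm_bound_increment: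
  assumes "pvar_norm p N s u A < ennreal e" "p > 0" "1 \<le> length w" "length w \<le> N"
    and D: "D \<in> partitions s u" "i < length D - 1"
  shows "\<bar>A (D ! i) (D ! Suc i) w\<bar> < e"
proof -
  define k where "k = length w"
  let ?f = "\<lambda>i. level_norm k (A (D ! i) (D ! Suc i)) powr (p / real k)"
  have k: "k \<ge> 1" "k \<in> {1..N}" using assms by (auto simp: k_def)
  have "ennreal ((\<Sum>i<length D - 1. ?f i) powr (real k / p)) \<le> pvar_norm p N s u A"
    unfolding pvar_norm_def using k D by (intro SUP_upper2[of k] SUP_upper2[of D]) auto
  then have "ennreal ((\<Sum>i<length D - 1. ?f i) powr (real k / p)) < ennreal e"
    using assms(1) by (rule order.strict_trans1)
  then have lt: "(\<Sum>i<length D - 1. ?f i) powr (real k / p) < e"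
    by (subst (asm) ennreal_less_iff) auto
  have "?f i \<le> (\<Sum>i<length D - 1. ?f i)" using D by (intro member_le_sum) auto
  then have "?f i powr (real k / p) \<le> (\<Sum>i<length D - 1. ?f i) powr (real k / p)"
    using assms by (intro powr_mono2) auto
  moreover have "?f i powr (real k / p) = level_norm k (A (D ! i) (D ! Suc i))"
    using k assms level_norm_nonneg[of k "A (D ! i) (D ! Suc i)"] by (simp add: powr_powr)
  moreover have "\<bar>A (D ! i) (D ! Suc i) w\<bar> \<le> level_norm k (A (D ! i) (D ! Suc i))"
    by (rule level_norm_ge) (simp add: k_def)
  ultimately show ?thesis using lt by linarith
qed

lemma incr_from_start:
  assumes "X 0 = tunit" "length w \<le> N"
  shows "incr N X 0 t w = X t w"
  using assms by (simp add: incr_eq trunc_def group_incr_def)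

text \<open>Both paths start at the unit, so their values at \<open>t\<close> are increments over
  \<open>[0,t]\<close>, and the difference of these is dominated by the distance.\<close>

lemma Omega_hat_approx:
  fixes X :: "real \<Rightarrow> 'd::finite option tseries"
  assumes "X \<in> Omega_hat p T" "p \<ge> 1" "T > 0" "e > 0"
  obtains Z :: "real \<Rightarrow> real ^ 'd" where "piecewise_smooth T Z"
    "\<And>t w. t \<in> {0..T} \<Longrightarrow> length w \<le> nat \<lfloor>p\<rfloor> \<Longrightarrow> \<bar>X t w - bv_signature (time_augment Z) t w\<bar> < e"
proof -
  define N where "N = nat \<lfloor>p\<rfloor>"
  have XP: "X \<in> pvar_paths p N T" using assms by (simp add: Omega_hat_def N_def Let_def)
  then have X0: "X 0 = tunit" and X1: "\<And>t. t \<in> {0..T} \<Longrightarrow> X t [] = 1"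
    by (auto simp: pvar_paths_def grouplike_upto_def dest!: bspec grouplike_trunc_upto)
  obtain Z :: "real \<Rightarrow> real ^ 'd" where Z: "piecewise_smooth T Z"
    "pvar_dist p N T X (\<lambda>t. trunc N (bv_signature (time_augment Z) t)) < ennreal e"
    using assms by (auto simp: Omega_hat_def N_def Let_def)
  let ?B = "bv_signature (time_augment Z)"
  have "\<bar>X t w - ?B t w\<bar> < e" if t: "t \<in> {0..T}" and w: "length w \<le> N" for t w
  proof (cases "t = 0 \<or> w = []")
    case True
    then show ?thesis using X0 X1[OF t] \<open>e > 0\<close> by (auto simp: bv_signature_start) (simp add: bv_signature_def)
  next
    case False
    \<comment> \<open>The first cell of this partition is \<open>[0,t]\<close>; for
      \<open>t = T\<close> there is no further point, since partitions increase strictly.\<close>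
    define D where "D = (if t < T then [0, t, T] else [0, T])"
    have D: "D \<in> partitions 0 T" "0 < length D - 1" "D ! 0 = 0" "D ! Suc 0 = t"
      using False t by (auto simp: D_def partitions_def)
    have "\<bar>incr N X 0 t w - incr N (\<lambda>t. trunc N (?B t)) 0 t w\<bar> < e"
      using pvar_norm_bound_increment[OF Z(2)[unfolded pvar_dist_def] _ _ w D(1,2)] False assms(2)
      unfolding D by (cases w) auto
    moreover have "incr N (\<lambda>t. trunc N (?B t)) 0 t w = ?B t w"
      using w by (subst incr_from_start) (auto simp: bv_signature_start, simp add: trunc_def)
    ultimately show ?thesis using X0 w by (simp add: incr_from_start)
  qed
  then show ?thesis using that Z(1) unfolding N_def by blast
qed

lemma pvar_paths_continuous:
  "X \<in> pvar_paths p N T \<Longrightarrow> continuous_on {0..T} (\<lambda>t. X t w)"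
  by (auto simp: pvar_paths_def)

lemma Omega_hat_pvar_paths: "X \<in> Omega_hat p T \<Longrightarrow> X \<in> pvar_paths p (nat \<lfloor>p\<rfloor>) T"
  by (simp add: Omega_hat_def Let_def)

text \<open>The identity holds for signatures of smooth paths with time component and is preserved
  by uniform limits. It is the trace that the smooth approximations leave on
  \<open>X\<close>.\<close>

lemma Omega_hat_time_letter:
  fixes X :: "real \<Rightarrow> 'd::finite option tseries"
  assumes X: "X \<in> Omega_hat p T" and p: "p \<ge> 1" "T > 0" and t: "t \<in> {0..T}" and w: "length w < nat \<lfloor>p\<rfloor>"
  shows "X t (w @ [None]) = integral {0..t} (\<lambda>u. X u w)"
proof -
  have "\<bar>X t (w @ [None]) - integral {0..t} (\<lambda>u. X u w)\<bar> \<le> 0 + e" if "e > 0" for e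
  proof -
    \<comment> \<open>The coefficient at \<open>t\<close> contributes an error \<open>c\<close>, the
      integral over \<open>[0,t]\<close> at most \<open>c * T\<close>.\<close>
    define c where "c = e / (1 + T)"
    have c: "c > 0" "c * (1 + T) = e" using that p by (auto simp: c_def)
    obtain Z :: "real \<Rightarrow> real ^ 'd" where Z: "piecewise_smooth T Z"
      "\<And>t w. t \<in> {0..T} \<Longrightarrow> length w \<le> nat \<lfloor>p\<rfloor> \<Longrightarrow> \<bar>X t w - bv_signature (time_augment Z) t w\<bar> < c"
      using Omega_hat_approx[OF X p c(1)] by blast
    let ?B = "bv_signature (time_augment Z)"
    have c1: "continuous_on {0..t} (\<lambda>u. X u w)" "continuous_on {0..t} (\<lambda>u. ?B u w)"
      using t pvar_paths_continuous[OF Omega_hat_pvar_paths[OF X]] bv_signature_continuous[OF Z(1)]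
      by (auto intro: continuous_on_subset[of "{0..T}"])
    have "\<bar>integral {0..t} (\<lambda>u. ?B u w) - integral {0..t} (\<lambda>u. X u w)\<bar>
      = norm (integral {0..t} (\<lambda>u. ?B u w - X u w))"
      using c1 by (subst integral_diff) (auto intro: integrable_continuous_interval)
    also have "\<dots> \<le> c * (t - 0)"
      using c1 t Z(2)[of _ w] w
      by (intro integral_bound continuous_intros) (auto simp: abs_minus_commute intro!: less_imp_le)
    also have "\<dots> \<le> c * T" using t c by simp
    finally show ?thesis
      using Z(2)[OF t, of "w @ [None]"] w c bv_signature_time_letter[OF Z(1) t, of w] by (simp add: distrib_left)
  qed
  then have "\<bar>X t (w @ [None]) - integral {0..t} (\<lambda>u. X u w)\<bar> \<le> 0" by (rule field_le_epsilon)
  then show ?thesis by simp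
qed

section \<open>Lyons' extension theorem\<close>

lemma partitions_extend:
  assumes F: "\<And>x y. F x y \<ge> (0::real)" and D: "D \<in> partitions s t" and "0 \<le> s" "t \<le> T"
  obtains E where "E \<in> partitions 0 T" "chain_sum F D \<le> chain_sum F E"
proof -
  obtain D' where D': "D' \<in> partitions 0 t" "chain_sum F D \<le> chain_sum F D'"
  proof (cases "s = 0")
    case False
    obtain ys where ys: "D = s # ys" using D by (cases D) (auto simp: partitions_def)
    have "[0] @ s # ys \<in> partitions 0 t"
      by (rule partitions_append) (use D \<open>0 \<le> s\<close> False ys in simp_all)
    then show ?thesis using that[of "[0] @ s # ys"] F[of 0 s] by (simp add: ys)
  qed (use D that in auto)
  show ?thesis
  proof (cases "t = T")
    case False
    obtain xs where xs: "D' = xs @ [t]" using D' by (cases D' rule: rev_cases) (auto simp: partitions_def)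
    have "xs @ t # [T] \<in> partitions 0 T"
      by (rule partitions_append) (use D'(1) \<open>t \<le> T\<close> False xs in simp_all)
    moreover have "chain_sum F (xs @ t # [T]) = chain_sum F D' + F t T"
      unfolding xs by (subst chain_sum_append) simp
    ultimately show ?thesis using that[of "xs @ t # [T]"] F[of t T] D' by simp
  qed (use D' that in auto)
qed

definition variation_control :: "(real \<Rightarrow> real \<Rightarrow> real) \<Rightarrow> real \<Rightarrow> real \<Rightarrow> real" where
  "variation_control F s t = (SUP D\<in>partitions s t. chain_sum F D)"

text \<open>Concatenated partitions give superadditivity, and the partition \<open>[s, t]\<close>
  gives the pointwise bound. The latter is stated for \<open>s < t\<close>, because
  \<open>[s]\<close> is the only partition of a point and its sum is 0.\<close>

lemma variation_control:
  assumes F: "\<And>x y. F x y \<ge> 0" and bound: "\<And>D. D \<in> partitions 0 T \<Longrightarrow> chain_sum F D \<le> B"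
  shows "superadditive T (variation_control F)"
    and "\<And>s t. 0 \<le> s \<Longrightarrow> s < t \<Longrightarrow> t \<le> T \<Longrightarrow> F s t \<le> variation_control F s t"
proof -
  have bdd: "bdd_above (chain_sum F ` partitions s t)" if "0 \<le> s" "t \<le> T" for s t
  proof (rule bdd_aboveI2)
    fix D assume "D \<in> partitions s t"
    then show "chain_sum F D \<le> B" using that bound by (meson F order_trans partitions_extend)
  qed
  have ne: "partitions s t \<noteq> {}" if "s \<le> t" for s t
    using uniform_partition[OF that, of 1] by auto
  have up: "chain_sum F D \<le> variation_control F s t" if "D \<in> partitions s t" "0 \<le> s" "t \<le> T" for D s t
    unfolding variation_control_def using that by (intro cSUP_upper bdd)
  show "F s t \<le> variation_control F s t" if "0 \<le> s" "s < t" "t \<le> T" for s t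
    using up[of "[s, t]" s t] that by simp
  show "superadditive T (variation_control F)"
    unfolding superadditive_def
  proof (intro conjI allI impI)
    fix s t assume st: "0 \<le> s \<and> s \<le> t \<and> t \<le> T"
    then obtain D where D: "D \<in> partitions s t" using ne by blast
    then show "0 \<le> variation_control F s t"
      using up[OF D] chain_sum_nonneg[of F D, OF F] st by linarith
  next
    fix s u t assume st: "0 \<le> s \<and> s \<le> u \<and> u \<le> t \<and> t \<le> T"
    have *: "chain_sum F D + chain_sum F E \<le> variation_control F s t"
      if D: "D \<in> partitions s u" and E: "E \<in> partitions u t" for D E
    proof -
      obtain xs where xs: "D = xs @ [u]" using D by (cases D rule: rev_cases) (auto simp: partitions_def)
      obtain ys where ys: "E = u # ys" using E by (cases E) (auto simp: partitions_def)
      have "xs @ u # ys \<in> partitions s t" using D E unfolding xs ys by (rule partitions_append)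
      from up[OF this] show ?thesis using st unfolding xs ys by (simp add: chain_sum_append[of F xs u ys])
    qed
    have "variation_control F u t \<le> variation_control F s t - chain_sum F D" if "D \<in> partitions s u" for D
      unfolding variation_control_def[of F u] using *[OF that] st ne
      by (intro cSUP_least) (auto simp: algebra_simps)
    then have "variation_control F s u \<le> variation_control F s t - variation_control F u t"
      unfolding variation_control_def[of F s u] using st ne
      by (intro cSUP_least) (auto simp: algebra_simps)
    then show "variation_control F s u + variation_control F u t \<le> variation_control F s t" by simp
  qed
qed

lemma pvar_norm_finite_bound:
  assumes "pvar_norm p N s t A < \<infinity>" "p > 0" "1 \<le> k" "k \<le> N"
  shows "\<exists>B. \<forall>D\<in>partitions s t. chain_sum (\<lambda>x y. level_norm k (A x y) powr (p / real k)) D \<le> B"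
proof -
  obtain b where b: "pvar_norm p N s t A = ennreal b" "b \<ge> 0"
    using assms(1) by (cases "pvar_norm p N s t A") auto
  have "chain_sum (\<lambda>x y. level_norm k (A x y) powr (p / real k)) D \<le> b powr (p / real k)"
    if D: "D \<in> partitions s t" for D
  proof -
    let ?S = "chain_sum (\<lambda>x y. level_norm k (A x y) powr (p / real k)) D"
    have S0: "?S \<ge> 0" by (rule chain_sum_nonneg) simp
    have "ennreal (?S powr (real k / p)) \<le> pvar_norm p N s t A"
      unfolding pvar_norm_def chain_sum_nth using assms D by (intro SUP_upper2[of k] SUP_upper2[of D]) auto
    then have "?S powr (real k / p) \<le> b" using b by simp
    then have "(?S powr (real k / p)) powr (p / real k) \<le> b powr (p / real k)"
      using assms by (intro powr_mono2) auto
    then show ?thesis using S0 assms by (simp add: powr_powr)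
  qed
  then show ?thesis by blast
qed

lemma level_norm_trunc: "k \<le> N \<Longrightarrow> level_norm k (trunc N a) = level_norm k a"
  unfolding level_norm_def trunc_def by (intro arg_cong[of _ _ Max] Collect_cong) auto

lemma pvar_paths_grouplike: "X \<in> pvar_paths p N T \<Longrightarrow> t \<in> {0..T} \<Longrightarrow> X t \<in> grouplike_trunc N"
  by (simp add: pvar_paths_def)

lemma pvar_paths_bound:
  assumes X: "X \<in> pvar_paths p N T" and "p > 0" "1 \<le> k" "k \<le> N"
  shows "\<exists>B. \<forall>D\<in>partitions 0 T. chain_sum (\<lambda>x y. level_norm k (group_incr X x y) powr (p / real k)) D \<le> B"
proof -
  obtain B where B: "\<And>D. D\<in>partitions 0 T \<Longrightarrow> chain_sum (\<lambda>x y. level_norm k (incr N X x y) powr (p / real k)) D \<le> B"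
    using pvar_norm_finite_bound[of p N 0 T "incr N X" k] assms by (auto simp: pvar_paths_def)
  have "chain_sum (\<lambda>x y. level_norm k (group_incr X x y) powr (p / real k)) D \<le>
      chain_sum (\<lambda>x y. level_norm k (incr N X x y) powr (p / real k)) D" if D: "D \<in> partitions 0 T" for D
  proof (rule chain_sum_mono[OF D])
    fix x y assume "0 \<le> x" "x < y" "y \<le> T"
    then have "incr N X x y = trunc N (group_incr X x y)"
      by (intro incr_eq pvar_paths_grouplike[OF X]) auto
    then show "level_norm k (group_incr X x y) powr (p / real k) \<le> level_norm k (incr N X x y) powr (p / real k)"
      using assms by (simp add: level_norm_trunc)
  qed
  then show ?thesis using B by (meson order_trans)
qed

section \<open>Increments of continuous paths\<close>

lemma tinv_continuous:
  assumes "\<And>v. continuous_on A (\<lambda>t. f t v)"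
  shows "continuous_on A (\<lambda>t. tinv (f t) w)"
proof (induction "length w" arbitrary: w rule: less_induct)
  case less
  show ?case
  proof (cases "w = []")
    case False
    then show ?thesis unfolding tinv.simps[of _ w]
      using less assms by (auto intro!: continuous_intros)
  qed simp
qed

lemma group_incr_continuous:
  assumes "\<And>v. continuous_on A (\<lambda>t. f t v)"
  shows "continuous_on (A \<times> A) (\<lambda>(s, t). group_incr f s t w)"
  unfolding group_incr_def tmult_def case_prod_unfold
  by (intro continuous_intros continuous_on_compose2[OF tinv_continuous[OF assms], of _ fst]
      continuous_on_compose2[OF assms, of _ snd]) auto

text \<open>The increment is jointly continuous in both times and vanishes on the diagonal, so
  uniform continuity on the square applies.\<close>

lemma group_incr_small:
  assumes c: "\<And>v. continuous_on {0..T} (\<lambda>t. f t v)" and one: "\<And>t. t \<in> {0..T} \<Longrightarrow> f t [] = 1"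
    and "w \<noteq> []" "\<epsilon> > 0"
  shows "\<exists>\<delta>>0. \<forall>s t. 0 \<le> s \<and> s \<le> t \<and> t \<le> T \<and> t - s \<le> \<delta> \<longrightarrow> \<bar>group_incr f s t w\<bar> \<le> \<epsilon>"
proof -
  have "uniformly_continuous_on ({0..T} \<times> {0..T}) (\<lambda>(s, t). group_incr f s t w)"
    by (intro compact_uniformly_continuous group_incr_continuous c compact_Times compact_Icc)
  then obtain d where d: "d > 0" "\<And>x x'. x \<in> {0..T} \<times> {0..T} \<Longrightarrow> x' \<in> {0..T} \<times> {0..T} \<Longrightarrow> dist x' x < d \<Longrightarrow>
      dist (case x' of (s, t) \<Rightarrow> group_incr f s t w) (case x of (s, t) \<Rightarrow> group_incr f s t w) < \<epsilon>"
    unfolding uniformly_continuous_on_def using \<open>\<epsilon> > 0\<close> by metis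
  have "\<bar>group_incr f s t w\<bar> \<le> \<epsilon>" if "0 \<le> s" "s \<le> t" "t \<le> T" "t - s \<le> d / 2" for s t
  proof -
    have "dist (s, t) (s, s) < d" using that d by (simp add: dist_Pair_Pair dist_real_def)
    moreover have "group_incr f s s w = 0"
      using one[of s] that \<open>w \<noteq> []\<close> by (simp add: group_incr_refl tunit_def)
    ultimately show ?thesis using d(2)[of "(s, s)" "(s, t)"] that by (simp add: dist_real_def)
  qed
  then show ?thesis using d(1) by (intro exI[of _ "d / 2"]) auto
qed

text \<open>Two bounds on the same quantity trade some of the exponent for a small constant.\<close>

lemma interpolate_bounds:
  fixes A \<theta> \<theta>' \<epsilon> :: real
  assumes "A \<ge> 0" "0 < \<theta>" "\<theta> < \<theta>'" "\<epsilon> > 0"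
  obtains e where "e > 0" "\<And>a W. 0 \<le> a \<Longrightarrow> 0 \<le> W \<Longrightarrow> a \<le> e \<Longrightarrow> a \<le> A * W powr \<theta>' \<Longrightarrow> a \<le> \<epsilon> * W powr \<theta>"
proof -
  \<comment> \<open>With \<open>l * \<theta>' = \<theta>\<close> the quantity is written as
    \<open>a powr (1 - l) * a powr l\<close>; the first factor receives the small bound, the second
    the bound by the control.\<close>
  define l where "l = \<theta> / \<theta>'"
  have l: "0 < l" "l < 1" "l * \<theta>' = \<theta>" using assms by (auto simp: l_def)
  define e where "e = (\<epsilon> / (A powr l + 1)) powr (1 / (1 - l))"
  have Al: "A powr l + 1 > 0" by (simp add: add_nonneg_pos)
  have e: "e > 0" using assms Al by (simp add: e_def)
  have e1: "e powr (1 - l) * A powr l \<le> \<epsilon>"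
  proof -
    have "e powr (1 - l) = \<epsilon> / (A powr l + 1)"
      using l assms Al by (simp add: e_def powr_powr)
    also have "\<dots> * A powr l \<le> \<epsilon>" using assms Al by (simp add: field_simps)
    finally show ?thesis .
  qed
  have "a \<le> \<epsilon> * W powr \<theta>" if a: "0 \<le> a" "0 \<le> W" "a \<le> e" "a \<le> A * W powr \<theta>'" for a W
  proof -
    have "a = a powr (1 - l) * a powr l" using a by (simp add: powr_add[symmetric])
    also have "\<dots> \<le> e powr (1 - l) * (A * W powr \<theta>') powr l"
      using a l by (intro mult_mono powr_mono2) auto
    also have "\<dots> = (e powr (1 - l) * A powr l) * W powr \<theta>"
      using assms a l by (simp add: powr_mult powr_powr mult.commute)
    also have "\<dots> \<le> \<epsilon> * W powr \<theta>" using e1 by (intro mult_right_mono) auto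
    finally show ?thesis .
  qed
  with e that show ?thesis by blast
qed

lemma shuffle_eval_bound:
  "\<exists>S\<ge>0. \<forall>a B. (\<forall>u. length u = length w + length v \<longrightarrow> \<bar>a u\<bar> \<le> B) \<longrightarrow> \<bar>shuffle_eval a w v\<bar> \<le> S * B"
proof (induction w v rule: shuffle_words.induct)
  case (3 w i v j)
  obtain S1 where S1: "S1 \<ge> 0" "\<And>a B. (\<forall>u. length u = length w + length (v @ [j]) \<longrightarrow> \<bar>a u\<bar> \<le> B) \<Longrightarrow>
      \<bar>shuffle_eval a w (v @ [j])\<bar> \<le> S1 * B" using 3(1) by blast
  obtain S2 where S2: "S2 \<ge> 0" "\<And>a B. (\<forall>u. length u = length (w @ [i]) + length v \<longrightarrow> \<bar>a u\<bar> \<le> B) \<Longrightarrow>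
      \<bar>shuffle_eval a (w @ [i]) v\<bar> \<le> S2 * B" using 3(2) by blast
  have "\<bar>shuffle_eval a (w @ [i]) (v @ [j])\<bar> \<le> (S1 + S2) * B"
    if a: "\<forall>u. length u = length (w @ [i]) + length (v @ [j]) \<longrightarrow> \<bar>a u\<bar> \<le> B" for a B
  proof -
    have "\<bar>shuffle_eval (\<lambda>u. a (u @ [i])) w (v @ [j])\<bar> \<le> S1 * B" using a by (intro S1) auto
    moreover have "\<bar>shuffle_eval (\<lambda>u. a (u @ [j])) (w @ [i]) v\<bar> \<le> S2 * B" using a by (intro S2) auto
    ultimately show ?thesis unfolding shuffle_eval_snoc distrib_right by linarith
  qed
  then show ?case using S1(1) S2(1) by (intro exI[of _ "S1 + S2"]) auto
qed (auto intro!: exI[of _ 1])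

text \<open>What has to be carried from one level to the next. The control \<open>\<omega>\<close>
  is a parameter, so one control serves all levels, while \<open>C\<close> may depend on
  \<open>n\<close>; coefficients of words longer than \<open>n\<close> are left free.\<close>

definition level_regular ::
    "real \<Rightarrow> real \<Rightarrow> (real \<Rightarrow> real \<Rightarrow> real) \<Rightarrow> nat \<Rightarrow> (real \<Rightarrow> 'a tseries) \<Rightarrow> bool" where
  "level_regular p T \<omega> n f \<longleftrightarrow>
     (\<forall>t\<in>{0..T}. grouplike_upto n (f t)) \<and>
     (\<forall>w. length w \<le> n \<longrightarrow> continuous_on {0..T} (\<lambda>t. f t w)) \<and>
     (\<forall>w. length w \<le> n \<longrightarrow> f 0 w = tunit w) \<and>
     (\<exists>C\<ge>0. \<forall>w s t. 1 \<le> length w \<and> length w \<le> n \<and> 0 \<le> s \<and> s \<le> t \<and> t \<le> T \<longrightarrow>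
        \<bar>group_incr f s t w\<bar> \<le> C * \<omega> s t powr (real (length w) / p))"

text \<open>Adding the powers \<open>p / k\<close> over all levels up to \<open>N\<close> yields one
  control for all of them, since each summand is at most the variation of the sum. The bound on
  level \<open>k\<close> follows on taking the power \<open>k / p\<close>.\<close>

lemma pvar_paths_level_regular:
  fixes X :: "real \<Rightarrow> 'a::finite tseries"
  assumes X: "X \<in> pvar_paths p N T" and "p > 0"
  shows "\<exists>\<omega>. superadditive T \<omega> \<and> level_regular p T \<omega> N X"
proof -
  define F where "F = (\<lambda>x y. \<Sum>k\<in>{1..N}. level_norm k (group_incr X x y) powr (p / real k))"
  have F0: "F x y \<ge> 0" for x y unfolding F_def by (intro sum_nonneg) auto
  have "\<forall>k\<in>{1..N}. \<exists>B. \<forall>D\<in>partitions 0 T. chain_sum (\<lambda>x y. level_norm k (group_incr X x y) powr (p / real k)) D \<le> B"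
    using pvar_paths_bound[OF X \<open>p > 0\<close>] by auto
  then obtain B where B: "\<And>k D. k \<in> {1..N} \<Longrightarrow> D\<in>partitions 0 T \<Longrightarrow>
      chain_sum (\<lambda>x y. level_norm k (group_incr X x y) powr (p / real k)) D \<le> B k" by metis
  have FB: "chain_sum F D \<le> (\<Sum>k\<in>{1..N}. B k)" if "D \<in> partitions 0 T" for D
  proof -
    have "chain_sum F D = (\<Sum>k\<in>{1..N}. chain_sum (\<lambda>x y. level_norm k (group_incr X x y) powr (p / real k)) D)"
      unfolding F_def chain_sum_nth by (rule sum.swap)
    also have "\<dots> \<le> (\<Sum>k\<in>{1..N}. B k)" by (intro sum_mono B that)
    finally show ?thesis .
  qed
  note vc = variation_control[of F, OF F0 FB]
  have one: "X t [] = 1" if "t \<in> {0..T}" for t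
    using grouplike_trunc_upto[OF pvar_paths_grouplike[OF X that]] by (simp add: grouplike_upto_def)
  have "\<bar>group_incr X s t w\<bar> \<le> 1 * variation_control F s t powr (real (length w) / p)"
    if w: "1 \<le> length w" "length w \<le> N" and st: "0 \<le> s" "s \<le> t" "t \<le> T" for w s t
  proof (cases "s = t")
    case True
    then show ?thesis using one[of s] w st by (auto simp: group_incr_refl tunit_def)
  next
    case False
    let ?k = "length w" and ?l = "level_norm (length w) (group_incr X s t)"
    have l0: "?l \<ge> 0" by (rule level_norm_nonneg)
    have "?l powr (p / real ?k) \<le> F s t" unfolding F_def using w
      by (intro member_le_sum[of ?k "{1..N}" "\<lambda>k. level_norm k (group_incr X s t) powr (p / real k)"]) auto
    also have "\<dots> \<le> variation_control F s t" by (rule vc(2)) (use st False in auto)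
    finally have "(?l powr (p / real ?k)) powr (real ?k / p) \<le> variation_control F s t powr (real ?k / p)"
      using \<open>p > 0\<close> by (intro powr_mono2) auto
    moreover have "(?l powr (p / real ?k)) powr (real ?k / p) = ?l"
      using l0 w \<open>p > 0\<close> by (cases w) (auto simp: powr_powr)
    moreover have "\<bar>group_incr X s t w\<bar> \<le> ?l" by (rule level_norm_ge) simp
    ultimately show ?thesis by simp
  qed
  then have "level_regular p T (variation_control F) N X"
    unfolding level_regular_def using X
    by (auto simp: pvar_paths_def intro!: exI[of _ 1] intro: grouplike_trunc_upto)
  with vc(1) show ?thesis by blast
qed

section \<open>Extension by one level\<close>

lemma group_incr_middle:
  assumes "X s [] = 1" "X t [] = 1" "w \<noteq> []"
  shows "group_incr X s t w = X t w - X s w - (\<Sum>k\<in>{1..<length w}. X s (take k w) * group_incr X s t (drop k w))"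
  using arg_cong[OF group_incr_start[of X s t], of "\<lambda>a. a w"] assms by (simp add: tmult_middle)

text \<open>Chen's relation with the two trivial splittings moved to the left. The right-hand side
  involves only levels strictly below \<open>length w\<close>, so it is known before the top level
  is.\<close>

lemma group_incr_defect:
  assumes "\<And>t. f t [] = 1" "w \<noteq> []"
  shows "group_incr f x y w - group_incr f x u w - group_incr f u y w =
     (\<Sum>k\<in>{1..<length w}. group_incr f x u (take k w) * group_incr f u y (drop k w))"
  using arg_cong[OF group_incr_chen[of f u x y], of "\<lambda>a. a w"] assms
  by (simp add: tmult_middle)

text \<open>Each product on the right of Chen's relation has exponents \<open>k / p\<close> and
  \<open>(n + 1 - k) / p\<close>, which add up to \<open>(n + 1) / p\<close>; there are
  \<open>n\<close> such products.\<close>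

lemma regular_defect_bound:
  assumes w: "superadditive T \<omega>" and "p > 0" and C: "C \<ge> 0"
    and bound: "\<And>v s t. 1 \<le> length v \<Longrightarrow> length v \<le> n \<Longrightarrow> 0 \<le> s \<Longrightarrow> s \<le> t \<Longrightarrow> t \<le> T \<Longrightarrow>
        \<bar>group_incr f s t v\<bar> \<le> C * \<omega> s t powr (real (length v) / p)"
    and v: "length v = Suc n" and one: "\<And>t. f t [] = 1"
    and xy: "0 \<le> x" "x \<le> u" "u \<le> y" "y \<le> T"
  shows "\<bar>group_incr f x y v - group_incr f x u v - group_incr f u y v\<bar> \<le>
      real n * C\<^sup>2 * \<omega> x y powr (real (Suc n) / p)"
proof -
  have W: "0 \<le> \<omega> x u" "\<omega> x u \<le> \<omega> x y" "0 \<le> \<omega> u y" "\<omega> u y \<le> \<omega> x y"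
    using xy by (auto intro!: superadditiveD(1)[OF w] superadditive_mono[OF w])
  have "\<bar>group_incr f x y v - group_incr f x u v - group_incr f u y v\<bar> \<le>
     (\<Sum>k\<in>{1..<length v}. \<bar>group_incr f x u (take k v) * group_incr f u y (drop k v)\<bar>)"
    using v by (subst group_incr_defect[of f, OF one]) (force, rule sum_abs)
  also have "\<dots> \<le> (\<Sum>k\<in>{1..<length v}. C\<^sup>2 * \<omega> x y powr (real (Suc n) / p))"
  proof (rule sum_mono)
    fix k assume k: "k \<in> {1..<length v}"
    have 1: "\<bar>group_incr f x u (take k v)\<bar> \<le> C * \<omega> x y powr (real k / p)"
    proof -
      have "\<bar>group_incr f x u (take k v)\<bar> \<le> C * \<omega> x u powr (real k / p)"
        using bound[of "take k v" x u] k v xy by auto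
      also have "\<dots> \<le> C * \<omega> x y powr (real k / p)"
        using W C \<open>p > 0\<close> by (intro mult_left_mono powr_mono2) auto
      finally show ?thesis .
    qed
    have 2: "\<bar>group_incr f u y (drop k v)\<bar> \<le> C * \<omega> x y powr (real (Suc n - k) / p)"
    proof -
      have "\<bar>group_incr f u y (drop k v)\<bar> \<le> C * \<omega> u y powr (real (Suc n - k) / p)"
        using bound[of "drop k v" u y] k v xy by auto
      also have "\<dots> \<le> C * \<omega> x y powr (real (Suc n - k) / p)"
        using W C \<open>p > 0\<close> by (intro mult_left_mono powr_mono2) auto
      finally show ?thesis .
    qed
    have "\<bar>group_incr f x u (take k v) * group_incr f u y (drop k v)\<bar> \<le>
        (C * \<omega> x y powr (real k / p)) * (C * \<omega> x y powr (real (Suc n - k) / p))"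
      unfolding abs_mult using C by (intro mult_mono 1 2) auto
    also have "\<dots> = C\<^sup>2 * \<omega> x y powr (real k / p + real (Suc n - k) / p)"
      by (simp add: power2_eq_square powr_add)
    also have "real k / p + real (Suc n - k) / p = real (Suc n) / p"
      using k v by (simp add: add_divide_distrib[symmetric])
    finally show "\<bar>group_incr f x u (take k v) * group_incr f u y (drop k v)\<bar> \<le> C\<^sup>2 * \<omega> x y powr (real (Suc n) / p)" .
  qed
  finally show ?thesis using v by simp
qed

lemma uniformly_small_continuous:
  fixes h :: "real \<Rightarrow> real"
  assumes "\<And>\<epsilon>. \<epsilon> > 0 \<Longrightarrow> \<exists>\<delta>>0. \<forall>s t. 0 \<le> s \<and> s \<le> t \<and> t \<le> T \<and> t - s \<le> \<delta> \<longrightarrow> \<bar>h t - h s\<bar> \<le> \<epsilon>"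
  shows "continuous_on {0..T} h"
  unfolding continuous_on_iff
proof (intro ballI allI impI)
  fix x e :: real assume x: "x \<in> {0..T}" and "e > 0"
  then obtain d where d: "d > 0" "\<And>s t. 0 \<le> s \<Longrightarrow> s \<le> t \<Longrightarrow> t \<le> T \<Longrightarrow> t - s \<le> d \<Longrightarrow> \<bar>h t - h s\<bar> \<le> e / 2"
    using assms[of "e / 2"] by auto
  have "dist (h y) (h x) < e" if "y \<in> {0..T}" "dist y x < d" for y
    using d(2)[of x y] d(2)[of y x] that x \<open>e > 0\<close> by (cases "x \<le> y") (auto simp: dist_real_def abs_minus_commute)
  then show "\<exists>d>0. \<forall>x'\<in>{0..T}. dist x' x < d \<longrightarrow> dist (h x') (h x) < e" using d(1) by blast
qed

text \<open>
  In the extension step \<open>f\<close> is prolonged by \<open>0\<close> to level \<open>n + 1\<close>, and sewing corrects it there.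
\<close>

lemma level_regular_correction:
  fixes f :: "real \<Rightarrow> 'a::finite tseries"
  assumes w: "superadditive T \<omega>" and "p > 0" and np: "real (Suc n) > p" and C: "C \<ge> 0"
    and bound: "\<And>v s t. 1 \<le> length v \<Longrightarrow> length v \<le> n \<Longrightarrow> 0 \<le> s \<Longrightarrow> s \<le> t \<Longrightarrow> t \<le> T \<Longrightarrow>
        \<bar>group_incr f s t v\<bar> \<le> C * \<omega> s t powr (real (length v) / p)"
    and one: "\<And>t. f t [] = 1" and cont: "\<And>v. continuous_on {0..T} (\<lambda>t. f t v)"
    and v: "length v = Suc n"
  obtains h where "h 0 = 0" "continuous_on {0..T} h"
    "\<And>s t. 0 \<le> s \<Longrightarrow> s \<le> t \<Longrightarrow> t \<le> T \<Longrightarrow> \<bar>group_incr f s t v + h t - h s\<bar> \<le>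
       real n * C\<^sup>2 * sewing_const (real (Suc n) / p) * \<omega> s t powr (real (Suc n) / p)"
proof -
  define \<theta>' where "\<theta>' = real (Suc n) / p"
  have th': "\<theta>' > 1" using np \<open>p > 0\<close> by (simp add: \<theta>'_def)
  \<comment> \<open>Midway between 1 and \<open>\<theta>'\<close>: sewing asks for an exponent above
    1, and the gap to \<open>\<theta>'\<close> buys the small constant.\<close>
  define \<theta> where "\<theta> = (1 + \<theta>') / 2"
  have th: "1 < \<theta>" "\<theta> < \<theta>'" using th' by (auto simp: \<theta>_def)
  \<comment> \<open>The sign makes \<open>h\<close> the compensation: the top increment plus
    \<open>h t - h s\<close> is exactly the sewing error.\<close>
  define \<Xi> where "\<Xi> = (\<lambda>s t. - group_incr f s t v)"
  define A where "A = real n * C\<^sup>2"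
  have A: "A \<ge> 0" by (simp add: A_def)
  have vne: "v \<noteq> []" using v by auto
  have diag: "\<Xi> x x = 0" for x using vne by (simp add: \<Xi>_def group_incr_refl one tunit_def)
  have big: "\<bar>\<Xi> x y - \<Xi> x u - \<Xi> u y\<bar> \<le> A * \<omega> x y powr \<theta>'"
    if "0 \<le> x" "x \<le> u" "u \<le> y" "y \<le> T" for x u y
    using regular_defect_bound[OF w \<open>p > 0\<close> C bound v one that] by (simp add: \<Xi>_def A_def \<theta>'_def)
  have gs: "\<exists>\<delta>>0. \<forall>s t. 0 \<le> s \<and> s \<le> t \<and> t \<le> T \<and> t - s \<le> \<delta> \<longrightarrow> \<bar>group_incr f s t v\<bar> \<le> e" if "e > 0" for e
    by (rule group_incr_small) (use cont one vne that in auto)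
  have small: "small_defect T \<omega> \<theta> \<Xi>"
    unfolding small_defect_def
  proof (intro allI impI)
    fix \<epsilon> :: real assume "\<epsilon> > 0"
    obtain e where e: "e > 0" "\<And>a W. 0 \<le> a \<Longrightarrow> 0 \<le> W \<Longrightarrow> a \<le> e \<Longrightarrow> a \<le> A * W powr \<theta>' \<Longrightarrow> a \<le> \<epsilon> * W powr \<theta>"
      using interpolate_bounds[OF A _ th(2) \<open>\<epsilon> > 0\<close>] th by auto
    obtain d where d: "d > 0" "\<And>s t. 0 \<le> s \<Longrightarrow> s \<le> t \<Longrightarrow> t \<le> T \<Longrightarrow> t - s \<le> d \<Longrightarrow> \<bar>group_incr f s t v\<bar> \<le> e / 3"
      using gs[of "e / 3"] e(1) by auto
    have "\<bar>\<Xi> x y - \<Xi> x u - \<Xi> u y\<bar> \<le> \<epsilon> * \<omega> x y powr \<theta>"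
      if "0 \<le> x" "x \<le> u" "u \<le> y" "y \<le> T" "y - x \<le> d" for x u y
    proof (rule e(2))
      show "\<bar>\<Xi> x y - \<Xi> x u - \<Xi> u y\<bar> \<le> e"
        using d(2)[of x y] d(2)[of x u] d(2)[of u y] that unfolding \<Xi>_def by linarith
      show "0 \<le> \<omega> x y" using that by (intro superadditiveD(1)[OF w]) auto
    qed (use big that in auto)
    then show "\<exists>\<delta>>0. \<forall>x u y. 0 \<le> x \<and> x \<le> u \<and> u \<le> y \<and> y \<le> T \<and> y - x \<le> \<delta> \<longrightarrow>
       \<bar>\<Xi> x y - \<Xi> x u - \<Xi> u y\<bar> \<le> \<epsilon> * \<omega> x y powr \<theta>" using d(1) by blast
  qed
  obtain h where h: "h 0 = 0" "\<And>s t \<epsilon>. 0 \<le> s \<Longrightarrow> s \<le> t \<Longrightarrow> t \<le> T \<Longrightarrow> \<epsilon> > 0 \<Longrightarrow>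
    \<exists>\<delta>>0. \<forall>D\<in>partitions s t. mesh_le \<delta> D \<longrightarrow> \<bar>chain_sum \<Xi> D - (h t - h s)\<bar> \<le> \<epsilon>"
    using sewing[OF w th(1) small diag] by blast
  have hb: "\<bar>h t - h s - \<Xi> s t\<bar> \<le> A * sewing_const \<theta>' * \<omega> s t powr \<theta>'" if "0 \<le> s" "s \<le> t" "t \<le> T" for s t
    by (rule sewing_bound[OF h(2) w th' A _ _ _ diag]) (use that big in auto)
  \<comment> \<open>To conclude from \<open>hb\<close>, the control would have to be small on short
    intervals. Sewing with the exponent \<open>\<theta>\<close> gives a small constant in front of
    the fixed number \<open>\<omega> 0 T powr \<theta>\<close> instead.\<close>
  have "continuous_on {0..T} h"
  proof (rule uniformly_small_continuous)
    fix \<epsilon> :: real assume "\<epsilon> > 0"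
    define K where "K = sewing_const \<theta> * \<omega> 0 T powr \<theta>"
    have sK: "sewing_const \<theta> > 0" using th by (intro sewing_const_pos) auto
    then have K: "K \<ge> 0" by (simp add: K_def)
    define c where "c = \<epsilon> / (2 * (K + 1))"
    have c: "c > 0" "c * K \<le> \<epsilon> / 2" using K \<open>\<epsilon> > 0\<close> by (auto simp: c_def field_simps)
    obtain d1 where d1: "d1 > 0" "\<And>x u y. 0 \<le> x \<Longrightarrow> x \<le> u \<Longrightarrow> u \<le> y \<Longrightarrow> y \<le> T \<Longrightarrow> y - x \<le> d1 \<Longrightarrow>
       \<bar>\<Xi> x y - \<Xi> x u - \<Xi> u y\<bar> \<le> c * \<omega> x y powr \<theta>"
      using small c(1) unfolding small_defect_def by meson
    obtain d2 where d2: "d2 > 0" "\<And>s t. 0 \<le> s \<Longrightarrow> s \<le> t \<Longrightarrow> t \<le> T \<Longrightarrow> t - s \<le> d2 \<Longrightarrow> \<bar>group_incr f s t v\<bar> \<le> \<epsilon> / 2"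
      using gs[of "\<epsilon> / 2"] \<open>\<epsilon> > 0\<close> by auto
    have "\<bar>h t - h s\<bar> \<le> \<epsilon>" if "0 \<le> s" "s \<le> t" "t \<le> T" "t - s \<le> min d1 d2" for s t
    proof -
      have "\<bar>h t - h s - \<Xi> s t\<bar> \<le> c * sewing_const \<theta> * \<omega> s t powr \<theta>"
        by (rule sewing_bound[OF h(2) w th(1) _ _ _ _ diag]) (use that d1 c in auto)
      also have "\<dots> \<le> c * sewing_const \<theta> * \<omega> 0 T powr \<theta>"
        using that c sK th
        by (intro mult_left_mono powr_mono2 superadditive_mono[OF w] superadditiveD(1)[OF w]) auto
      also have "\<dots> \<le> \<epsilon> / 2" using c(2) by (simp add: K_def mult.assoc)
      finally have "\<bar>h t - h s - \<Xi> s t\<bar> \<le> \<epsilon> / 2" .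
      moreover have "\<bar>\<Xi> s t\<bar> \<le> \<epsilon> / 2" using d2(2)[of s t] that by (simp add: \<Xi>_def)
      ultimately show ?thesis by linarith
    qed
    then show "\<exists>\<delta>>0. \<forall>s t. 0 \<le> s \<and> s \<le> t \<and> t \<le> T \<and> t - s \<le> \<delta> \<longrightarrow> \<bar>h t - h s\<bar> \<le> \<epsilon>"
      using d1(1) d2(1) by (intro exI[of _ "min d1 d2"]) auto
  qed
  moreover have "\<bar>group_incr f s t v + h t - h s\<bar> \<le>
       real n * C\<^sup>2 * sewing_const (real (Suc n) / p) * \<omega> s t powr (real (Suc n) / p)"
    if "0 \<le> s" "s \<le> t" "t \<le> T" for s t
    using hb[OF that] by (simp add: \<Xi>_def A_def \<theta>'_def algebra_simps)
  ultimately show ?thesis using that h(1) by blast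
qed

text \<open>The defect of the shuffle identity on the new level is an additive function that is too small not to vanish.\<close>

lemma shuffle_next_level:
  assumes w: "superadditive T \<omega>" and "p > 0" and np: "real (Suc n) > p" and C: "C \<ge> 0"
    and bound: "\<And>v s t. 1 \<le> length v \<Longrightarrow> length v \<le> Suc n \<Longrightarrow> 0 \<le> s \<Longrightarrow> s \<le> t \<Longrightarrow> t \<le> T \<Longrightarrow>
        \<bar>group_incr f s t v\<bar> \<le> C * \<omega> s t powr (real (length v) / p)"
    and gl: "\<And>t. t \<in> {0..T} \<Longrightarrow> grouplike_upto n (f t)"
    and one: "\<And>t. f t [] = 1" and cont: "\<And>v. continuous_on {0..T} (\<lambda>t. f t v)"
    and start: "\<And>v. length v \<le> Suc n \<Longrightarrow> f 0 v = tunit v"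
    and t: "t \<in> {0..T}"
  shows "grouplike_upto (Suc n) (f t)"
proof -
  have "shuffle_eval (f t) u v = f t u * f t v" if len: "length u + length v = Suc n" and ne: "u \<noteq> []" "v \<noteq> []" for u v
  proof -
    define \<theta>' where "\<theta>' = real (Suc n) / p"
    have th': "\<theta>' > 1" using np \<open>p > 0\<close> by (simp add: \<theta>'_def)
    define \<theta> where "\<theta> = (1 + \<theta>') / 2"
    have th: "1 \<le> \<theta>" "0 < \<theta>" "\<theta> < \<theta>'" using th' by (auto simp: \<theta>_def)
    define \<phi> where "\<phi> = (\<lambda>a. shuffle_eval a u v - a u * a v)"
    obtain S where S: "S \<ge> 0" "\<And>a B. (\<And>x. length x = length u + length v \<Longrightarrow> \<bar>a x\<bar> \<le> B) \<Longrightarrow> \<bar>shuffle_eval a u v\<bar> \<le> S * B"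
      using shuffle_eval_bound[of u v] by blast
    define A where "A = S * C + C\<^sup>2"
    have A: "A \<ge> 0" using S C by (simp add: A_def)
    \<comment> \<open>The shuffle defect on level \<open>n + 1\<close> turns the product
      \<open>f x \<otimes>\<^sub>t group_incr f x y\<close> into a sum.\<close>
    have incr: "\<phi> (f y) - \<phi> (f x) = \<phi> (group_incr f x y)" if "0 \<le> x" "x \<le> y" "y \<le> T" for x y
    proof -
      have "f x \<otimes>\<^sub>t group_incr f x y = f y" by (rule group_incr_start) (rule one)
      moreover have "grouplike_upto n (group_incr f x y)"
        unfolding group_incr_def using gl that by (intro grouplike_upto_tmult grouplike_upto_tinv) auto
      ultimately show ?thesis
        using shuffle_defect_tmult[of n "f x" "group_incr f x y" u v] gl[of x] that len ne
        unfolding \<phi>_def by simp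
    qed
    have big: "\<bar>\<phi> (group_incr f x y)\<bar> \<le> A * \<omega> x y powr \<theta>'" if "0 \<le> x" "x \<le> y" "y \<le> T" for x y
    proof -
      have "\<bar>shuffle_eval (group_incr f x y) u v\<bar> \<le> S * (C * \<omega> x y powr \<theta>')"
      proof (rule S(2))
        fix z :: "'a list" assume z: "length z = length u + length v"
        then have "length z = Suc n" using len by simp
        then show "\<bar>group_incr f x y z\<bar> \<le> C * \<omega> x y powr \<theta>'"
          using bound[of z x y] that by (simp add: \<theta>'_def)
      qed
      moreover have "\<bar>group_incr f x y u * group_incr f x y v\<bar> \<le>
          (C * \<omega> x y powr (real (length u) / p)) * (C * \<omega> x y powr (real (length v) / p))"
        unfolding abs_mult using ne len that C
        by (intro mult_mono bound) (auto simp: Suc_le_eq)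
      moreover have "(C * \<omega> x y powr (real (length u) / p)) * (C * \<omega> x y powr (real (length v) / p)) = C\<^sup>2 * \<omega> x y powr \<theta>'"
        using len by (simp add: power2_eq_square powr_add[symmetric] \<theta>'_def add_divide_distrib[symmetric] of_nat_add[symmetric] del: of_nat_add)
      ultimately show ?thesis unfolding \<phi>_def A_def distrib_right by (simp add: mult.assoc)
    qed
    have "\<phi> (f t) = \<phi> (f 0)"
    proof (rule sewing_uniqueness[OF w th(1)])
      fix \<epsilon> :: real assume "\<epsilon> > 0"
      obtain e where e: "e > 0" "\<And>a W. 0 \<le> a \<Longrightarrow> 0 \<le> W \<Longrightarrow> a \<le> e \<Longrightarrow> a \<le> A * W powr \<theta>' \<Longrightarrow> a \<le> \<epsilon> * W powr \<theta>"
        using interpolate_bounds[OF A th(2,3) \<open>\<epsilon> > 0\<close>] by auto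
      have "continuous_on {0..T} (\<lambda>t. \<phi> (f t))"
        unfolding \<phi>_def shuffle_eval_def pairing_def by (intro continuous_intros cont)
      then have "uniformly_continuous_on {0..T} (\<lambda>t. \<phi> (f t))" by (rule compact_uniformly_continuous) simp
      then obtain d where d: "d > 0" "\<And>x x'. x \<in> {0..T} \<Longrightarrow> x' \<in> {0..T} \<Longrightarrow> dist x' x < d \<Longrightarrow> dist (\<phi> (f x')) (\<phi> (f x)) < e"
        unfolding uniformly_continuous_on_def using e(1) by metis
      have "\<bar>\<phi> (f y) - \<phi> (f x)\<bar> \<le> \<epsilon> * \<omega> x y powr \<theta>" if "0 \<le> x" "x < y" "y \<le> T" "y - x \<le> d / 2" for x y
      proof (rule e(2))
        show "\<bar>\<phi> (f y) - \<phi> (f x)\<bar> \<le> e" using d(2)[of x y] that d(1) by (simp add: dist_real_def)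
        show "\<bar>\<phi> (f y) - \<phi> (f x)\<bar> \<le> A * \<omega> x y powr \<theta>'" using incr[of x y] big[of x y] that by simp
        show "0 \<le> \<omega> x y" using that by (intro superadditiveD(1)[OF w]) auto
      qed simp
      then show "\<exists>\<delta>>0. \<forall>x y. 0 \<le> x \<and> x < y \<and> y \<le> T \<and> y - x \<le> \<delta> \<longrightarrow> \<bar>\<phi> (f y) - \<phi> (f x)\<bar> \<le> \<epsilon> * \<omega> x y powr \<theta>"
        using d(1) by (intro exI[of _ "d / 2"]) auto
    qed (use t in auto)
    moreover have "\<phi> (f 0) = \<phi> tunit"
      unfolding \<phi>_def using start len by (auto intro!: arg_cong2[of _ _ _ _ "(-)"] arg_cong2[of _ _ _ _ "(*)"] shuffle_eval_cong)
    moreover have "grouplike_upto (length u + length v) (tunit :: 'a tseries)" by simp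
    then have "\<phi> tunit = 0" unfolding \<phi>_def grouplike_upto_def by simp
    ultimately show ?thesis by (simp add: \<phi>_def)
  qed
  then have "shuffle_eval (f t) u v = f t u * f t v" if "length u + length v = Suc n" for u v
    using that one by (cases "u = [] \<or> v = []") auto
  then show ?thesis
    using gl[OF t] unfolding grouplike_upto_def by (auto simp: le_Suc_eq)
qed

lemma level_regular_extend:
  fixes f :: "real \<Rightarrow> 'a::finite tseries"
  assumes w: "superadditive T \<omega>" and "p > 0" and np: "real (Suc n) > p" and "T \<ge> 0"
    and f: "level_regular p T \<omega> n f"
  obtains f' where "level_regular p T \<omega> (Suc n) f'" "\<And>t w. t \<in> {0..T} \<Longrightarrow> length w \<le> n \<Longrightarrow> f' t w = f t w"
proof -
  \<comment> \<open>Truncation puts 0 on level \<open>n + 1\<close>. Clamping the time to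
    \<open>[0,T]\<close> makes \<open>g t [] = 1\<close> hold for every real \<open>t\<close>, the
    form in which the preceding lemmas ask for it.\<close>
  define g where "g = (\<lambda>t. trunc n (f (max 0 (min T t))))"
  have gf: "g t w = f t w" if "t \<in> {0..T}" "length w \<le> n" for t w
    using that by (simp add: g_def trunc_def)
  have g0: "g t w = 0" if "length w > n" for t w using that by (simp add: g_def trunc_def)
  have gone: "g t [] = 1" for t
    using f \<open>T \<ge> 0\<close> by (auto simp: g_def level_regular_def grouplike_upto_def)
  have gcont: "continuous_on {0..T} (\<lambda>t. g t v)" for v
  proof (cases "length v \<le> n")
    case True
    then have "continuous_on {0..T} (\<lambda>t. f t v)" using f by (simp add: level_regular_def)
    then show ?thesis by (rule continuous_on_eq) (simp add: gf True)
  qed (simp add: g0)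
  obtain C where C: "C \<ge> 0" "\<And>w s t. 1 \<le> length w \<Longrightarrow> length w \<le> n \<Longrightarrow> 0 \<le> s \<Longrightarrow> s \<le> t \<Longrightarrow> t \<le> T \<Longrightarrow>
        \<bar>group_incr f s t w\<bar> \<le> C * \<omega> s t powr (real (length w) / p)"
    using f unfolding level_regular_def by blast
  have gC: "\<bar>group_incr g s t w\<bar> \<le> C * \<omega> s t powr (real (length w) / p)"
    if "1 \<le> length w" "length w \<le> n" "0 \<le> s" "s \<le> t" "t \<le> T" for w s t
  proof -
    have "group_incr g s t w = group_incr f s t w" by (rule group_incr_cong) (use that gf in auto)
    then show ?thesis using C(2)[OF that] by simp
  qed
  define K where "K = real n * C\<^sup>2 * sewing_const (real (Suc n) / p)"
  have "\<exists>h. length v = Suc n \<longrightarrow> h 0 = 0 \<and> continuous_on {0..T} h \<and>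
    (\<forall>s t. 0 \<le> s \<and> s \<le> t \<and> t \<le> T \<longrightarrow> \<bar>group_incr g s t v + h t - h s\<bar> \<le> K * \<omega> s t powr (real (Suc n) / p))" for v
  proof (cases "length v = Suc n")
    case True
    obtain h where "h 0 = 0" "continuous_on {0..T} h"
      "\<And>s t. 0 \<le> s \<Longrightarrow> s \<le> t \<Longrightarrow> t \<le> T \<Longrightarrow> \<bar>group_incr g s t v + h t - h s\<bar> \<le>
       real n * C\<^sup>2 * sewing_const (real (Suc n) / p) * \<omega> s t powr (real (Suc n) / p)"
      using level_regular_correction[OF w \<open>p > 0\<close> np C(1) gC gone gcont True] by blast
    then show ?thesis unfolding K_def by blast
  qed simp
  then obtain h where h: "\<And>v. length v = Suc n \<Longrightarrow> h v 0 = 0" "\<And>v. length v = Suc n \<Longrightarrow> continuous_on {0..T} (h v)"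
    "\<And>v s t. length v = Suc n \<Longrightarrow> 0 \<le> s \<Longrightarrow> s \<le> t \<Longrightarrow> t \<le> T \<Longrightarrow>
       \<bar>group_incr g s t v + h v t - h v s\<bar> \<le> K * \<omega> s t powr (real (Suc n) / p)"
    by metis
  define f' where "f' = (\<lambda>t w. if length w = Suc n then h w t else g t w)"
  have f'g: "f' t w = g t w" if "length w \<le> n" for t w using that by (simp add: f'_def)
  have f'h: "f' t w = h w t" if "length w = Suc n" for t w using that by (simp add: f'_def)
  have one: "f' t [] = 1" for t using gone by (simp add: f'_def)
  have cont: "continuous_on {0..T} (\<lambda>t. f' t v)" for v
    by (cases "length v = Suc n") (simp_all add: f'_def gcont h(2))
  have top: "group_incr f' s t v = group_incr g s t v + h v t - h v s" if "length v = Suc n" for s t v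
  proof -
    have "group_incr f' s t v - group_incr g s t v = (f' t v - g t v) - (f' s v - g s v)"
      by (rule group_incr_top) (use that one gone f'g in auto)
    then show ?thesis using that by (simp add: f'h g0)
  qed
  define C' where "C' = max C K"
  have C': "C' \<ge> 0" using C by (simp add: C'_def)
  have bound: "\<bar>group_incr f' s t v\<bar> \<le> C' * \<omega> s t powr (real (length v) / p)"
    if "1 \<le> length v" "length v \<le> Suc n" "0 \<le> s" "s \<le> t" "t \<le> T" for v s t
  proof (cases "length v = Suc n")
    case True
    have "\<bar>group_incr f' s t v\<bar> \<le> K * \<omega> s t powr (real (Suc n) / p)"
      using h(3)[OF True that(3-5)] top[OF True] by simp
    also have "\<dots> \<le> C' * \<omega> s t powr (real (Suc n) / p)" by (intro mult_right_mono) (auto simp: C'_def)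
    finally show ?thesis by (simp only: True)
  next
    case False
    then have l: "length v \<le> n" using that by simp
    have "group_incr f' s t v = group_incr g s t v" by (rule group_incr_cong) (use l f'g in auto)
    then have "\<bar>group_incr f' s t v\<bar> \<le> C * \<omega> s t powr (real (length v) / p)" using gC[OF that(1) l that(3-)] by simp
    also have "\<dots> \<le> C' * \<omega> s t powr (real (length v) / p)" by (intro mult_right_mono) (auto simp: C'_def)
    finally show ?thesis .
  qed
  have gl: "grouplike_upto n (f' t)" if "t \<in> {0..T}" for t
  proof (rule grouplike_upto_cong)
    show "grouplike_upto n (f t)" using f that by (simp add: level_regular_def)
  qed (use that f'g gf in auto)
  have start: "f' 0 v = tunit v" if "length v \<le> Suc n" for v
  proof (cases "length v = Suc n")
    case True
    then show ?thesis using h(1) by (auto simp: f'h tunit_def)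
  next
    case False
    then show ?thesis using that f \<open>T \<ge> 0\<close> by (simp add: f'g gf level_regular_def)
  qed
  have "level_regular p T \<omega> (Suc n) f'"
    unfolding level_regular_def
    using shuffle_next_level[OF w \<open>p > 0\<close> np C' bound gl one cont start] cont start bound C' by blast
  then show ?thesis using that f'g gf by simp
qed

section \<open>The lift on all levels\<close>

lemma regular_family:
  fixes X :: "real \<Rightarrow> 'a::finite tseries"
  assumes w: "superadditive T \<omega>" and p: "p > 0" "real (Suc N) > p" "T \<ge> 0" and X: "level_regular p T \<omega> N X"
  obtains S where "\<And>n. level_regular p T \<omega> n S" "\<And>t w. t \<in> {0..T} \<Longrightarrow> length w \<le> N \<Longrightarrow> S t w = X t w"
proof -
  let ?Q = "\<lambda>n f f'. \<forall>t\<in>{0..T}. \<forall>w. length w \<le> N + n \<longrightarrow> f' t w = f t w"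
  have "\<exists>F. F 0 = X \<and> (\<forall>n. level_regular p T \<omega> (N + n) (F n) \<and> ?Q n (F n) (F (Suc n)))"
  proof -
    have "\<exists>F. \<forall>n. (level_regular p T \<omega> (N + n) (F n) \<and> (n = 0 \<longrightarrow> F n = X)) \<and> ?Q n (F n) (F (Suc n))"
    proof (rule dependent_nat_choice)
      show "\<exists>x. level_regular p T \<omega> (N + 0) x \<and> (0 = (0::nat) \<longrightarrow> x = X)" using X by auto
    next
      fix f n assume f: "level_regular p T \<omega> (N + n) f \<and> (n = 0 \<longrightarrow> f = X)"
      have "real (Suc (N + n)) > p" using p(2) by simp
      then obtain f' where "level_regular p T \<omega> (Suc (N + n)) f'" "?Q n f f'"
        using level_regular_extend[OF w p(1) _ p(3)] f by metis
      then show "\<exists>y. (level_regular p T \<omega> (N + Suc n) y \<and> (Suc n = 0 \<longrightarrow> y = X)) \<and> ?Q n f y" by auto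
    qed
    then show ?thesis by blast
  qed
  then obtain F where F0: "F 0 = X" and F: "\<And>n. level_regular p T \<omega> (N + n) (F n)"
    and FS: "\<And>n t w. t \<in> {0..T} \<Longrightarrow> length w \<le> N + n \<Longrightarrow> F (Suc n) t w = F n t w" by blast
  have Fle: "F (n + k) t w = F n t w" if "t \<in> {0..T}" "length w \<le> N + n" for n k t w
    by (induction k) (use that FS in auto)
  \<comment> \<open>An extension leaves lower levels untouched, so on a word \<open>w\<close> the
    sequence is constant once \<open>N + n \<ge> length w\<close>; the index \<open>length w\<close>
    always suffices.\<close>
  define S where "S = (\<lambda>t w. F (length w) t w)"
  have SF: "S t w = F n t w" if "t \<in> {0..T}" "length w \<le> N + n" for n t w
  proof (cases "length w \<le> n")
    case True
    then show ?thesis using Fle[of t w "length w" "n - length w"] that by (simp add: S_def)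
  next
    case False
    then show ?thesis using Fle[of t w n "length w - n"] that by (simp add: S_def)
  qed
  have "level_regular p T \<omega> n S" for n
    unfolding level_regular_def
  proof (intro conjI allI impI ballI)
    fix t assume t: "t \<in> {0..T}"
    show "grouplike_upto n (S t)"
    proof (rule grouplike_upto_cong)
      have "grouplike_upto (N + n) (F n t)" using F[of n] t by (simp add: level_regular_def)
      then show "grouplike_upto n (F n t)" by (rule grouplike_upto_mono) simp
    qed (use t in \<open>simp add: SF[of t _ n]\<close>)
  next
    fix w :: "'a list" assume l: "length w \<le> n"
    then have "continuous_on {0..T} (\<lambda>t. F n t w)" using F[of n] by (simp add: level_regular_def)
    then show "continuous_on {0..T} (\<lambda>t. S t w)"
      by (rule continuous_on_eq) (use l in \<open>simp add: SF[of _ w n]\<close>)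
    show "S 0 w = tunit w" using SF[of 0 w n] l p(3) F[of n] by (simp add: level_regular_def)
  next
    obtain C where C: "C \<ge> 0" "\<And>w s t. 1 \<le> length w \<Longrightarrow> length w \<le> N + n \<Longrightarrow> 0 \<le> s \<Longrightarrow> s \<le> t \<Longrightarrow> t \<le> T \<Longrightarrow>
        \<bar>group_incr (F n) s t w\<bar> \<le> C * \<omega> s t powr (real (length w) / p)"
      using F[of n] unfolding level_regular_def by blast
    have "\<bar>group_incr S s t w\<bar> \<le> C * \<omega> s t powr (real (length w) / p)"
      if "1 \<le> length w" "length w \<le> n" "0 \<le> s" "s \<le> t" "t \<le> T" for w s t
    proof -
      have "group_incr S s t w = group_incr (F n) s t w"
        by (rule group_incr_cong) (use that in \<open>auto intro!: SF\<close>)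
      then show ?thesis using C(2)[of w s t] that by simp
    qed
    then show "\<exists>C\<ge>0. \<forall>w s t. 1 \<le> length w \<and> length w \<le> n \<and> 0 \<le> s \<and> s \<le> t \<and> t \<le> T \<longrightarrow>
        \<bar>group_incr S s t w\<bar> \<le> C * \<omega> s t powr (real (length w) / p)"
      using C(1) by blast
  qed
  moreover have "S t w = X t w" if "t \<in> {0..T}" "length w \<le> N" for t w
    using SF[of t w 0] that by (simp add: F0)
  ultimately show ?thesis using that by blast
qed

text \<open>Raised to the power \<open>p / k\<close>, the bound on level \<open>k\<close> becomes a
  multiple of \<open>\<omega>\<close>, whose sums over partitions are at most
  \<open>\<omega> 0 T\<close>.\<close>

lemma level_regular_pvar_paths:
  fixes S :: "real \<Rightarrow> 'a::finite tseries"
  assumes w: "superadditive T \<omega>" and p: "p > 0" "T \<ge> 0" and S: "\<And>n. level_regular p T \<omega> n S"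
  shows "(\<lambda>t. trunc M (S t)) \<in> pvar_paths p M T"
proof -
  have gl: "S t \<in> grouplike" if "t \<in> {0..T}" for t
    using S that by (simp add: grouplike_iff level_regular_def)
  have tg: "trunc M (S t) \<in> grouplike_trunc M" if "t \<in> {0..T}" for t
    using gl[OF that] by (simp add: grouplike_trunc_def)
  have cont: "continuous_on {0..T} (\<lambda>t. S t w)" for w
    using S[of "length w"] by (simp add: level_regular_def)
  have start: "S 0 = tunit"
  proof
    fix w show "S 0 w = tunit w" using S[of "length w"] by (simp add: level_regular_def)
  qed
  obtain C where C: "C \<ge> 0" "\<And>w s t. 1 \<le> length w \<Longrightarrow> length w \<le> M \<Longrightarrow> 0 \<le> s \<Longrightarrow> s \<le> t \<Longrightarrow> t \<le> T \<Longrightarrow>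
        \<bar>group_incr S s t w\<bar> \<le> C * \<omega> s t powr (real (length w) / p)"
    using S[of M] unfolding level_regular_def by blast
  define B where "B = (\<Sum>k\<in>{1..M}. (C powr (p / real k) * \<omega> 0 T) powr (real k / p))"
  have W: "\<omega> 0 T \<ge> 0" using p by (intro superadditiveD(1)[OF w]) auto
  have "pvar_norm p M 0 T (incr M (\<lambda>t. trunc M (S t))) \<le> ennreal B"
    unfolding pvar_norm_def
  proof (intro SUP_least ennreal_leI)
    fix k D assume k: "k \<in> {1..M}" and D: "D \<in> partitions 0 T"
    let ?I = "incr M (\<lambda>t. trunc M (S t))"
    have "(\<Sum>i<length D - 1. level_norm k (?I (D ! i) (D ! Suc i)) powr (p / real k)) =
        chain_sum (\<lambda>x y. level_norm k (?I x y) powr (p / real k)) D" by (simp add: chain_sum_nth)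
    also have "\<dots> \<le> chain_sum (\<lambda>x y. C powr (p / real k) * \<omega> x y) D"
    proof (rule chain_sum_mono[OF D])
      fix x y assume xy: "0 \<le> x" "x < y" "y \<le> T"
      have "level_norm k (?I x y) \<le> C * \<omega> x y powr (real k / p)"
      proof (rule level_norm_le)
        fix v :: "'a list" assume v: "length v = k"
        have "?I x y = trunc M (group_incr (\<lambda>t. trunc M (S t)) x y)"
          by (rule incr_eq) (use tg[of x] xy in auto)
        then have "?I x y v = group_incr (\<lambda>t. trunc M (S t)) x y v"
          using k v by (simp add: trunc_def)
        also have "\<dots> = group_incr S x y v"
          by (rule group_incr_cong) (use k v in \<open>auto simp: trunc_def\<close>)
        finally show "\<bar>?I x y v\<bar> \<le> C * \<omega> x y powr (real k / p)"
          using C(2)[of v x y] k v xy by simp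
      qed
      then have "level_norm k (?I x y) powr (p / real k) \<le> (C * \<omega> x y powr (real k / p)) powr (p / real k)"
        using p by (intro powr_mono2 level_norm_nonneg) auto
      also have "\<dots> = C powr (p / real k) * \<omega> x y"
        using C(1) p k superadditiveD(1)[OF w, of x y] xy by (simp add: powr_mult powr_powr)
      finally show "level_norm k (?I x y) powr (p / real k) \<le> C powr (p / real k) * \<omega> x y" .
    qed
    also have "\<dots> = C powr (p / real k) * chain_sum \<omega> D" by (rule chain_sum_cmult)
    also have "\<dots> \<le> C powr (p / real k) * \<omega> 0 T"
      by (intro mult_left_mono superadditive_chain_sum[OF w D]) auto
    finally have "(\<Sum>i<length D - 1. level_norm k (?I (D ! i) (D ! Suc i)) powr (p / real k)) powr (real k / p)
       \<le> (C powr (p / real k) * \<omega> 0 T) powr (real k / p)"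
      using p by (intro powr_mono2 sum_nonneg) auto
    also have "\<dots> \<le> B" unfolding B_def using k by (intro member_le_sum) auto
    finally show "(\<Sum>i<length D - 1. level_norm k (?I (D ! i) (D ! Suc i)) powr (p / real k)) powr (real k / p) \<le> B" .
  qed
  then have "pvar_norm p M 0 T (incr M (\<lambda>t. trunc M (S t))) < \<infinity>"
    by (rule order.strict_trans1) simp
  moreover have "continuous_on {0..T} (\<lambda>t. trunc M (S t) w)" for w
    by (cases "length w \<le> M") (simp_all add: trunc_def cont)
  ultimately show ?thesis by (simp add: pvar_paths_def tg start)
qed

lemma lyons_lift_exists:
  fixes X :: "real \<Rightarrow> 'a::finite tseries"
  assumes X: "X \<in> pvar_paths p (nat \<lfloor>p\<rfloor>) T" and p: "p \<ge> 1" "T \<ge> 0"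
  obtains S where "is_lyons_lift p T X S"
proof -
  let ?N = "nat \<lfloor>p\<rfloor>"
  have N: "real (Suc ?N) > p" using p by linarith
  have p0: "p > 0" using p by simp
  obtain \<omega> where w: "superadditive T \<omega>" and reg: "level_regular p T \<omega> ?N X"
    using pvar_paths_level_regular[OF X p0] by blast
  obtain S where S: "\<And>n. level_regular p T \<omega> n S" "\<And>t w. t \<in> {0..T} \<Longrightarrow> length w \<le> ?N \<Longrightarrow> S t w = X t w"
    using regular_family[OF w p0 N p(2) reg] by blast
  have "trunc ?N (S t) = X t" if t: "t \<in> {0..T}" for t
  proof
    fix w show "trunc ?N (S t) w = X t w"
      using S(2)[OF t, of w] grouplike_trunc_beyond[OF pvar_paths_grouplike[OF X t], of w]
      by (simp add: trunc_def)
  qed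
  moreover have "S t \<in> grouplike" if "t \<in> {0..T}" for t
    using S(1) that by (simp add: grouplike_iff level_regular_def)
  ultimately have "is_lyons_lift p T X S"
    unfolding is_lyons_lift_def using level_regular_pvar_paths[OF w p0 p(2) S(1)] by blast
  then show ?thesis by (rule that)
qed

section \<open>Uniqueness of the lift\<close>

lemma lyons_lift_one: "is_lyons_lift p T X S \<Longrightarrow> t \<in> {0..T} \<Longrightarrow> S t [] = 1"
  by (auto simp: is_lyons_lift_def grouplike_iff grouplike_upto_def)

lemma lyons_lift_low:
  assumes "is_lyons_lift p T X S" "t \<in> {0..T}" "length w \<le> nat \<lfloor>p\<rfloor>"
  shows "S t w = X t w"
proof -
  have "trunc (nat \<lfloor>p\<rfloor>) (S t) = X t" using assms by (simp add: is_lyons_lift_def)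
  from fun_cong[OF this, of w] show ?thesis using assms by (simp add: trunc_def)
qed

lemma lyons_lift_continuous:
  fixes S :: "real \<Rightarrow> 'a::finite tseries"
  assumes "is_lyons_lift p T X S"
  shows "continuous_on {0..T} (\<lambda>t. S t w)"
proof -
  have "(\<lambda>t. trunc (length w) (S t)) \<in> pvar_paths p (length w) T"
    using assms by (simp add: is_lyons_lift_def)
  from pvar_paths_continuous[OF this, of w] show ?thesis by (simp add: trunc_def)
qed

lemma lyons_lift_start:
  fixes S :: "real \<Rightarrow> 'a::finite tseries"
  assumes "is_lyons_lift p T X S"
  shows "S 0 = tunit"
proof
  fix w :: "'a list"
  have "(\<lambda>t. trunc (length w) (S t)) \<in> pvar_paths p (length w) T"
    using assms by (simp add: is_lyons_lift_def)
  then have "trunc (length w) (S 0) = tunit" by (simp add: pvar_paths_def)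
  from fun_cong[OF this, of w] show "S 0 w = tunit w" by (simp add: trunc_def)
qed

lemma lyons_lift_group_incr_small:
  assumes S: "is_lyons_lift p T X S" and "w \<noteq> []" "\<epsilon> > 0"
  shows "\<exists>\<delta>>0. \<forall>s t. 0 \<le> s \<and> s \<le> t \<and> t \<le> T \<and> t - s \<le> \<delta> \<longrightarrow> \<bar>group_incr S s t w\<bar> \<le> \<epsilon>"
  by (rule group_incr_small) (use lyons_lift_continuous[OF S] lyons_lift_one[OF S] assms in auto)

text \<open>Above level \<open>p\<close> the increments have exponent below \<open>1\<close> in the variation sum, so their own sum vanishes with the mesh.\<close>

lemma lyons_lift_chain_small:
  assumes S: "is_lyons_lift p T X S" and p: "p > 0" and w: "real (length w) > p" and "\<epsilon> > 0"
  shows "\<exists>\<delta>>0. \<forall>t\<in>{0..T}. \<forall>D\<in>partitions 0 t. mesh_le \<delta> D \<longrightarrow> chain_sum (\<lambda>x y. \<bar>group_incr S x y w\<bar>) D \<le> \<epsilon>"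
proof -
  let ?k = "length w"
  have k: "1 \<le> ?k" and wne: "w \<noteq> []" using w p by (cases w; simp)+
  have "(\<lambda>t. trunc ?k (S t)) \<in> pvar_paths p ?k T"
    using S by (simp add: is_lyons_lift_def)
  from pvar_paths_bound[OF this p k order_refl]
  obtain B where B: "\<And>D. D\<in>partitions 0 T \<Longrightarrow>
      chain_sum (\<lambda>x y. level_norm ?k (group_incr (\<lambda>t. trunc ?k (S t)) x y) powr (p / real ?k)) D \<le> B" by blast
  define F where "F = (\<lambda>x y. \<bar>group_incr S x y w\<bar> powr (p / real ?k))"
  have F0: "F x y \<ge> 0" for x y by (simp add: F_def)
  have FB: "chain_sum F D \<le> B" if D: "D \<in> partitions 0 T" for D
  proof -
    have "chain_sum F D \<le> chain_sum (\<lambda>x y. level_norm ?k (group_incr (\<lambda>t. trunc ?k (S t)) x y) powr (p / real ?k)) D"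
    proof (rule chain_sum_mono[OF D])
      fix x y
      have "group_incr S x y w = group_incr (\<lambda>t. trunc ?k (S t)) x y w"
        by (rule group_incr_cong) (auto simp: trunc_def)
      then show "F x y \<le> level_norm ?k (group_incr (\<lambda>t. trunc ?k (S t)) x y) powr (p / real ?k)"
        unfolding F_def using p by (intro powr_mono2) (auto intro: level_norm_ge)
    qed
    then show ?thesis using B[OF D] by linarith
  qed
  define l where "l = p / real ?k"
  have "0 < real ?k" using p w by linarith
  then have l: "0 < l" "l < 1" using p w by (auto simp: l_def divide_less_eq)
  define B' where "B' = \<bar>B\<bar> + 1"
  have B': "B' > 0" "B \<le> B'" by (auto simp: B'_def)
  \<comment> \<open>An increment \<open>a\<close> of size at most \<open>e\<close> satisfies
    \<open>a \<le> e powr (1 - l) * a powr l\<close>, and the sums of \<open>a powr l\<close> are at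
    most \<open>B'\<close>; \<open>e\<close> is chosen so that the product is
    \<open>\<epsilon>\<close>.\<close>
  define e where "e = (\<epsilon> / B') powr (1 / (1 - l))"
  have e: "e > 0" using B' \<open>\<epsilon> > 0\<close> by (simp add: e_def)
  have e1: "e powr (1 - l) * B' = \<epsilon>" using l B' \<open>\<epsilon> > 0\<close> by (simp add: e_def powr_powr)
  obtain d where d: "d > 0" "\<And>s t. 0 \<le> s \<Longrightarrow> s \<le> t \<Longrightarrow> t \<le> T \<Longrightarrow> t - s \<le> d \<Longrightarrow> \<bar>group_incr S s t w\<bar> \<le> e"
    using lyons_lift_group_incr_small[OF S wne e] by blast
  have "chain_sum (\<lambda>x y. \<bar>group_incr S x y w\<bar>) D \<le> \<epsilon>"
    if t: "t \<in> {0..T}" and D: "D \<in> partitions 0 t" "mesh_le d D" for t D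
  proof -
    have "chain_sum (\<lambda>x y. \<bar>group_incr S x y w\<bar>) D \<le> chain_sum (\<lambda>x y. e powr (1 - l) * F x y) D"
    proof (rule chain_sum_mono_mesh[OF D])
      fix x y assume "0 \<le> x" "x < y" "y \<le> t" "y - x \<le> d"
      then have "\<bar>group_incr S x y w\<bar> \<le> e" using d(2)[of x y] t by auto
      then have "\<bar>group_incr S x y w\<bar> powr (1 - l) * F x y \<le> e powr (1 - l) * F x y"
        using l F0 by (intro mult_right_mono powr_mono2) auto
      then show "\<bar>group_incr S x y w\<bar> \<le> e powr (1 - l) * F x y"
        by (simp add: F_def l_def[symmetric] powr_add[symmetric])
    qed
    also have "\<dots> = e powr (1 - l) * chain_sum F D" by (rule chain_sum_cmult)
    also have "\<dots> \<le> e powr (1 - l) * B'"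
    proof -
      obtain E where "E \<in> partitions 0 T" "chain_sum F D \<le> chain_sum F E"
        by (rule partitions_extend[OF F0 D(1)]) (use t in auto)
      then have "chain_sum F D \<le> B'" using FB[of E] B' by linarith
      then show ?thesis by (intro mult_left_mono) auto
    qed
    finally show ?thesis using e1 by simp
  qed
  then show ?thesis using d(1) by blast
qed

text \<open>The part of \<open>S y w - S x w\<close> that is determined by words shorter than
  \<open>w\<close>; what it misses is the top increment \<open>group_incr S x y w\<close>.\<close>

definition lift_germ :: "(real \<Rightarrow> 'a tseries) \<Rightarrow> 'a list \<Rightarrow> real \<Rightarrow> real \<Rightarrow> real" where
  "lift_germ S w x y = (\<Sum>k\<in>{1..<length w}. S x (take k w) * group_incr S x y (drop k w))"

text \<open>Above level \<open>p\<close> the sums of the top increments vanish with the mesh, so the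
  germs alone recover \<open>S t w\<close>. The partitions are equidistant and explicit, so that the
  limit is one of a sequence and its times do not depend on the path.\<close>

lemma lift_germ_limit:
  assumes S: "is_lyons_lift p T X S" and p: "p > 0" and w: "real (length w) > p" and t: "0 < t" "t \<le> T"
  shows "(\<lambda>n. \<Sum>i<Suc n. lift_germ S w (t * real i / real (Suc n)) (t * real (Suc i) / real (Suc n))) \<longlonglongrightarrow> S t w"
proof -
  define U where "U = (\<lambda>n. map (\<lambda>i. t * real i / real (Suc n)) [0..<Suc (Suc n)])"
  have U: "U n \<in> partitions 0 t" for n
    unfolding partitions_def using t
    by (auto simp: U_def hd_map last_map sorted_wrt_map sorted_wrt_upt divide_strict_right_mono
        intro!: sorted_wrt_mono_rel[OF _ sorted_wrt_upt] simp del: upt_Suc of_nat_Suc)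
  have Unth: "U n ! i = t * real i / real (Suc n)" if "i < Suc (Suc n)" for n i
    using that by (simp add: U_def del: upt_Suc of_nat_Suc)
  have lenU: "length (U n) = Suc (Suc n)" for n by (simp add: U_def)
  have mesh: "mesh_le (t / real (Suc n)) (U n)" for n
    unfolding mesh_le_def lenU
    by (auto simp: Unth diff_divide_distrib[symmetric] algebra_simps simp del: of_nat_Suc)
      (simp add: divide_right_mono algebra_simps)
  have wne: "w \<noteq> []" using w p by auto
  have eq: "(\<Sum>i<Suc n. lift_germ S w (t * real i / real (Suc n)) (t * real (Suc i) / real (Suc n))) =
     chain_sum (lift_germ S w) (U n)" for n
    unfolding chain_sum_nth lenU by (simp add: Unth del: of_nat_Suc sum.lessThan_Suc)
  have S0: "S 0 w = 0" using lyons_lift_start[OF S] wne by (simp add: tunit_def)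
  have tel: "S t w = chain_sum (lift_germ S w) (U n) + chain_sum (\<lambda>x y. group_incr S x y w) (U n)" for n
  proof -
    have "S t w = chain_sum (\<lambda>x y. S y w - S x w) (U n)"
      using U[of n] S0 by (subst chain_sum_telescope) (auto simp: partitions_def)
    also have "\<dots> = chain_sum (\<lambda>x y. lift_germ S w x y + group_incr S x y w) (U n)"
      unfolding chain_sum_nth
    proof (intro sum.cong refl)
      fix i assume "i \<in> {..<length (U n) - 1}"
      then have "U n ! i \<in> {0..T}" "U n ! Suc i \<in> {0..T}"
        using partitions_nth[OF U[of n], of i] t by auto
      then show "S (U n ! Suc i) w - S (U n ! i) w =
          lift_germ S w (U n ! i) (U n ! Suc i) + group_incr S (U n ! i) (U n ! Suc i) w"
        using group_incr_middle[of S "U n ! i" "U n ! Suc i" w] lyons_lift_one[OF S] wne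
        by (simp add: lift_germ_def)
    qed
    finally show ?thesis by (simp add: chain_sum_add)
  qed
  show ?thesis
    unfolding eq
  proof (rule LIMSEQ_I)
    fix r :: real assume "r > 0"
    then obtain d where d: "d > 0" "\<And>t D. t \<in> {0..T} \<Longrightarrow> D \<in> partitions 0 t \<Longrightarrow> mesh_le d D \<Longrightarrow>
        chain_sum (\<lambda>x y. \<bar>group_incr S x y w\<bar>) D \<le> r / 2"
      using lyons_lift_chain_small[OF S p w, of "r / 2"] by (metis half_gt_zero)
    obtain n0 where n0: "inverse (real (Suc n0)) < d / t" using reals_Archimedean[of "d / t"] d t by auto
    have "norm (chain_sum (lift_germ S w) (U n) - S t w) < r" if "n \<ge> n0" for n
    proof -
      have "t < d * real (Suc n0)" using n0 t by (simp add: field_simps)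
      also have "\<dots> \<le> d * real (Suc n)" using that d by (intro mult_left_mono) auto
      finally have "t / real (Suc n) \<le> d" by (simp add: field_simps)
      then have m: "mesh_le d (U n)" using mesh[of n] unfolding mesh_le_def by force
      have "\<bar>chain_sum (\<lambda>x y. group_incr S x y w) (U n)\<bar> \<le> r / 2"
        using chain_sum_abs[of "\<lambda>x y. group_incr S x y w" "U n"] d(2)[OF _ U m] t by simp
      then show ?thesis using tel[of n] \<open>r > 0\<close> by (simp add: abs_if split: if_splits)
    qed
    then show "\<exists>no. \<forall>n\<ge>no. norm (chain_sum (lift_germ S w) (U n) - S t w) < r" by blast
  qed
qed

lemma lift_germ_cong:
  assumes "\<And>v. length v < length w \<Longrightarrow> S x v = S' x v" "\<And>v. length v < length w \<Longrightarrow> S y v = S' y v"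
  shows "lift_germ S w x y = lift_germ S' w x y"
  unfolding lift_germ_def
  by (intro sum.cong arg_cong2[of _ _ _ _ "(*)"] group_incr_cong) (auto simp: assms)

text \<open>Up to level \<open>p\<close> both lifts are the given path, and above it each is the
  limit of the same germs in lower levels, by induction on the length of words.\<close>

lemma lyons_lift_unique:
  assumes S: "is_lyons_lift p T X S" and S': "is_lyons_lift p T X S'" and p: "p \<ge> 1" and t: "t \<in> {0..T}"
  shows "S t = S' t"
proof
  fix w show "S t w = S' t w" using t
  proof (induction "length w" arbitrary: w t rule: less_induct)
    case less
    show ?case
    proof (cases "length w \<le> nat \<lfloor>p\<rfloor> \<or> t = 0")
      case True
      then show ?thesis
        using lyons_lift_low[OF S less.prems] lyons_lift_low[OF S' less.prems]
          lyons_lift_start[OF S] lyons_lift_start[OF S'] by auto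
    next
      case False
      then have w: "real (length w) > p" and t0: "0 < t" "t \<le> T" using p less.prems by (auto, linarith)
      have "lift_germ S w (t * real i / real (Suc n)) (t * real (Suc i) / real (Suc n)) =
          lift_germ S' w (t * real i / real (Suc n)) (t * real (Suc i) / real (Suc n))" if "i < Suc n" for n i
      proof -
        have "t * real j / real (Suc n) \<in> {0..T}" if "j \<le> Suc n" for j
        proof -
          have "t * real j \<le> t * real (Suc n)" using that t0 by (intro mult_left_mono) auto
          then have "t * real j / real (Suc n) \<le> t" by (simp add: field_simps del: of_nat_Suc)
          then show ?thesis using t0 by auto
        qed
        then show ?thesis using that by (intro lift_germ_cong less.hyps) (auto simp del: of_nat_Suc atLeastAtMost_iff)
      qed
      then have "(\<Sum>i<Suc n. lift_germ S w (t * real i / real (Suc n)) (t * real (Suc i) / real (Suc n))) =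
          (\<Sum>i<Suc n. lift_germ S' w (t * real i / real (Suc n)) (t * real (Suc i) / real (Suc n)))" for n
        by (intro sum.cong) auto
      then show ?thesis
        using lift_germ_limit[OF S _ w t0] lift_germ_limit[OF S' _ w t0] p
        by (metis (no_types, lifting) LIMSEQ_unique ext less_le_trans zero_less_one)
    qed
  qed
qed

lemma rp_signature_eq:
  assumes S: "is_lyons_lift p T X S" and p: "p \<ge> 1" and t: "t \<in> {0..T}"
  shows "rp_signature p T X t = S t"
  unfolding rp_signature_def
proof (rule the_equality)
  show "\<exists>S'. is_lyons_lift p T X S' \<and> S' t = S t" using S by blast
next
  fix a assume "\<exists>S'. is_lyons_lift p T X S' \<and> S' t = a"
  then obtain S' where "is_lyons_lift p T X S'" "S' t = a" by blast
  then show "a = S t" using lyons_lift_unique[OF _ S p t] by simp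
qed

section \<open>The time letter on all levels\<close>

lemma group_incr_time_letter:
  assumes one: "\<And>t. t \<in> {0..T} \<Longrightarrow> S t [] = 1" and cont: "\<And>v. continuous_on {0..T} (\<lambda>t. S t v)"
    and time: "\<And>u t. length u \<le> length v \<Longrightarrow> t \<in> {0..T} \<Longrightarrow> S t (u @ [a]) = integral {0..t} (\<lambda>r. S r u)"
    and st: "0 \<le> s" "s \<le> t" "t \<le> T"
  shows "group_incr S s t (v @ [a]) = integral {s..t} (\<lambda>r. group_incr S s r v)"
proof -
  have int: "(\<lambda>r. S r u) integrable_on {x..y}" if "0 \<le> x" "y \<le> T" for u x y
    by (intro integrable_continuous_real continuous_on_subset[OF cont]) (use that in auto)
  have diff: "S t (u @ [a]) - S s (u @ [a]) = integral {s..t} (\<lambda>r. S r u)" if "length u \<le> length v" for u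
    using Henstock_Kurzweil_Integration.integral_combine[of 0 s t "\<lambda>r. S r u"] int[of 0 t u] time[OF that, of t] time[OF that, of s] st by auto
  have "group_incr S s s (v @ [a]) = 0" using one[of s] st by (simp add: group_incr_refl tunit_def)
  then have "group_incr S s t (v @ [a]) = group_incr S s t (v @ [a]) - group_incr S s s (v @ [a])" by simp
  \<comment> \<open>The term in which the whole word falls to the past \<open>tinv (S s)\<close> is
    the same at \<open>s\<close> and at \<open>t\<close> and cancels. In the others the past is
    constant in the integration variable.\<close>
  also have "\<dots> = (\<Sum>i\<le>length v. tinv (S s) (take i v) * (S t (drop i v @ [a]) - S s (drop i v @ [a])))"
    unfolding group_incr_def tmult_snoc using one[of s] one[of t] st
    by (simp add: tmult_def sum_subtractf right_diff_distrib)
  also have "\<dots> = (\<Sum>i\<le>length v. integral {s..t} (\<lambda>r. tinv (S s) (take i v) * S r (drop i v)))"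
    by (intro sum.cong refl) (simp add: diff)
  also have "\<dots> = integral {s..t} (\<lambda>r. group_incr S s r v)"
    unfolding group_incr_def tmult_def using int st
    by (intro integral_sum[symmetric] integrable_on_mult_right) auto
  finally show ?thesis .
qed

text \<open>Up to level \<open>p\<close> this is inherited from the path. Above it, the difference
  \<open>\<phi>\<close> of both sides has increments made of two terms: the top increment, whose
  sums vanish with the mesh, and an integral that is small compared with \<open>y - x\<close>.
  Telescoping gives 0.\<close>

lemma lyons_lift_time_letter:
  fixes X :: "real \<Rightarrow> 'd::finite option tseries"
  assumes S: "is_lyons_lift p T X S" and X: "X \<in> Omega_hat p T" and p: "p \<ge> 1" "T > 0" and t: "t \<in> {0..T}"
  shows "S t (w @ [None]) = integral {0..t} (\<lambda>u. S u w)"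
  using t
proof (induction "length w" arbitrary: w t rule: less_induct)
  case less
  note one = lyons_lift_one[OF S] and cont = lyons_lift_continuous[OF S]
  have int: "(\<lambda>r. S r u) integrable_on {x..y}" if "0 \<le> x" "y \<le> T" for u x y
    by (intro integrable_continuous_real continuous_on_subset[OF cont]) (use that in auto)
  have gcont: "continuous_on {x..y} (\<lambda>r. group_incr S x r u)" if "0 \<le> x" "y \<le> T" for u x y
    unfolding group_incr_def tmult_def
    by (intro continuous_intros continuous_on_subset[OF cont]) (use that in auto)
  have gint: "(\<lambda>r. group_incr S x r u) integrable_on {x..y}" if "0 \<le> x" "y \<le> T" for u x y
    by (intro integrable_continuous_real gcont that)
  show ?case
  proof (cases "length w < nat \<lfloor>p\<rfloor>")
    case True
    have "S t (w @ [None]) = X t (w @ [None])" by (rule lyons_lift_low[OF S less.prems]) (use True in auto)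
    also have "\<dots> = integral {0..t} (\<lambda>u. X u w)" by (rule Omega_hat_time_letter[OF X p less.prems True])
    also have "\<dots> = integral {0..t} (\<lambda>u. S u w)"
      by (rule integral_cong) (use less.prems True lyons_lift_low[OF S, of _ w] in auto)
    finally show ?thesis .
  next
    case False
    let ?w = "w @ [None]"
    have wl: "real (length ?w) > p" using False p by (simp, linarith)
    have wne: "w \<noteq> []" using False p by (cases w) (auto simp: le_nat_iff)
    define \<phi> where "\<phi> = (\<lambda>t. S t ?w - integral {0..t} (\<lambda>u. S u w))"
    \<comment> \<open>The shorter words ending in the time letter are integrals by induction, and
      Chen's relation under the integral cancels everything but these two terms.\<close>
    have incr: "\<phi> y - \<phi> x = group_incr S x y ?w - integral {x..y} (\<lambda>r. group_incr S x r w)"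
      if xy: "0 \<le> x" "x \<le> y" "y \<le> T" for x y
    proof -
      have "S y ?w - S x ?w - group_incr S x y ?w =
          (\<Sum>k\<in>{1..<length ?w}. S x (take k ?w) * group_incr S x y (drop k ?w))"
        using group_incr_middle[of S x y ?w] one xy by simp
      also have "\<dots> = (\<Sum>k\<in>{1..<length ?w}. integral {x..y} (\<lambda>r. S x (take k w) * group_incr S x r (drop k w)))"
      proof (intro sum.cong refl)
        fix k assume k: "k \<in> {1..<length ?w}"
        have "group_incr S x y (drop k w @ [None]) = integral {x..y} (\<lambda>r. group_incr S x r (drop k w))"
          by (rule group_incr_time_letter[OF one cont less.hyps]) (use k xy wne in auto)
        then show "S x (take k ?w) * group_incr S x y (drop k ?w) =
            integral {x..y} (\<lambda>r. S x (take k w) * group_incr S x r (drop k w))"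
          using k by simp
      qed
      also have "\<dots> = integral {x..y} (\<lambda>r. \<Sum>k\<in>{1..<length ?w}. S x (take k w) * group_incr S x r (drop k w))"
        using xy by (intro integral_sum[symmetric] integrable_on_mult_right gint) auto
      also have "\<dots> = integral {x..y} (\<lambda>r. S r w - group_incr S x r w)"
      proof (rule integral_cong)
        fix r
        have "(S x \<otimes>\<^sub>t group_incr S x r) w = (\<Sum>k\<in>insert 0 {1..<length ?w}. S x (take k w) * group_incr S x r (drop k w))"
          unfolding tmult_def by (rule sum.cong) auto
        then have "S r w = (\<Sum>k\<in>insert 0 {1..<length ?w}. S x (take k w) * group_incr S x r (drop k w))"
          using group_incr_start[of S x r] one[of x] xy by simp
        then show "(\<Sum>k\<in>{1..<length ?w}. S x (take k w) * group_incr S x r (drop k w)) = S r w - group_incr S x r w"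
          using one[of x] xy by simp
      qed
      also have "\<dots> = integral {x..y} (\<lambda>r. S r w) - integral {x..y} (\<lambda>r. group_incr S x r w)"
        using xy by (intro integral_diff int gint) auto
      moreover have "integral {0..x} (\<lambda>r. S r w) + integral {x..y} (\<lambda>r. S r w) = integral {0..y} (\<lambda>r. S r w)"
        using xy by (intro Henstock_Kurzweil_Integration.integral_combine int) auto
      ultimately show ?thesis unfolding \<phi>_def by linarith
    qed
    have "\<bar>\<phi> t\<bar> \<le> 0 + e" if "e > 0" for e
    proof -
      define c where "c = e / (1 + T)"
      have c: "c > 0" "c * (1 + T) = e" using that p by (auto simp: c_def)
      obtain d1 where d1: "d1 > 0" "\<And>D. D \<in> partitions 0 t \<Longrightarrow> mesh_le d1 D \<Longrightarrow> chain_sum (\<lambda>x y. \<bar>group_incr S x y ?w\<bar>) D \<le> c"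
        using lyons_lift_chain_small[OF S _ wl c(1)] less.prems p by auto
      obtain d2 where d2: "d2 > 0" "\<And>s t. 0 \<le> s \<Longrightarrow> s \<le> t \<Longrightarrow> t \<le> T \<Longrightarrow> t - s \<le> d2 \<Longrightarrow> \<bar>group_incr S s t w\<bar> \<le> c"
        using lyons_lift_group_incr_small[OF S wne c(1)] by blast
      obtain D where D: "D \<in> partitions 0 t" "mesh_le (min d1 d2) D"
        using uniform_partition[of 0 t "min d1 d2"] d1 d2 less.prems by auto
      have m1: "mesh_le d1 D" using D(2) by (auto simp: mesh_le_def)
      have "\<phi> 0 = 0" using lyons_lift_start[OF S] by (simp add: \<phi>_def tunit_def)
      then have "\<bar>\<phi> t\<bar> = \<bar>chain_sum (\<lambda>x y. \<phi> y - \<phi> x) D\<bar>"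
        using D(1) by (subst chain_sum_telescope) (auto simp: partitions_def)
      also have "\<dots> \<le> chain_sum (\<lambda>x y. \<bar>\<phi> y - \<phi> x\<bar>) D" by (rule chain_sum_abs)
      also have "\<dots> \<le> chain_sum (\<lambda>x y. \<bar>group_incr S x y ?w\<bar> + c * (y - x)) D"
      proof (rule chain_sum_mono_mesh[OF D])
        fix x y assume xy: "0 \<le> x" "x < y" "y \<le> t" "y - x \<le> min d1 d2"
        have "norm (integral {x..y} (\<lambda>r. group_incr S x r w)) \<le> c * (y - x)"
        proof (rule integral_bound)
          show "continuous_on {x..y} (\<lambda>r. group_incr S x r w)" using xy less.prems by (intro gcont) auto
          fix r assume "r \<in> {x..y}"
          then show "norm (group_incr S x r w) \<le> c" using d2(2)[of x r] xy less.prems by auto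
        qed (use xy in auto)
        then show "\<bar>\<phi> y - \<phi> x\<bar> \<le> \<bar>group_incr S x y ?w\<bar> + c * (y - x)"
          using incr[of x y] xy less.prems by simp
      qed
      also have "\<dots> = chain_sum (\<lambda>x y. \<bar>group_incr S x y ?w\<bar>) D + c * chain_sum (\<lambda>x y. y - x) D"
        by (simp add: chain_sum_add chain_sum_cmult)
      also have "chain_sum (\<lambda>x y. y - x) D = t"
        using chain_sum_telescope[of D "\<lambda>x. x"] D(1) by (auto simp: partitions_def)
      also have "chain_sum (\<lambda>x y. \<bar>group_incr S x y ?w\<bar>) D + c * t \<le> c + c * T"
        using d1(2)[OF D(1) m1] c less.prems by (intro add_mono mult_left_mono) auto
      finally show ?thesis using c(2) by (simp add: distrib_left)
    qed
    then have "\<bar>\<phi> t\<bar> \<le> 0" by (rule field_le_epsilon)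
    then show ?thesis by (simp add: \<phi>_def)
  qed
qed

section \<open>Adaptedness of the signature\<close>

lemma pvar_paths_cong:
  fixes X X' :: "real \<Rightarrow> 'a::finite tseries"
  assumes X: "X \<in> pvar_paths p N T" and eq: "\<And>t. t \<in> {0..T} \<Longrightarrow> X' t = X t" and "T \<ge> 0"
  shows "X' \<in> pvar_paths p N T"
proof -
  have "incr N X' (D ! i) (D ! Suc i) = incr N X (D ! i) (D ! Suc i)"
    if "D \<in> partitions 0 T" "i < length D - 1" for D i
    using partitions_nth[OF that] eq by (simp add: incr_def)
  then have "pvar_norm p N 0 T (incr N X') = pvar_norm p N 0 T (incr N X)"
    unfolding pvar_norm_def
    by (intro SUP_cong refl arg_cong[of _ _ ennreal] arg_cong2[of _ _ _ _ "(powr)"] sum.cong) auto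
  moreover have "continuous_on {0..T} (\<lambda>t. X' t w)" for w
    using pvar_paths_continuous[OF X, of w] by (rule continuous_on_eq) (simp add: eq)
  ultimately show ?thesis using X eq \<open>T \<ge> 0\<close> by (simp add: pvar_paths_def)
qed

text \<open>Existence gives some lift, and uniqueness identifies \<open>rp_signature\<close> with it
  on \<open>[0,T]\<close>. Outside that interval the two may differ, so membership in
  \<open>pvar_paths\<close> is transferred by \<open>pvar_paths_cong\<close>.\<close>

lemma rp_signature_lift:
  fixes X :: "real \<Rightarrow> 'a::finite tseries"
  assumes X: "X \<in> pvar_paths p (nat \<lfloor>p\<rfloor>) T" and p: "p \<ge> 1" "T \<ge> 0"
  shows "is_lyons_lift p T X (rp_signature p T X)"
proof -
  obtain S where S: "is_lyons_lift p T X S" using lyons_lift_exists[OF X p] .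
  note eq = rp_signature_eq[OF S p(1)]
  have "(\<lambda>t. trunc N (rp_signature p T X t)) \<in> pvar_paths p N T" for N
    by (rule pvar_paths_cong[of "\<lambda>t. trunc N (S t)"]) (use S eq p in \<open>auto simp: is_lyons_lift_def\<close>)
  then show ?thesis using S by (simp add: is_lyons_lift_def eq)
qed

section \<open>Measurability of germs and of path suprema\<close>

lemma tinv_measurable:
  assumes "\<And>v. length v \<le> length w \<Longrightarrow> (\<lambda>\<omega>. f \<omega> v) \<in> borel_measurable A"
  shows "(\<lambda>\<omega>. tinv (f \<omega>) w) \<in> borel_measurable A"
  using assms
proof (induction "length w" arbitrary: w rule: less_induct)
  case less
  show ?case
  proof (cases "w = []")
    case False
    then show ?thesis unfolding tinv.simps[of _ w]
      by (auto intro!: borel_measurable_sum borel_measurable_times less borel_measurable_uminus)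
  qed simp
qed

lemma lift_germ_measurable:
  assumes "\<And>v. length v < length w \<Longrightarrow> (\<lambda>\<omega>. S \<omega> x v) \<in> borel_measurable A"
    and "\<And>v. length v < length w \<Longrightarrow> (\<lambda>\<omega>. S \<omega> y v) \<in> borel_measurable A"
  shows "(\<lambda>\<omega>. lift_germ (S \<omega>) w x y) \<in> borel_measurable A"
  unfolding lift_germ_def group_incr_def tmult_def
  by (intro borel_measurable_sum borel_measurable_times tinv_measurable assms) auto

text \<open>By continuity the supremum of the paths is attained along a countable dense set of times.\<close>

lemma exists_greater_measurable:
  fixes f :: "real \<Rightarrow> 'w \<Rightarrow> real"
  assumes c: "\<And>\<omega>. \<omega> \<in> space A \<Longrightarrow> continuous_on {a..b} (\<lambda>u. f u \<omega>)"
    and m: "\<And>u. u \<in> {a..b} \<Longrightarrow> f u \<in> borel_measurable A"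
  shows "{\<omega> \<in> space A. \<exists>u\<in>{a..b}. f u \<omega> > c} \<in> sets A"
proof -
  obtain D where D: "countable D" "D \<subseteq> {a..b}" "{a..b} \<subseteq> closure D" by (rule separable)
  have "{\<omega> \<in> space A. \<exists>u\<in>{a..b}. f u \<omega> > c} = (\<Union>u\<in>D. {\<omega> \<in> space A. f u \<omega> > c})"
  proof (intro subset_antisym subsetI)
    fix \<omega> assume "\<omega> \<in> {\<omega> \<in> space A. \<exists>u\<in>{a..b}. f u \<omega> > c}"
    then obtain u where u: "\<omega> \<in> space A" "u \<in> {a..b}" "f u \<omega> > c" by auto
    obtain d where d: "d > 0" "\<And>v. v \<in> {a..b} \<Longrightarrow> dist v u < d \<Longrightarrow> dist (f v \<omega>) (f u \<omega>) < f u \<omega> - c"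
      using c[OF u(1)] u(2,3) unfolding continuous_on_iff by (metis diff_gt_0_iff_gt)
    obtain v where v: "v \<in> D" "dist v u < d" using D(3) u(2) d(1) by (meson closure_approachable subsetD)
    then have "f v \<omega> > c" using d(2)[of v] D(2) by (auto simp: dist_real_def)
    then show "\<omega> \<in> (\<Union>u\<in>D. {\<omega> \<in> space A. f u \<omega> > c})" using v u by auto
  qed (use D(2) in auto)
  also have "\<dots> \<in> sets A"
    using D m by (intro sets.countable_UN' ) (auto simp: borel_measurable_iff_greater)
  finally show ?thesis .
qed

text \<open>A continuous path attains its maximum on a compact interval, so it reaches
  \<open>c\<close> as soon as it exceeds every \<open>c - 1 / (n + 1)\<close>.\<close>

lemma exists_ge_measurable:
  fixes f :: "real \<Rightarrow> 'w \<Rightarrow> real"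
  assumes c: "\<And>\<omega>. \<omega> \<in> space A \<Longrightarrow> continuous_on {a..b} (\<lambda>u. f u \<omega>)"
    and m: "\<And>u. u \<in> {a..b} \<Longrightarrow> f u \<in> borel_measurable A"
  shows "{\<omega> \<in> space A. \<exists>u\<in>{a..b}. f u \<omega> \<ge> c} \<in> sets A"
proof -
  let ?E = "\<lambda>n. {\<omega> \<in> space A. \<exists>u\<in>{a..b}. f u \<omega> > c - 1 / real (Suc n)}"
  have "{\<omega> \<in> space A. \<exists>u\<in>{a..b}. f u \<omega> \<ge> c} = (\<Inter>n. ?E n)"
  proof (intro subset_antisym subsetI)
    fix \<omega> assume "\<omega> \<in> {\<omega> \<in> space A. \<exists>u\<in>{a..b}. f u \<omega> \<ge> c}"
    then obtain u where u: "\<omega> \<in> space A" "u \<in> {a..b}" "c \<le> f u \<omega>" by auto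
    have "c - 1 / real (Suc n) < f u \<omega>" for n
      by (rule less_le_trans[OF _ u(3)]) simp
    then show "\<omega> \<in> (\<Inter>n. ?E n)" using u(1,2) by blast
  next
    fix \<omega> assume w: "\<omega> \<in> (\<Inter>n. ?E n)"
    then have "\<omega> \<in> space A" "{a..b} \<noteq> {}" by auto
    then obtain u where u: "u \<in> {a..b}" "\<And>v. v \<in> {a..b} \<Longrightarrow> f v \<omega> \<le> f u \<omega>"
      using continuous_attains_sup[of "{a..b}" "\<lambda>u. f u \<omega>"] c by auto
    have "c \<le> f u \<omega> + e" if "e > 0" for e
    proof -
      obtain n where n: "inverse (real (Suc n)) < e" using reals_Archimedean[OF \<open>e > 0\<close>] by blast
      have "\<omega> \<in> ?E n" using w by blast
      then obtain v where "v \<in> {a..b}" "f v \<omega> > c - 1 / real (Suc n)" by blast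
      then show ?thesis using u(2)[of v] n by (simp add: inverse_eq_divide)
    qed
    then have "c \<le> f u \<omega>" by (rule field_le_epsilon)
    then show "\<omega> \<in> {\<omega> \<in> space A. \<exists>u\<in>{a..b}. f u \<omega> \<ge> c}" using u(1) \<open>\<omega> \<in> space A\<close> by auto
  qed
  also have "\<dots> \<in> sets A"
    by (intro sets.countable_INT' image_subsetI exists_greater_measurable c m) auto
  finally show ?thesis .
qed

section \<open>The signature of a random rough path\<close>

locale rough_process = prob_space M for M :: "'w measure" +
  fixes p T :: real and X :: "real \<Rightarrow> 'w \<Rightarrow> 'd::finite option tseries"
  assumes p1: "p \<ge> 1" and T0: "T > 0"
    and X_measurable: "\<And>t w. t \<in> {0..T} \<Longrightarrow> (\<lambda>\<omega>. X t \<omega> w) \<in> borel_measurable M"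
    and X_paths: "\<And>\<omega>. \<omega> \<in> space M \<Longrightarrow> (\<lambda>t. X t \<omega>) \<in> Omega_hat p T"
begin

definition sig :: "'w \<Rightarrow> real \<Rightarrow> 'd option tseries" where
  "sig \<omega> = rp_signature p T (\<lambda>r. X r \<omega>)"

abbreviation filt :: "ereal \<Rightarrow> 'w measure" where
  "filt \<equiv> rp_filtration p T M X"

lemma sig_lift: "\<omega> \<in> space M \<Longrightarrow> is_lyons_lift p T (\<lambda>r. X r \<omega>) (sig \<omega>)"
  unfolding sig_def using p1 T0 by (intro rp_signature_lift Omega_hat_pvar_paths X_paths) auto

lemma sig_grouplike: "\<omega> \<in> space M \<Longrightarrow> t \<in> {0..T} \<Longrightarrow> sig \<omega> t \<in> grouplike"
  using sig_lift by (auto simp: is_lyons_lift_def)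

lemma sig_continuous: "\<omega> \<in> space M \<Longrightarrow> continuous_on {0..T} (\<lambda>t. sig \<omega> t w)"
  by (rule lyons_lift_continuous[OF sig_lift])

lemma sig_start: "\<omega> \<in> space M \<Longrightarrow> sig \<omega> 0 = tunit"
  by (rule lyons_lift_start[OF sig_lift])

lemma sig_Nil: "\<omega> \<in> space M \<Longrightarrow> t \<in> {0..T} \<Longrightarrow> sig \<omega> t [] = 1"
  by (rule lyons_lift_one[OF sig_lift])

lemma sig_low: "\<omega> \<in> space M \<Longrightarrow> t \<in> {0..T} \<Longrightarrow> length w \<le> nat \<lfloor>p\<rfloor> \<Longrightarrow> sig \<omega> t w = X t \<omega> w"
  by (rule lyons_lift_low[OF sig_lift])

lemma sig_time_letter:
  "\<omega> \<in> space M \<Longrightarrow> t \<in> {0..T} \<Longrightarrow> sig \<omega> t (w @ [None]) = integral {0..t} (\<lambda>u. sig \<omega> u w)"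
  by (rule lyons_lift_time_letter[OF sig_lift X_paths p1 T0])

lemma X_start: "\<omega> \<in> space M \<Longrightarrow> X 0 \<omega> = tunit"
  using Omega_hat_pvar_paths[OF X_paths] by (auto simp: pvar_paths_def)

text \<open>The path starts at the unit, so its increments from 0 are its values; on words longer
  than \<open>\<lfloor>p\<rfloor>\<close> both sides vanish. The filtration is therefore generated
  by the coordinates of \<open>X\<close>.\<close>

lemma incr_eq_X:
  assumes "\<omega> \<in> space M" "t \<in> {0..T}"
  shows "incr (nat \<lfloor>p\<rfloor>) (\<lambda>r. X r \<omega>) 0 t w = X t \<omega> w"
proof (cases "length w \<le> nat \<lfloor>p\<rfloor>")
  case True
  then show ?thesis using incr_from_start[of "\<lambda>r. X r \<omega>"] X_start assms by simp
next
  case False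
  have "X t \<omega> \<in> grouplike_trunc (nat \<lfloor>p\<rfloor>)"
    using pvar_paths_grouplike[OF Omega_hat_pvar_paths[OF X_paths]] assms by blast
  from grouplike_trunc_beyond[OF this, of w] show ?thesis using False by (simp add: incr_def trunc_def)
qed

definition filt_generator :: "ereal \<Rightarrow> 'w set set" where
  "filt_generator t = {{\<omega> \<in> space M. incr (nat \<lfloor>p\<rfloor>) (\<lambda>r. X r \<omega>) 0 s w \<in> B} | s w B.
        s \<in> {0..T} \<and> ereal s \<le> t \<and> B \<in> sets borel}"

lemma filt_generator_Pow: "filt_generator t \<subseteq> Pow (space M)"
  by (auto simp: filt_generator_def)

lemma space_filt [simp]: "space (filt t) = space M"
  using filt_generator_Pow[of t] by (simp add: rp_filtration_def filt_generator_def)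

lemma sets_filt: "sets (filt t) = sigma_sets (space M) (filt_generator t)"
  using filt_generator_Pow[of t] by (simp add: rp_filtration_def filt_generator_def)

lemma filt_generatorE:
  assumes "A \<in> filt_generator t"
  obtains s w B where "A = {\<omega> \<in> space M. X s \<omega> w \<in> B}" "s \<in> {0..T}" "ereal s \<le> t" "B \<in> sets borel"
proof -
  obtain s w B where A: "A = {\<omega> \<in> space M. incr (nat \<lfloor>p\<rfloor>) (\<lambda>r. X r \<omega>) 0 s w \<in> B}"
    and s: "s \<in> {0..T}" "ereal s \<le> t" "B \<in> sets borel"
    using assms by (auto simp: filt_generator_def)
  have "A = {\<omega> \<in> space M. X s \<omega> w \<in> B}" unfolding A using s by (auto simp: incr_eq_X)
  then show ?thesis using that s by blast
qed

lemma subalgebra_filt: "subalgebra M (filt t)"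
proof -
  have "A \<in> sets M" if "A \<in> filt_generator t" for A
  proof -
    obtain s w B where A: "A = {\<omega> \<in> space M. X s \<omega> w \<in> B}" "s \<in> {0..T}" "B \<in> sets borel"
      using filt_generatorE[OF \<open>A \<in> filt_generator t\<close>] by metis
    then show ?thesis using measurable_sets[OF X_measurable[of s w], of B] by (simp add: vimage_def Int_def conj_commute)
  qed
  then have "sigma_sets (space M) (filt_generator t) \<subseteq> sets M"
    by (intro sets.sigma_sets_subset) auto
  then show ?thesis by (simp add: subalgebra_def sets_filt)
qed

lemma measurable_filt_M: "f \<in> borel_measurable (filt t) \<Longrightarrow> f \<in> borel_measurable M"
  by (rule measurable_from_subalg[OF subalgebra_filt])

lemma X_adapted:
  assumes "s \<in> {0..T}" "ereal s \<le> t"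
  shows "(\<lambda>\<omega>. X s \<omega> w) \<in> borel_measurable (filt t)"
proof (rule measurableI)
  fix B :: "real set" assume "B \<in> sets borel"
  then have "{\<omega> \<in> space M. incr (nat \<lfloor>p\<rfloor>) (\<lambda>r. X r \<omega>) 0 s w \<in> B} \<in> filt_generator t"
    using assms by (auto simp: filt_generator_def)
  moreover have "{\<omega> \<in> space M. incr (nat \<lfloor>p\<rfloor>) (\<lambda>r. X r \<omega>) 0 s w \<in> B} = (\<lambda>\<omega>. X s \<omega> w) -` B \<inter> space (filt t)"
    using assms by (auto simp: incr_eq_X)
  ultimately show "(\<lambda>\<omega>. X s \<omega> w) -` B \<inter> space (filt t) \<in> sets (filt t)"
    unfolding sets_filt by (metis sigma_sets.Basic)
qed simp

text \<open>Above level \<open>p\<close> the value at \<open>s\<close> is a limit of germs, which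
  involve only shorter words at times up to \<open>s\<close>; below, it is a coordinate of
  \<open>X\<close>.\<close>

lemma sig_adapted:
  assumes "s \<in> {0..T}" "ereal s \<le> t"
  shows "(\<lambda>\<omega>. sig \<omega> s w) \<in> borel_measurable (filt t)"
  using assms
proof (induction "length w" arbitrary: w s rule: less_induct)
  case less
  consider "length w \<le> nat \<lfloor>p\<rfloor>" | "s = 0" | "length w > nat \<lfloor>p\<rfloor>" "0 < s" using less.prems by force
  then show ?case
  proof cases
    case 1
    have "(\<lambda>\<omega>. sig \<omega> s w) \<in> borel_measurable (filt t) \<longleftrightarrow> (\<lambda>\<omega>. X s \<omega> w) \<in> borel_measurable (filt t)"
      using less.prems 1 by (intro measurable_cong sig_low) auto
    then show ?thesis using X_adapted less.prems by simp
  next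
    case 2
    have "(\<lambda>\<omega>. sig \<omega> s w) \<in> borel_measurable (filt t) \<longleftrightarrow> (\<lambda>\<omega>. tunit w) \<in> borel_measurable (filt t)"
      using 2 by (intro measurable_cong) (simp add: sig_start)
    then show ?thesis by simp
  next
    case 3
    then have w: "real (length w) > p" using p1 by linarith
    have s: "0 < s" "s \<le> T" using less.prems 3 by auto
    show ?thesis
    proof (rule borel_measurable_LIMSEQ_real)
      fix \<omega> assume "\<omega> \<in> space (filt t)"
      then show "(\<lambda>n. \<Sum>i<Suc n. lift_germ (sig \<omega>) w (s * real i / real (Suc n)) (s * real (Suc i) / real (Suc n)))
          \<longlonglongrightarrow> sig \<omega> s w"
        using p1 by (intro lift_germ_limit[OF sig_lift] w s) auto
    next
      fix n
      have "s * real j / real (Suc n) \<in> {0..T} \<and> ereal (s * real j / real (Suc n)) \<le> t" if "j \<le> Suc n" for j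
      proof -
        have "s * real j \<le> s * real (Suc n)" using that s by (intro mult_left_mono) auto
        then have *: "s * real j / real (Suc n) \<le> s" by (simp add: field_simps del: of_nat_Suc)
        then have "ereal (s * real j / real (Suc n)) \<le> ereal s" by simp
        then have "ereal (s * real j / real (Suc n)) \<le> t" using less.prems(2) by (rule order_trans)
        then show ?thesis using s * by auto
      qed
      then show "(\<lambda>\<omega>. \<Sum>i<Suc n. lift_germ (sig \<omega>) w (s * real i / real (Suc n)) (s * real (Suc i) / real (Suc n)))
          \<in> borel_measurable (filt t)"
        by (intro borel_measurable_sum lift_germ_measurable less.hyps)
          (auto simp del: of_nat_Suc atLeastAtMost_iff)
    qed
  qed
qed

section \<open>Linear functionals of the signature\<close>

definition lin :: "'d option tpoly \<Rightarrow> real \<Rightarrow> 'w \<Rightarrow> real" where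
  "lin l t \<omega> = pairing l (sig \<omega> t)"

lemma lin_adapted: "s \<in> {0..T} \<Longrightarrow> ereal s \<le> t \<Longrightarrow> lin l s \<in> borel_measurable (filt t)"
  unfolding lin_def[abs_def] pairing_def
  by (intro borel_measurable_sum borel_measurable_times sig_adapted) auto

lemma lin_measurable: "s \<in> {0..T} \<Longrightarrow> lin l s \<in> borel_measurable M"
  using lin_adapted[of s "ereal s"] measurable_filt_M by auto

lemma lin_continuous: "\<omega> \<in> space M \<Longrightarrow> continuous_on {0..T} (\<lambda>t. lin l t \<omega>)"
  unfolding lin_def pairing_def by (intro continuous_intros sig_continuous)

lemma lin_add: "lin (l + m) t \<omega> = lin l t \<omega> + lin m t \<omega>"
  by (simp add: lin_def pairing_plus)

lemma lin_shuffle: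
  "\<omega> \<in> space M \<Longrightarrow> t \<in> {0..T} \<Longrightarrow> lin (shuffle l m) t \<omega> = lin l t \<omega> * lin m t \<omega>"
  using sig_grouplike by (auto simp: lin_def grouplike_def)

lemma lin_word: "lin (Poly_Mapping.single w c) t \<omega> = c * sig \<omega> t w"
  by (simp add: lin_def)

lemma lin_time:
  "\<omega> \<in> space M \<Longrightarrow> t \<in> {0..T} \<Longrightarrow> lin (Poly_Mapping.single [None] c) t \<omega> = c * t"
proof -
  assume w: "\<omega> \<in> space M" and t: "t \<in> {0..T}"
  have "sig \<omega> t ([] @ [None]) = integral {0..t} (\<lambda>u. sig \<omega> u [])" by (rule sig_time_letter[OF w t])
  also have "\<dots> = integral {0..t} (\<lambda>u. 1)" by (rule integral_cong) (use sig_Nil[OF w] t in auto)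
  also have "\<dots> = t" using t by simp
  finally show ?thesis by (simp add: lin_word)
qed

lemma lin_integral:
  assumes "\<omega> \<in> space M" "t \<in> {0..T}"
  shows "lin (snoc_letter l None) t \<omega> = integral {0..t} (\<lambda>u. lin l u \<omega>)"
proof -
  have "(\<lambda>u. sig \<omega> u w) integrable_on {0..t}" for w
    using assms by (intro integrable_continuous_real continuous_on_subset[OF sig_continuous]) auto
  then show ?thesis
    unfolding lin_def pairing_snoc_letter unfolding pairing_def
    using assms by (simp add: sig_time_letter) (subst integral_sum, auto intro: integrable_on_mult_right)
qed

section \<open>Hitting times of linear functionals\<close>

lemma lin_exists_ge:
  assumes "t \<in> {0..T}" "ereal t \<le> u"
  shows "{\<omega> \<in> space M. \<exists>s\<in>{0..t}. lin l s \<omega> \<ge> c} \<in> sets (filt u)"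
proof -
  have "{\<omega> \<in> space (filt u). \<exists>s\<in>{0..t}. lin l s \<omega> \<ge> c} \<in> sets (filt u)"
  proof (rule exists_ge_measurable)
    fix s assume s: "s \<in> {0..t}"
    then have "ereal s \<le> u" using assms(2) by (meson atLeastAtMost_iff ereal_less_eq(3) order_trans)
    then show "lin l s \<in> borel_measurable (filt u)" using s assms(1) by (intro lin_adapted) auto
  qed (use assms in \<open>auto intro: continuous_on_subset[OF lin_continuous]\<close>)
  then show ?thesis by simp
qed

text \<open>The times at which a continuous functional is at least 1 form a compact set, so the
  infimum is attained unless the set is empty.\<close>

lemma hitting_time_cases:
  assumes w: "\<omega> \<in> space M"
  obtains (never) "hitting_time p T X l \<omega> = \<infinity>" "\<And>t. t \<in> {0..T} \<Longrightarrow> lin l t \<omega> < 1"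
    | (hit) t where "hitting_time p T X l \<omega> = ereal t" "t \<in> {0..T}" "lin l t \<omega> \<ge> 1"
        "\<And>s. s \<in> {0..T} \<Longrightarrow> lin l s \<omega> \<ge> 1 \<Longrightarrow> t \<le> s"
proof -
  define H where "H = {t \<in> {0..T}. lin l t \<omega> \<ge> 1}"
  have h: "hitting_time p T X l \<omega> = Inf (ereal ` H)"
    by (simp add: hitting_time_def H_def lin_def sig_def)
  show ?thesis
  proof (cases "H = {}")
    case True
    have "lin l t \<omega> < 1" if "t \<in> {0..T}" for t
      using True that unfolding H_def by (metis (mono_tags, lifting) emptyE mem_Collect_eq not_le)
    then show ?thesis using h True never by (simp add: top_ereal_def)
  next
    case False
    have "H = {0..T} \<inter> (\<lambda>t. lin l t \<omega>) -` {1..}" by (auto simp: H_def)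
    then have "closed H" by (simp add: continuous_closed_preimage[OF lin_continuous[OF w]])
    moreover have "bounded H" by (rule bounded_subset[of "{0..T}"]) (auto simp: H_def)
    ultimately have "compact H" by (simp add: compact_eq_bounded_closed)
    then obtain t where t: "t \<in> H" "\<And>s. s \<in> H \<Longrightarrow> t \<le> s" using compact_attains_inf[of H] False by auto
    have "Inf (ereal ` H) = ereal t"
      using t by (intro antisym Inf_lower Inf_greatest) auto
    then show ?thesis using h t hit by (auto simp: H_def)
  qed
qed

lemma hitting_time_le_iff:
  assumes w: "\<omega> \<in> space M" and t: "t \<in> {0..T}"
  shows "hitting_time p T X l \<omega> \<le> ereal t \<longleftrightarrow> (\<exists>s\<in>{0..t}. lin l s \<omega> \<ge> 1)"
  using w
proof (cases rule: hitting_time_cases[where l = l])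
  case never
  then show ?thesis using t by force
next
  case (hit s)
  then show ?thesis using t by force
qed

text \<open>Since the infimum is attained, \<open>\<tau> \<le> t\<close> says that level 1 is
  reached within \<open>[0,t]\<close>, which is an event of time \<open>t\<close> and not merely of
  every later time. The cases below run over the extended times that index the filtration.\<close>

lemma hitting_time_stopping: "hitting_time p T X l \<in> rp_stopping_times p T M X"
proof -
  let ?\<tau> = "hitting_time p T X l"
  have vals: "?\<tau> \<omega> \<in> ereal ` {0..T} \<union> {\<infinity>}" if "\<omega> \<in> space M" for \<omega>
    using that by (cases rule: hitting_time_cases[where l = l]) auto
  have "Measurable.pred (filt t) (\<lambda>\<omega>. ?\<tau> \<omega> \<le> t)" for t
  proof -
    consider "t < 0" | r where "t = ereal r" "r \<in> {0..T}" | "t \<noteq> \<infinity>" "ereal T \<le> t" | "t = \<infinity>"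
      by (cases t) (auto simp: not_le not_less, force)
    then have "{\<omega> \<in> space M. ?\<tau> \<omega> \<le> t} \<in> sets (filt t)"
    proof cases
      case 1
      have "\<not> ?\<tau> \<omega> \<le> t" if "\<omega> \<in> space M" for \<omega>
        using vals[OF that] 1 by (auto simp: not_le intro: less_le_trans[of t 0])
      then have "{\<omega> \<in> space M. ?\<tau> \<omega> \<le> t} = {}" by auto
      then show ?thesis by (simp only: sets.empty_sets)
    next
      case (2 r)
      have "?\<tau> \<omega> \<le> t \<longleftrightarrow> (\<exists>s\<in>{0..r}. lin l s \<omega> \<ge> 1)" if "\<omega> \<in> space M" for \<omega>
        using hitting_time_le_iff[OF that 2(2)] 2(1) by simp
      then have "{\<omega> \<in> space M. ?\<tau> \<omega> \<le> t} = {\<omega> \<in> space M. \<exists>s\<in>{0..r}. lin l s \<omega> \<ge> 1}" by blast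
      then show ?thesis using lin_exists_ge[of r t 1 l] 2 by simp
    next
      case 3
      have "?\<tau> \<omega> \<le> t \<longleftrightarrow> (\<exists>s\<in>{0..T}. lin l s \<omega> \<ge> 1)" if "\<omega> \<in> space M" for \<omega>
      proof -
        have "?\<tau> \<omega> \<le> t \<longleftrightarrow> ?\<tau> \<omega> \<le> ereal T"
          using vals[OF that] 3 by (auto intro: order_trans[of _ "ereal T"])
        then show ?thesis using hitting_time_le_iff[OF that, of T l] T0 by simp
      qed
      then have "{\<omega> \<in> space M. ?\<tau> \<omega> \<le> t} = {\<omega> \<in> space M. \<exists>s\<in>{0..T}. lin l s \<omega> \<ge> 1}" by blast
      then show ?thesis using lin_exists_ge[of T t 1 l] 3 T0 by simp
    next
      case 4
      then have "{\<omega> \<in> space M. ?\<tau> \<omega> \<le> t} = space (filt t)" by auto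
      then show ?thesis by (simp only: sets.top)
    qed
    then show ?thesis by (simp add: pred_def)
  qed
  then show ?thesis using vals by (auto simp: rp_stopping_times_def stopping_time_def)
qed

end

section \<open>Approximation by linear functionals\<close>

lemma continuous_interval_bound:
  fixes f :: "real \<Rightarrow> real"
  assumes "continuous_on {a..b} f"
  obtains B where "B \<ge> 0" "\<And>t. t \<in> {a..b} \<Longrightarrow> \<bar>f t\<bar> \<le> B"
proof -
  have "bounded (f ` {a..b})" by (intro compact_imp_bounded compact_continuous_image assms) auto
  then obtain B where "\<And>t. t \<in> {a..b} \<Longrightarrow> \<bar>f t\<bar> \<le> B" unfolding bounded_iff by force
  then show ?thesis by (intro that[of "\<bar>B\<bar>"]) (auto intro: order_trans[OF _ abs_ge_self])
qed

context rough_process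
begin

text \<open>A single \<open>\<epsilon>\<close> bounds both the exceptional probability and the error
  uniform in time. The exceptional set is required to be an event, so that no measurability is asked
  of \<open>g\<close> and \<open>h\<close>.\<close>

definition close_within :: "real \<Rightarrow> (real \<Rightarrow> 'w \<Rightarrow> real) \<Rightarrow> (real \<Rightarrow> 'w \<Rightarrow> real) \<Rightarrow> bool" where
  "close_within \<epsilon> g h \<longleftrightarrow> (\<exists>E\<in>sets M. prob E < \<epsilon> \<and>
     (\<forall>\<omega>\<in>space M - E. \<forall>t\<in>{0..T}. \<bar>g t \<omega> - h t \<omega>\<bar> < \<epsilon>))"

definition approximable :: "(real \<Rightarrow> 'w \<Rightarrow> real) \<Rightarrow> bool" where
  "approximable h \<longleftrightarrow> (\<forall>\<epsilon>>0. \<exists>l. close_within \<epsilon> (lin l) h)"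

lemma close_within_uniform:
  assumes "\<epsilon> > 0" "\<And>\<omega> t. \<omega> \<in> space M \<Longrightarrow> t \<in> {0..T} \<Longrightarrow> \<bar>g t \<omega> - h t \<omega>\<bar> < \<epsilon>"
  shows "close_within \<epsilon> g h"
  unfolding close_within_def using assms by (intro bexI[of _ "{}"]) auto

lemma close_within_trans:
  assumes "close_within \<epsilon> f g" "close_within \<delta> g h"
  shows "close_within (\<epsilon> + \<delta>) f h"
proof -
  obtain E1 where E1: "E1 \<in> sets M" "prob E1 < \<epsilon>" "\<And>\<omega> t. \<omega> \<in> space M - E1 \<Longrightarrow> t \<in> {0..T} \<Longrightarrow> \<bar>f t \<omega> - g t \<omega>\<bar> < \<epsilon>"
    using assms(1) by (auto simp: close_within_def)
  obtain E2 where E2: "E2 \<in> sets M" "prob E2 < \<delta>" "\<And>\<omega> t. \<omega> \<in> space M - E2 \<Longrightarrow> t \<in> {0..T} \<Longrightarrow> \<bar>g t \<omega> - h t \<omega>\<bar> < \<delta>"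
    using assms(2) by (auto simp: close_within_def)
  show ?thesis
    unfolding close_within_def
  proof (intro bexI[of _ "E1 \<union> E2"] conjI ballI)
    show "prob (E1 \<union> E2) < \<epsilon> + \<delta>" using measure_Un_le[OF E1(1) E2(1)] E1(2) E2(2) by linarith
    fix \<omega> t assume "\<omega> \<in> space M - (E1 \<union> E2)" "t \<in> {0..T}"
    then show "\<bar>f t \<omega> - h t \<omega>\<bar> < \<epsilon> + \<delta>" using E1(3)[of \<omega> t] E2(3)[of \<omega> t] by auto
  qed (use E1 E2 in auto)
qed

lemma approximable_limit:
  assumes "\<And>\<epsilon>. \<epsilon> > 0 \<Longrightarrow> \<exists>g. approximable g \<and> close_within \<epsilon> g h"
  shows "approximable h"
  unfolding approximable_def
proof (intro allI impI)
  fix \<epsilon> :: real assume "\<epsilon> > 0"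
  then obtain g where g: "approximable g" "close_within (\<epsilon> / 2) g h" using assms[of "\<epsilon> / 2"] by auto
  then obtain l where "close_within (\<epsilon> / 2) (lin l) g" using \<open>\<epsilon> > 0\<close> unfolding approximable_def by (meson half_gt_zero)
  from close_within_trans[OF this g(2)] show "\<exists>l. close_within \<epsilon> (lin l) h" by auto
qed

lemma approximable_cong:
  assumes "approximable g" "\<And>\<omega> t. \<omega> \<in> space M \<Longrightarrow> t \<in> {0..T} \<Longrightarrow> g t \<omega> = h t \<omega>"
  shows "approximable h"
  by (rule approximable_limit) (use assms in \<open>auto intro!: exI[of _ g] close_within_uniform\<close>)

lemma prob_decseq_small:
  assumes "\<And>n. E n \<in> sets M" "decseq E" "(\<Inter>n. E n) = {}" "\<epsilon> > 0"
  obtains n0 where "\<And>n. n \<ge> n0 \<Longrightarrow> prob (E n) < \<epsilon>"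
proof -
  have "(\<lambda>n. prob (E n)) \<longlonglongrightarrow> prob (\<Inter>n. E n)"
    using assms(1,2) by (intro finite_Lim_measure_decseq) auto
  then have "eventually (\<lambda>n. prob (E n) < \<epsilon>) sequentially"
    using assms(3,4) by (intro order_tendstoD) auto
  then show ?thesis using that by (auto simp: eventually_sequentially)
qed

text \<open>Each path is bounded, so the events on which the bound \<open>n + 1\<close> is exceeded
  decrease to the empty set.\<close>

lemma continuous_bounded_prob:
  fixes f :: "real \<Rightarrow> 'w \<Rightarrow> real"
  assumes c: "\<And>\<omega>. \<omega> \<in> space M \<Longrightarrow> continuous_on {0..T} (\<lambda>t. f t \<omega>)"
    and m: "\<And>t. t \<in> {0..T} \<Longrightarrow> f t \<in> borel_measurable M" and "\<epsilon> > 0"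
  shows "\<exists>C>0. \<exists>E\<in>sets M. prob E < \<epsilon> \<and> (\<forall>\<omega>\<in>space M - E. \<forall>t\<in>{0..T}. \<bar>f t \<omega>\<bar> \<le> C)"
proof -
  let ?E = "\<lambda>n. {\<omega> \<in> space M. \<exists>t\<in>{0..T}. \<bar>f t \<omega>\<bar> > real (Suc n)}"
  have E: "?E n \<in> sets M" for n
    by (rule exists_greater_measurable) (use c m in \<open>auto intro!: continuous_intros borel_measurable_abs\<close>)
  have dec: "decseq ?E" by (force simp: decseq_def)
  have "(\<Inter>n. ?E n) = {}"
  proof (rule equals0I)
    fix \<omega> assume w: "\<omega> \<in> (\<Inter>n. ?E n)"
    then have "\<omega> \<in> space M" by auto
    then obtain B where B: "\<And>t. t \<in> {0..T} \<Longrightarrow> \<bar>f t \<omega>\<bar> \<le> B"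
      using continuous_interval_bound[OF c] by blast
    obtain n where n: "B \<le> real n" using real_arch_simple by blast
    have "\<omega> \<in> ?E n" using w by blast
    then obtain t where "t \<in> {0..T}" "\<bar>f t \<omega>\<bar> > real (Suc n)" by blast
    then show False using B[of t] n by simp
  qed
  then obtain n where "prob (?E n) < \<epsilon>" using prob_decseq_small[OF E dec] \<open>\<epsilon> > 0\<close> by blast
  then show ?thesis using E[of n]
    by (intro exI[of _ "real (Suc n)"] conjI bexI[of _ "?E n"] ballI) (auto simp: not_less)
qed

lemma approximable_bounded_prob:
  assumes "approximable h" "\<epsilon> > 0"
  shows "\<exists>C>0. \<exists>E\<in>sets M. prob E < \<epsilon> \<and> (\<forall>\<omega>\<in>space M - E. \<forall>t\<in>{0..T}. \<bar>h t \<omega>\<bar> \<le> C)"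
proof -
  define e where "e = \<epsilon> / 2"
  have e: "e > 0" using \<open>\<epsilon> > 0\<close> by (simp add: e_def)
  obtain l E1 where E1: "E1 \<in> sets M" "prob E1 < e"
      "\<And>\<omega> t. \<omega> \<in> space M - E1 \<Longrightarrow> t \<in> {0..T} \<Longrightarrow> \<bar>lin l t \<omega> - h t \<omega>\<bar> < e"
    using assms(1) e unfolding approximable_def close_within_def by meson
  obtain C E2 where E2: "C > 0" "E2 \<in> sets M" "prob E2 < e"
      "\<And>\<omega> t. \<omega> \<in> space M - E2 \<Longrightarrow> t \<in> {0..T} \<Longrightarrow> \<bar>lin l t \<omega>\<bar> \<le> C"
    using continuous_bounded_prob[of "lin l", OF lin_continuous lin_measurable e] by blast
  show ?thesis
  proof (intro exI[of _ "C + e"] conjI bexI[of _ "E1 \<union> E2"] ballI)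
    show "prob (E1 \<union> E2) < \<epsilon>" using measure_Un_le[OF E1(1) E2(2)] E1(2) E2(3) by (simp add: e_def)
    fix \<omega> t assume "\<omega> \<in> space M - (E1 \<union> E2)" "t \<in> {0..T}"
    then show "\<bar>h t \<omega>\<bar> \<le> C + e" using E1(3)[of \<omega> t] E2(4)[of \<omega> t] by auto
  qed (use E1 E2 e in auto)
qed

lemma approximable_add:
  assumes "approximable g" "approximable h"
  shows "approximable (\<lambda>t \<omega>. g t \<omega> + h t \<omega>)"
  unfolding approximable_def
proof (intro allI impI)
  fix \<epsilon> :: real assume "\<epsilon> > 0"
  then obtain l m where l: "close_within (\<epsilon> / 2) (lin l) g" and m: "close_within (\<epsilon> / 2) (lin m) h"
    using assms unfolding approximable_def by (meson half_gt_zero)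
  have "close_within (\<epsilon> / 2) (lin (l + m)) (\<lambda>t \<omega>. g t \<omega> + lin m t \<omega>)"
    using l by (simp add: close_within_def lin_add)
  moreover have "close_within (\<epsilon> / 2) (\<lambda>t \<omega>. g t \<omega> + lin m t \<omega>) (\<lambda>t \<omega>. g t \<omega> + h t \<omega>)"
    using m by (simp add: close_within_def)
  ultimately show "\<exists>l. close_within \<epsilon> (lin l) (\<lambda>t \<omega>. g t \<omega> + h t \<omega>)"
    using close_within_trans by fastforce
qed

text \<open>A product of functionals is the functional of the shuffle. Its error contains the
  factors themselves, which are bounded by constants only outside events of small
  probability.\<close>

lemma approximable_mult:
  assumes g: "approximable g" and h: "approximable h"
  shows "approximable (\<lambda>t \<omega>. g t \<omega> * h t \<omega>)"
  unfolding approximable_def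
proof (intro allI impI)
  fix \<epsilon> :: real assume "\<epsilon> > 0"
  then have e4: "\<epsilon> / 4 > 0" by simp
  obtain C1 E1 where E1: "C1 > 0" "E1 \<in> sets M" "prob E1 < \<epsilon> / 4"
      "\<And>\<omega> t. \<omega> \<in> space M - E1 \<Longrightarrow> t \<in> {0..T} \<Longrightarrow> \<bar>g t \<omega>\<bar> \<le> C1"
    using approximable_bounded_prob[OF g e4] by blast
  obtain C2 E2 where E2: "C2 > 0" "E2 \<in> sets M" "prob E2 < \<epsilon> / 4"
      "\<And>\<omega> t. \<omega> \<in> space M - E2 \<Longrightarrow> t \<in> {0..T} \<Longrightarrow> \<bar>h t \<omega>\<bar> \<le> C2"
    using approximable_bounded_prob[OF h e4] by blast
  \<comment> \<open>The four exceptional events get \<open>\<epsilon> / 4\<close> each;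
    \<open>e \<le> 1\<close> bounds the second functional by \<open>C2 + 1\<close>, and the last
    term makes the total error at most \<open>\<epsilon> / 2\<close>.\<close>
  define e where "e = min (\<epsilon> / 4) (min 1 (\<epsilon> / (2 * (C1 + C2 + 1))))"
  have e: "e > 0" using \<open>\<epsilon> > 0\<close> E1 E2 by (simp add: e_def)
  have e': "e \<le> \<epsilon> / 4" "e \<le> 1" unfolding e_def by (rule min.cobounded1) (simp add: min_le_iff_disj)
  have "e \<le> \<epsilon> / (2 * (C1 + C2 + 1))" by (simp add: e_def)
  then have e2: "e * (C1 + C2 + 1) \<le> \<epsilon> / 2" using E1 E2 by (simp add: field_simps)
  obtain l E3 where E3: "E3 \<in> sets M" "prob E3 < e"
      "\<And>\<omega> t. \<omega> \<in> space M - E3 \<Longrightarrow> t \<in> {0..T} \<Longrightarrow> \<bar>lin l t \<omega> - g t \<omega>\<bar> < e"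
    using g e(1) unfolding approximable_def close_within_def by meson
  obtain m E4 where E4: "E4 \<in> sets M" "prob E4 < e"
      "\<And>\<omega> t. \<omega> \<in> space M - E4 \<Longrightarrow> t \<in> {0..T} \<Longrightarrow> \<bar>lin m t \<omega> - h t \<omega>\<bar> < e"
    using h e(1) unfolding approximable_def close_within_def by meson
  have "close_within \<epsilon> (lin (shuffle l m)) (\<lambda>t \<omega>. g t \<omega> * h t \<omega>)"
    unfolding close_within_def
  proof (intro bexI[of _ "(E1 \<union> E2) \<union> (E3 \<union> E4)"] conjI ballI)
    show "prob ((E1 \<union> E2) \<union> (E3 \<union> E4)) < \<epsilon>"
      using measure_Un_le[of "E1 \<union> E2" M "E3 \<union> E4"] measure_Un_le[of E1 M E2] measure_Un_le[of E3 M E4] E1 E2 E3 E4 e'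
      by simp
    fix \<omega> t assume w: "\<omega> \<in> space M - ((E1 \<union> E2) \<union> (E3 \<union> E4))" and t: "t \<in> {0..T}"
    let ?a = "lin l t \<omega>" and ?b = "lin m t \<omega>"
    have b: "\<bar>g t \<omega>\<bar> \<le> C1" "\<bar>h t \<omega>\<bar> \<le> C2" "\<bar>?a - g t \<omega>\<bar> < e" "\<bar>?b - h t \<omega>\<bar> < e"
      using E1(4)[of \<omega> t] E2(4)[of \<omega> t] E3(3)[of \<omega> t] E4(3)[of \<omega> t] w t by auto
    then have "\<bar>?b\<bar> \<le> C2 + 1" using e' by linarith
    have "\<bar>?a * ?b - g t \<omega> * h t \<omega>\<bar> = \<bar>(?a - g t \<omega>) * ?b + g t \<omega> * (?b - h t \<omega>)\<bar>"
      by (simp add: algebra_simps)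
    also have "\<dots> \<le> \<bar>?a - g t \<omega>\<bar> * \<bar>?b\<bar> + \<bar>g t \<omega>\<bar> * \<bar>?b - h t \<omega>\<bar>"
      by (rule order_trans[OF abs_triangle_ineq]) (simp add: abs_mult)
    also have "\<dots> \<le> e * (C2 + 1) + C1 * e"
      using b \<open>\<bar>?b\<bar> \<le> C2 + 1\<close> e E1 by (intro add_mono mult_mono) auto
    also have "\<dots> \<le> \<epsilon> / 2" using e2 by (simp add: algebra_simps)
    also have "\<dots> < \<epsilon>" using \<open>\<epsilon> > 0\<close> by simp
    finally show "\<bar>lin (shuffle l m) t \<omega> - g t \<omega> * h t \<omega>\<bar> < \<epsilon>" using w t by (simp add: lin_shuffle)
  qed (use E1 E2 E3 E4 in auto)
  then show "\<exists>l. close_within \<epsilon> (lin l) (\<lambda>t \<omega>. g t \<omega> * h t \<omega>)" by blast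
qed

section \<open>Deterministic functions of time and weighted time integrals\<close>

lemma lin_polynomial:
  assumes "real_polynomial_function (q :: real \<Rightarrow> real)"
  shows "\<exists>l. \<forall>\<omega>\<in>space M. \<forall>t\<in>{0..T}. lin l t \<omega> = q t"
  using assms
proof induction
  case (linear f)
  then obtain c where "f = (\<lambda>x. x * c)" by (rule real_bounded_linear[THEN iffD1, THEN exE])
  then show ?case by (intro exI[of _ "Poly_Mapping.single [None] c"]) (simp add: lin_time)
next
  case (const c)
  show ?case by (intro exI[of _ "Poly_Mapping.single [] c"]) (simp add: lin_word sig_Nil)
next
  case (add f g)
  then obtain l m where "\<forall>\<omega>\<in>space M. \<forall>t\<in>{0..T}. lin l t \<omega> = f t" "\<forall>\<omega>\<in>space M. \<forall>t\<in>{0..T}. lin m t \<omega> = g t" by blast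
  then show ?case by (intro exI[of _ "l + m"]) (simp add: lin_add)
next
  case (mult f g)
  then obtain l m where "\<forall>\<omega>\<in>space M. \<forall>t\<in>{0..T}. lin l t \<omega> = f t" "\<forall>\<omega>\<in>space M. \<forall>t\<in>{0..T}. lin m t \<omega> = g t" by blast
  then show ?case by (intro exI[of _ "shuffle l m"]) (simp add: lin_shuffle)
qed

lemma approximable_deterministic:
  assumes "continuous_on {0..T} \<phi>"
  shows "approximable (\<lambda>t \<omega>. \<phi> t)"
  unfolding approximable_def
proof (intro allI impI)
  fix \<epsilon> :: real assume "\<epsilon> > 0"
  obtain q where q: "real_polynomial_function q" "\<And>x. x \<in> {0..T} \<Longrightarrow> \<bar>\<phi> x - q x\<bar> < \<epsilon>"
    using Stone_Weierstrass_real_polynomial_function[OF compact_Icc assms \<open>\<epsilon> > 0\<close>] by blast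
  obtain l where "\<forall>\<omega>\<in>space M. \<forall>t\<in>{0..T}. lin l t \<omega> = q t" using lin_polynomial[OF q(1)] by blast
  then have "close_within \<epsilon> (lin l) (\<lambda>t \<omega>. \<phi> t)"
    using q(2) \<open>\<epsilon> > 0\<close> by (intro close_within_uniform) (auto simp: abs_minus_commute)
  then show "\<exists>l. close_within \<epsilon> (lin l) (\<lambda>t \<omega>. \<phi> t)" by blast
qed

lemma sig_measurable: "t \<in> {0..T} \<Longrightarrow> (\<lambda>\<omega>. sig \<omega> t w) \<in> borel_measurable M"
  using lin_measurable[of t "Poly_Mapping.single w 1"] by (simp add: lin_word[abs_def])

text \<open>The weight is replaced by a polynomial, which is a functional because the time letter
  evaluates to \<open>t\<close>. Multiplying by it is a shuffle, and integrating in time appends the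
  letter \<open>None\<close>.\<close>

lemma approximable_weighted_integral:
  assumes b: "continuous_on {0..T} b"
  shows "approximable (\<lambda>t \<omega>. integral {0..t} (\<lambda>u. b u * sig \<omega> u w))"
  unfolding approximable_def
proof (intro allI impI)
  fix \<epsilon> :: real assume "\<epsilon> > 0"
  obtain C E where E: "C > 0" "E \<in> sets M" "prob E < \<epsilon>" "\<And>\<omega> t. \<omega> \<in> space M - E \<Longrightarrow> t \<in> {0..T} \<Longrightarrow> \<bar>sig \<omega> t w\<bar> \<le> C"
    using continuous_bounded_prob[of "\<lambda>t \<omega>. sig \<omega> t w", OF sig_continuous sig_measurable \<open>\<epsilon> > 0\<close>] by blast
  define c where "c = \<epsilon> / (2 * (C * T))"
  have CT: "C * T > 0" using E T0 by simp
  have c: "c > 0" "c * C * T < \<epsilon>" using CT \<open>\<epsilon> > 0\<close> E T0 by (auto simp: c_def)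
  obtain q where q: "real_polynomial_function q" "\<And>x. x \<in> {0..T} \<Longrightarrow> \<bar>b x - q x\<bar> < c"
    using Stone_Weierstrass_real_polynomial_function[OF compact_Icc b c(1)] by blast
  obtain l where l: "\<forall>\<omega>\<in>space M. \<forall>t\<in>{0..T}. lin l t \<omega> = q t" using lin_polynomial[OF q(1)] by blast
  have qc: "continuous_on {0..T} q" using q(1) by (simp add: real_polynomial_function_eq continuous_on_polymonial_function)
  let ?m = "snoc_letter (shuffle l (Poly_Mapping.single w 1)) None"
  have "close_within \<epsilon> (lin ?m) (\<lambda>t \<omega>. integral {0..t} (\<lambda>u. b u * sig \<omega> u w))"
    unfolding close_within_def
  proof (intro bexI[of _ E] conjI ballI)
    fix \<omega> t assume w: "\<omega> \<in> space M - E" and t: "t \<in> {0..T}"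
    have sub: "continuous_on {0..t} (\<lambda>u. sig \<omega> u w)" "continuous_on {0..t} q" "continuous_on {0..t} b"
      using w t by (auto intro: continuous_on_subset[OF sig_continuous] continuous_on_subset[OF qc] continuous_on_subset[OF b])
    have "lin ?m t \<omega> = integral {0..t} (\<lambda>u. lin (shuffle l (Poly_Mapping.single w 1)) u \<omega>)"
      using w t by (intro lin_integral) auto
    also have "\<dots> = integral {0..t} (\<lambda>u. q u * sig \<omega> u w)"
      by (rule integral_cong) (use w t l in \<open>auto simp: lin_shuffle lin_word\<close>)
    finally have "lin ?m t \<omega> - integral {0..t} (\<lambda>u. b u * sig \<omega> u w)
        = integral {0..t} (\<lambda>u. q u * sig \<omega> u w) - integral {0..t} (\<lambda>u. b u * sig \<omega> u w)" by simp
    also have "\<dots> = integral {0..t} (\<lambda>u. q u * sig \<omega> u w - b u * sig \<omega> u w)"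
      by (intro integral_diff[symmetric] integrable_continuous_real continuous_intros sub)
    also have "norm \<dots> \<le> (c * C) * (t - 0)"
    proof (rule integral_bound)
      fix u assume u: "u \<in> {0..t}"
      have "\<bar>q u - b u\<bar> * \<bar>sig \<omega> u w\<bar> \<le> c * C"
        using q(2)[of u] E(4)[of \<omega> u] u t w E(1) by (intro mult_mono) (auto simp: abs_minus_commute)
      then show "norm (q u * sig \<omega> u w - b u * sig \<omega> u w) \<le> c * C"
        by (simp add: left_diff_distrib[symmetric] abs_mult)
    qed (use t in \<open>auto intro!: continuous_intros sub\<close>)
    also have "\<dots> \<le> c * C * T" using t c E by (intro mult_left_mono) auto
    finally show "\<bar>lin ?m t \<omega> - integral {0..t} (\<lambda>u. b u * sig \<omega> u w)\<bar> < \<epsilon>" using c(2) by simp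
  qed (use E in auto)
  then show "\<exists>l. close_within \<epsilon> (lin l) (\<lambda>t \<omega>. integral {0..t} (\<lambda>u. b u * sig \<omega> u w))" by blast
qed

section \<open>Random factors known at a given time\<close>

lemma bump_exists:
  fixes r d :: real
  assumes "0 < d" "d \<le> r" "r \<le> T"
  obtains b where "continuous_on UNIV b" "\<And>u. 0 \<le> b u" "\<And>u. u \<notin> {r - d..r} \<Longrightarrow> b u = 0"
    "\<And>t. r \<le> t \<Longrightarrow> t \<le> T \<Longrightarrow> integral {0..t} b = (1::real)"
proof -
  define b0 where "b0 = (\<lambda>u. max 0 ((u - (r - d)) * (r - u)))"
  have c: "continuous_on A b0" for A unfolding b0_def by (intro continuous_intros)
  have nn: "b0 u \<ge> 0" for u by (simp add: b0_def)
  have z: "b0 u = 0" if "u \<notin> {r - d..r}" for u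
  proof -
    have "(u - (r - d)) * (r - u) \<le> 0"
      using that \<open>0 < d\<close> by (cases "u < r - d") (auto simp: mult_le_0_iff)
    then show ?thesis by (simp add: b0_def)
  qed
  define Z where "Z = integral {0..r} b0"
  have "Z \<noteq> 0"
  proof
    assume "Z = 0"
    then have "\<forall>x\<in>{0..r}. b0 x = 0"
      using integral_eq_0_iff[OF c, of 0 r] nn assms by (simp add: Z_def)
    then have "b0 (r - d / 2) = 0" using assms by auto
    then show False using assms by (auto simp: b0_def max_def split: if_splits)
  qed
  moreover have "Z \<ge> 0" unfolding Z_def by (intro integral_nonneg integrable_continuous_real c nn)
  ultimately have Z: "Z > 0" by simp
  have int: "integral {0..t} b0 = Z" if "r \<le> t" "t \<le> T" for t
  proof -
    have "integral {r..t} b0 = integral {r..t} (\<lambda>_. 0)"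
    proof (rule integral_cong)
      fix u assume "u \<in> {r..t}"
      then show "b0 u = 0" using z[of u] by (cases "u = r") (auto simp: b0_def)
    qed
    then show ?thesis
      using Henstock_Kurzweil_Integration.integral_combine[of 0 r t b0] that assms integrable_continuous_real[OF c]
      by (simp add: Z_def)
  qed
  show ?thesis
  proof (rule that[of "\<lambda>u. b0 u / Z"])
    show "continuous_on UNIV (\<lambda>u. b0 u / Z)" using Z by (intro continuous_intros c) auto
    show "integral {0..t} (\<lambda>u. b0 u / Z) = 1" if "r \<le> t" "t \<le> T" for t
      using int[OF that] Z by (simp add: integral_divide)
  qed (use nn z Z in auto)
qed

text \<open>Random variables that are visible from time \<open>s\<close> on: \<open>F\<close> may be
  attached to any continuous function of time that vanishes up to \<open>s\<close>. Quantifying over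
  all such \<open>\<phi>\<close> leaves the freedom to factor \<open>\<phi>\<close> when two random
  variables are multiplied.\<close>

definition adapted_factors :: "real \<Rightarrow> ('w \<Rightarrow> real) set" where
  "adapted_factors s = {F. \<forall>\<phi>. continuous_on {0..T} \<phi> \<and> (\<forall>t\<in>{0..s}. \<phi> t = 0) \<longrightarrow> approximable (\<lambda>t \<omega>. \<phi> t * F \<omega>)}"

lemma adapted_factorsI:
  assumes "\<And>\<phi>. continuous_on {0..T} \<phi> \<Longrightarrow> \<forall>t\<in>{0..s}. \<phi> t = 0 \<Longrightarrow> approximable (\<lambda>t \<omega>. \<phi> t * F \<omega>)"
  shows "F \<in> adapted_factors s"
  using assms by (simp add: adapted_factors_def)

lemma adapted_factorsD:
  assumes "F \<in> adapted_factors s" "continuous_on {0..T} \<phi>" "\<forall>t\<in>{0..s}. \<phi> t = 0"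
  shows "approximable (\<lambda>t \<omega>. \<phi> t * F \<omega>)"
  using assms by (simp add: adapted_factors_def)

lemma adapted_factors_cong:
  assumes F: "F \<in> adapted_factors s" and eq: "\<And>\<omega>. \<omega> \<in> space M \<Longrightarrow> F \<omega> = G \<omega>"
  shows "G \<in> adapted_factors s"
proof (rule adapted_factorsI)
  fix \<phi> :: "real \<Rightarrow> real" assume "continuous_on {0..T} \<phi>" "\<forall>t\<in>{0..s}. \<phi> t = 0"
  from adapted_factorsD[OF F this] show "approximable (\<lambda>t \<omega>. \<phi> t * G \<omega>)"
    by (rule approximable_cong) (simp add: eq)
qed

lemma adapted_factors_const: "(\<lambda>\<omega>. c) \<in> adapted_factors s"
  by (rule adapted_factorsI) (intro approximable_deterministic continuous_intros)

lemma adapted_factors_add: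
  assumes "F \<in> adapted_factors s" "G \<in> adapted_factors s"
  shows "(\<lambda>\<omega>. F \<omega> + G \<omega>) \<in> adapted_factors s"
proof (rule adapted_factorsI)
  fix \<phi> :: "real \<Rightarrow> real" assume "continuous_on {0..T} \<phi>" "\<forall>t\<in>{0..s}. \<phi> t = 0"
  from approximable_add[OF adapted_factorsD[OF assms(1) this] adapted_factorsD[OF assms(2) this]]
  show "approximable (\<lambda>t \<omega>. \<phi> t * (F \<omega> + G \<omega>))" by (simp add: distrib_left)
qed

lemma adapted_factors_mult:
  assumes "F \<in> adapted_factors s" "G \<in> adapted_factors s"
  shows "(\<lambda>\<omega>. F \<omega> * G \<omega>) \<in> adapted_factors s"
proof (rule adapted_factorsI)
  fix \<phi> :: "real \<Rightarrow> real" assume p: "continuous_on {0..T} \<phi>" "\<forall>t\<in>{0..s}. \<phi> t = 0"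
  let ?r = "\<lambda>t. sqrt \<bar>\<phi> t\<bar>"
  \<comment> \<open>The signed square root of \<open>\<phi>\<close>. Together with the root of
    \<open>\<bar>\<phi>\<bar>\<close> it factors \<open>\<phi>\<close> into continuous functions
    with the same zeros, one for each random factor.\<close>
  define s1 where "s1 = (\<lambda>t. sqrt (max 0 (\<phi> t)) - sqrt (max 0 (- \<phi> t)))"
  have "continuous_on {0..T} s1" unfolding s1_def by (intro continuous_intros p(1))
  then have "approximable (\<lambda>t \<omega>. s1 t * F \<omega>)"
    by (rule adapted_factorsD[OF assms(1)]) (use p(2) in \<open>simp add: s1_def\<close>)
  moreover have "continuous_on {0..T} ?r" by (intro continuous_intros p(1))
  then have "approximable (\<lambda>t \<omega>. ?r t * G \<omega>)"
    by (rule adapted_factorsD[OF assms(2)]) (use p(2) in simp)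
  ultimately have "approximable (\<lambda>t \<omega>. (s1 t * F \<omega>) * (?r t * G \<omega>))" by (rule approximable_mult)
  moreover have "s1 t * ?r t = \<phi> t" for t
    by (cases "\<phi> t \<ge> 0") (auto simp: s1_def max_def)
  then have "(s1 t * F \<omega>) * (?r t * G \<omega>) = \<phi> t * (F \<omega> * G \<omega>)" for t \<omega>
    by (metis mult.assoc mult.left_commute)
  ultimately show "approximable (\<lambda>t \<omega>. \<phi> t * (F \<omega> * G \<omega>))" by simp
qed

text \<open>Pointwise convergence implies convergence in probability, and \<open>\<phi>\<close> is
  bounded on \<open>[0,T]\<close>. The exceptional events are unions over tails so that they
  decrease.\<close>

lemma adapted_factors_limit:
  assumes F: "\<And>n. F n \<in> adapted_factors s" and m: "\<And>n. F n \<in> borel_measurable M"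
    and lim: "\<And>\<omega>. \<omega> \<in> space M \<Longrightarrow> (\<lambda>n. F n \<omega>) \<longlonglongrightarrow> G \<omega>"
  shows "G \<in> adapted_factors s"
proof (rule adapted_factorsI)
  fix \<phi> :: "real \<Rightarrow> real" assume p: "continuous_on {0..T} \<phi>" "\<forall>t\<in>{0..s}. \<phi> t = 0"
  have G: "G \<in> borel_measurable M" by (rule borel_measurable_LIMSEQ_real[OF lim m])
  obtain B where B0: "B \<ge> 0" and B: "\<And>t. t \<in> {0..T} \<Longrightarrow> \<bar>\<phi> t\<bar> \<le> B"
    using continuous_interval_bound[OF p(1)] by blast
  show "approximable (\<lambda>t \<omega>. \<phi> t * G \<omega>)"
  proof (rule approximable_limit)
    fix \<epsilon> :: real assume "\<epsilon> > 0"
    define c where "c = \<epsilon> / (B + 1)"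
    have c: "c > 0" "B * c < \<epsilon>" using B0 \<open>\<epsilon> > 0\<close> by (auto simp: c_def field_simps)
    let ?E = "\<lambda>n. \<Union>k\<in>{n..}. {\<omega> \<in> space M. \<bar>F k \<omega> - G \<omega>\<bar> > c}"
    have E: "?E n \<in> sets M" for n using m G by measurable
    have dec: "decseq ?E" by (force simp: decseq_def)
    have "(\<Inter>n. ?E n) = {}"
    proof (rule equals0I)
      fix \<omega> assume w: "\<omega> \<in> (\<Inter>n. ?E n)"
      then have "\<omega> \<in> space M" by auto
      then obtain n where n: "\<And>k. k \<ge> n \<Longrightarrow> norm (F k \<omega> - G \<omega>) < c" using LIMSEQ_D[OF lim c(1)] by blast
      have "\<omega> \<in> ?E n" using w by blast
      then obtain k where "k \<ge> n" "\<bar>F k \<omega> - G \<omega>\<bar> > c" by auto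
      then show False using n[of k] by simp
    qed
    then obtain n where n: "prob (?E n) < \<epsilon>" using prob_decseq_small[OF E dec] \<open>\<epsilon> > 0\<close> by blast
    have "close_within \<epsilon> (\<lambda>t \<omega>. \<phi> t * F n \<omega>) (\<lambda>t \<omega>. \<phi> t * G \<omega>)"
      unfolding close_within_def
    proof (intro bexI[of _ "?E n"] conjI ballI)
      fix \<omega> t assume w: "\<omega> \<in> space M - ?E n" and t: "t \<in> {0..T}"
      have "\<bar>\<phi> t\<bar> * \<bar>F n \<omega> - G \<omega>\<bar> \<le> B * c"
        using B[OF t] B0 w by (intro mult_mono) (auto simp: not_less)
      then show "\<bar>\<phi> t * F n \<omega> - \<phi> t * G \<omega>\<bar> < \<epsilon>"
        using c(2) by (simp add: right_diff_distrib[symmetric] abs_mult)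
    qed (use n E in auto)
    moreover have "approximable (\<lambda>t \<omega>. \<phi> t * F n \<omega>)" by (rule adapted_factorsD[OF F p])
    ultimately show "\<exists>g. approximable g \<and> close_within \<epsilon> g (\<lambda>t \<omega>. \<phi> t * G \<omega>)" by blast
  qed
qed

text \<open>
  The value of the signature at a past time \<open>r\<close> is recovered from the current one by averaging against a bump
  just before \<open>r\<close>; this is where the time component of the path enters.
\<close>

lemma adapted_factors_sig:
  assumes r: "0 \<le> r" "r \<le> s" "s \<le> T"
  shows "(\<lambda>\<omega>. sig \<omega> r w) \<in> adapted_factors s"
proof (cases "r = 0")
  case True
  show ?thesis by (rule adapted_factors_cong[OF adapted_factors_const[of "tunit w"]]) (simp add: True sig_start)
next
  case False
  with r have r0: "r > 0" "r \<in> {0..T}" by auto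
  show ?thesis
  proof (rule adapted_factorsI)
    fix \<phi> :: "real \<Rightarrow> real" assume p: "continuous_on {0..T} \<phi>" "\<forall>t\<in>{0..s}. \<phi> t = 0"
    obtain B where B0: "B \<ge> 0" and B: "\<And>t. t \<in> {0..T} \<Longrightarrow> \<bar>\<phi> t\<bar> \<le> B"
      using continuous_interval_bound[OF p(1)] by blast
    show "approximable (\<lambda>t \<omega>. \<phi> t * sig \<omega> r w)"
    proof (rule approximable_limit)
      fix \<epsilon> :: real assume "\<epsilon> > 0"
      define c where "c = \<epsilon> / (B + 1)"
      have c: "c > 0" "B * c < \<epsilon>" using B0 \<open>\<epsilon> > 0\<close> by (auto simp: c_def field_simps)
      \<comment> \<open>Lengths of windows before \<open>r\<close> that shrink to it;
        \<open>d 0 = r\<close>, so no window reaches below 0.\<close>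
      define d where "d = (\<lambda>n::nat. r / real (Suc n))"
      have d: "0 < d n" "d n \<le> r" for n using r0 by (auto simp: d_def field_simps)
      have dmono: "d n \<le> d m" if "m \<le> n" for m n
        using that r0 unfolding d_def by (intro divide_left_mono) auto
      let ?E = "\<lambda>n. {\<omega> \<in> space M. \<exists>u\<in>{r - d n..r}. \<bar>sig \<omega> u w - sig \<omega> r w\<bar> > c}"
      have sub: "u \<in> {0..T}" if "u \<in> {r - d n..r}" for u n using that d[of n] r by auto
      have E: "?E n \<in> sets M" for n
      proof (rule exists_greater_measurable)
        fix \<omega> assume "\<omega> \<in> space M"
        then show "continuous_on {r - d n..r} (\<lambda>u. \<bar>sig \<omega> u w - sig \<omega> r w\<bar>)"
          by (intro continuous_intros continuous_on_subset[OF sig_continuous] subsetI) (use sub in blast)+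
      next
        fix u assume "u \<in> {r - d n..r}"
        then show "(\<lambda>\<omega>. \<bar>sig \<omega> u w - sig \<omega> r w\<bar>) \<in> borel_measurable M"
          using sub r0 by (intro borel_measurable_abs borel_measurable_diff sig_measurable) auto
      qed
      have dec: "decseq ?E"
        unfolding decseq_def using dmono by (fastforce intro: order_trans diff_left_mono)
      have "(\<Inter>n. ?E n) = {}"
      proof (rule equals0I)
        fix \<omega> assume w: "\<omega> \<in> (\<Inter>n. ?E n)"
        then have ws: "\<omega> \<in> space M" by auto
        obtain \<delta> where \<delta>: "\<delta> > 0" "\<And>u. u \<in> {0..T} \<Longrightarrow> dist u r < \<delta> \<Longrightarrow> dist (sig \<omega> u w) (sig \<omega> r w) < c"
          using sig_continuous[OF ws, of w] r0(2) c(1) unfolding continuous_on_iff by metis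
        obtain n where n: "inverse (real (Suc n)) < \<delta> / r" using reals_Archimedean[of "\<delta> / r"] \<delta> r0 by auto
        have dn: "d n < \<delta>" using n r0 by (simp add: d_def field_simps)
        have "\<omega> \<in> ?E n" using w by blast
        then obtain u where u: "u \<in> {r - d n..r}" "\<bar>sig \<omega> u w - sig \<omega> r w\<bar> > c" by blast
        then show False using \<delta>(2)[OF sub[OF u(1)]] dn by (auto simp: dist_real_def)
      qed
      then obtain n where n: "prob (?E n) < \<epsilon>" using prob_decseq_small[OF E dec] \<open>\<epsilon> > 0\<close> by blast
      have rT: "r \<le> T" using r by simp
      obtain b :: "real \<Rightarrow> real" where b: "continuous_on UNIV b" "\<And>u. 0 \<le> b u" "\<And>u. u \<notin> {r - d n..r} \<Longrightarrow> b u = 0"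
        "\<And>t. r \<le> t \<Longrightarrow> t \<le> T \<Longrightarrow> integral {0..t} b = 1"
        using bump_exists[OF d(1)[of n] d(2)[of n] rT] by blast
      have bc: "continuous_on A b" for A using b(1) by (rule continuous_on_subset) simp
      let ?g = "\<lambda>t \<omega>. \<phi> t * integral {0..t} (\<lambda>u. b u * sig \<omega> u w)"
      have "close_within \<epsilon> ?g (\<lambda>t \<omega>. \<phi> t * sig \<omega> r w)"
        unfolding close_within_def
      proof (intro bexI[of _ "?E n"] conjI ballI)
        fix \<omega> t assume w: "\<omega> \<in> space M - ?E n" and t: "t \<in> {0..T}"
        show "\<bar>?g t \<omega> - \<phi> t * sig \<omega> r w\<bar> < \<epsilon>"
        \<comment> \<open>Up to \<open>s\<close> the factor \<open>\<phi> t\<close> vanishes. Later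
          \<open>t\<close> exceeds \<open>s\<close> and hence \<open>r\<close>, so the support of
          the bump lies in \<open>[0,t]\<close> and its integral is 1.\<close>
        proof (cases "t \<le> s")
          case True
          then show ?thesis using p t \<open>\<epsilon> > 0\<close> by simp
        next
          case False
          then have rt: "r \<le> t" "t \<le> T" using r t by auto
          have sc: "continuous_on {0..t} (\<lambda>u. sig \<omega> u w)"
            using w t by (intro continuous_on_subset[OF sig_continuous]) auto
          have bs: "((\<lambda>u. b u * sig \<omega> r w) has_integral 1 * sig \<omega> r w) {0..t}"
            using b(4)[OF rt] integrable_continuous_real[OF bc, of 0 t]
            by (intro has_integral_mult_left) (simp add: has_integral_integral)
          have "integral {0..t} (\<lambda>u. b u * sig \<omega> u w) - sig \<omega> r w =
              integral {0..t} (\<lambda>u. b u * sig \<omega> u w) - integral {0..t} (\<lambda>u. b u * sig \<omega> r w)"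
            using integral_unique[OF bs] by simp
          also have "\<dots> = integral {0..t} (\<lambda>u. b u * sig \<omega> u w - b u * sig \<omega> r w)"
            by (intro integral_diff[symmetric] integrable_continuous_real continuous_intros bc sc)
          also have "norm \<dots> \<le> integral {0..t} (\<lambda>u. b u * c)"
          proof (rule integral_norm_bound_integral)
            fix u assume u: "u \<in> {0..t}"
            show "norm (b u * sig \<omega> u w - b u * sig \<omega> r w) \<le> b u * c"
            proof (cases "u \<in> {r - d n..r}")
              case True
              then have "\<bar>sig \<omega> u w - sig \<omega> r w\<bar> \<le> c" using w by (auto simp: not_less)
              then have "b u * \<bar>sig \<omega> u w - sig \<omega> r w\<bar> \<le> b u * c" using b(2) by (intro mult_left_mono)
              then show ?thesis using b(2)[of u] by (simp add: right_diff_distrib[symmetric] abs_mult)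
            qed (simp add: b(3))
          qed (intro integrable_continuous_real continuous_intros bc sc)+
          also have "\<dots> = c" using b(4)[OF rt] by simp
          finally have "\<bar>integral {0..t} (\<lambda>u. b u * sig \<omega> u w) - sig \<omega> r w\<bar> \<le> c" by simp
          then have "\<bar>\<phi> t\<bar> * \<bar>integral {0..t} (\<lambda>u. b u * sig \<omega> u w) - sig \<omega> r w\<bar> \<le> B * c"
            using B[OF t] B0 by (intro mult_mono) auto
          then show ?thesis using c(2) by (simp add: right_diff_distrib[symmetric] abs_mult)
        qed
      qed (use n E in auto)
      moreover have "approximable ?g"
        by (intro approximable_mult approximable_deterministic approximable_weighted_integral p bc)
      ultimately show "\<exists>g. approximable g \<and> close_within \<epsilon> g (\<lambda>t \<omega>. \<phi> t * sig \<omega> r w)" by blast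
    qed
  qed
qed

lemma adapted_factors_polynomial:
  assumes "real_polynomial_function (q :: real \<Rightarrow> real)" "V \<in> adapted_factors s"
  shows "(\<lambda>\<omega>. q (V \<omega>)) \<in> adapted_factors s"
  using assms(1)
proof induction
  case (linear f)
  then obtain c where "f = (\<lambda>x. x * c)" by (rule real_bounded_linear[THEN iffD1, THEN exE])
  then show ?case using adapted_factors_mult[OF assms(2) adapted_factors_const] by simp
qed (auto intro: adapted_factors_const adapted_factors_add adapted_factors_mult)

text \<open>Polynomials in \<open>V\<close> are available through products. Those within
  \<open>1 / (n + 1)\<close> of \<open>\<psi>\<close> on \<open>[-n,n]\<close> converge at each
  value of \<open>V\<close>, even if \<open>V\<close> is unbounded.\<close>

lemma adapted_factors_continuous:
  assumes \<psi>: "continuous_on UNIV (\<psi> :: real \<Rightarrow> real)" and V: "V \<in> adapted_factors s" "V \<in> borel_measurable M"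
  shows "(\<lambda>\<omega>. \<psi> (V \<omega>)) \<in> adapted_factors s"
proof -
  have "\<exists>q. real_polynomial_function q \<and> (\<forall>x\<in>{- real n..real n}. \<bar>\<psi> x - q x\<bar> < 1 / real (Suc n))" for n
    using Stone_Weierstrass_real_polynomial_function[OF compact_Icc continuous_on_subset[OF \<psi> subset_UNIV],
        of "1 / real (Suc n)" "- real n" "real n"] by (metis of_nat_0_less_iff zero_less_Suc zero_less_divide_1_iff)
  then obtain q where q: "\<And>n. real_polynomial_function (q n)"
    "\<And>n x. x \<in> {- real n..real n} \<Longrightarrow> \<bar>\<psi> x - q n x\<bar> < 1 / real (Suc n)" by metis
  show ?thesis
  proof (rule adapted_factors_limit)
    show "(\<lambda>\<omega>. q n (V \<omega>)) \<in> adapted_factors s" for n by (rule adapted_factors_polynomial[OF q(1) V(1)])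
    have "continuous_on UNIV (q n)" for n
      using q(1)[of n] by (simp add: real_polynomial_function_eq continuous_on_polymonial_function)
    then show "(\<lambda>\<omega>. q n (V \<omega>)) \<in> borel_measurable M" for n
      using V(2) by (metis borel_measurable_continuous_onI measurable_compose)
    fix \<omega>
    show "(\<lambda>n. q n (V \<omega>)) \<longlonglongrightarrow> \<psi> (V \<omega>)"
    proof (rule LIMSEQ_I)
      fix e :: real assume "e > 0"
      obtain n1 where n1: "inverse (real (Suc n1)) < e" using reals_Archimedean[OF \<open>e > 0\<close>] by blast
      obtain n2 where n2: "\<bar>V \<omega>\<bar> \<le> real n2" using real_arch_simple by blast
      have "norm (q n (V \<omega>) - \<psi> (V \<omega>)) < e" if "n \<ge> max n1 n2" for n
      proof -
        have "V \<omega> \<in> {- real n..real n}" using n2 that by auto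
        then have "\<bar>\<psi> (V \<omega>) - q n (V \<omega>)\<bar> < 1 / real (Suc n)" by (rule q(2))
        also have "\<dots> \<le> 1 / real (Suc n1)" using that by (intro divide_left_mono) auto
        also have "\<dots> < e" using n1 by (simp add: inverse_eq_divide)
        finally show ?thesis by (simp add: abs_minus_commute)
      qed
      then show "\<exists>no. \<forall>n\<ge>no. norm (q n (V \<omega>) - \<psi> (V \<omega>)) < e" by blast
    qed
  qed
qed

text \<open>The indicator is a pointwise limit of the continuous ramps \<open>\<psi> n\<close>,
  which equal 1 up to \<open>c\<close> and then fall to 0 with slope \<open>n\<close>.\<close>

lemma adapted_factors_halfline:
  assumes V: "V \<in> adapted_factors s" "V \<in> borel_measurable M"
  shows "(\<lambda>\<omega>. indicator {..c} (V \<omega>)) \<in> adapted_factors s"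
proof -
  define \<psi> where "\<psi> = (\<lambda>n::nat. \<lambda>x. max 0 (min 1 (1 - real n * (x - c))))"
  have c: "continuous_on UNIV (\<psi> n)" for n unfolding \<psi>_def by (intro continuous_intros)
  show ?thesis
  proof (rule adapted_factors_limit)
    show "(\<lambda>\<omega>. \<psi> n (V \<omega>)) \<in> adapted_factors s" for n by (rule adapted_factors_continuous[OF c V])
    show "(\<lambda>\<omega>. \<psi> n (V \<omega>)) \<in> borel_measurable M" for n
      using V(2) c by (metis borel_measurable_continuous_onI measurable_compose)
    fix \<omega>
    show "(\<lambda>n. \<psi> n (V \<omega>)) \<longlonglongrightarrow> indicator {..c} (V \<omega>)"
    proof (cases "V \<omega> \<le> c")
      case True
      have "\<psi> n (V \<omega>) = 1" for n
      proof -
        have "real n * (V \<omega> - c) \<le> 0" using True by (intro mult_nonneg_nonpos) auto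
        then show ?thesis by (simp add: \<psi>_def)
      qed
      then show ?thesis using True by simp
    next
      case False
      obtain n0 where n0: "1 / (V \<omega> - c) \<le> real n0" using real_arch_simple by blast
      have "\<psi> n (V \<omega>) = 0" if "n \<ge> n0" for n
      proof -
        have "1 \<le> real n0 * (V \<omega> - c)" using n0 False by (simp add: field_simps)
        also have "\<dots> \<le> real n * (V \<omega> - c)" using that False by (intro mult_right_mono) auto
        finally show ?thesis by (simp add: \<psi>_def)
      qed
      then have "eventually (\<lambda>n. \<psi> n (V \<omega>) = indicator {..c} (V \<omega>)) sequentially"
        using False by (auto simp: eventually_sequentially)
      then show ?thesis by (rule tendsto_eventually)
    qed
  qed
qed

section \<open>Events of the filtration\<close>

definition adapted_events :: "real \<Rightarrow> 'w set set" where
  "adapted_events s = {A \<in> sets M. indicator A \<in> adapted_factors s}"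

text \<open>In terms of indicators, complements are affine, finite unions follow from products by
  inclusion and exclusion, and countable unions are pointwise limits of finite ones.\<close>

lemma adapted_events_sigma_algebra: "sigma_algebra (space M) (adapted_events s)"
proof -
  have compl: "space M - A \<in> adapted_events s" if "A \<in> adapted_events s" for A
  proof -
    have "(\<lambda>\<omega>. 1 + (- 1) * indicator A \<omega>) \<in> adapted_factors s"
      using that by (intro adapted_factors_add adapted_factors_mult adapted_factors_const) (simp add: adapted_events_def)
    then have "indicator (space M - A) \<in> adapted_factors s"
      by (rule adapted_factors_cong) (auto simp: indicator_def)
    then show ?thesis using that by (auto simp: adapted_events_def)
  qed
  have un: "A \<union> B \<in> adapted_events s" if "A \<in> adapted_events s" "B \<in> adapted_events s" for A B
  proof -
    have "(\<lambda>\<omega>. indicator A \<omega> + indicator B \<omega> + (- 1) * (indicator A \<omega> * indicator B \<omega>)) \<in> adapted_factors s"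
      using that by (intro adapted_factors_add adapted_factors_mult adapted_factors_const) (simp_all add: adapted_events_def)
    then have "indicator (A \<union> B) \<in> adapted_factors s"
      by (rule adapted_factors_cong) (auto simp: indicator_def)
    then show ?thesis using that by (auto simp: adapted_events_def)
  qed
  have empty: "{} \<in> adapted_events s"
    using adapted_factors_cong[OF adapted_factors_const[of 0 s], of "indicator {}"] by (simp add: adapted_events_def)
  have union: "(\<Union>i. A i) \<in> adapted_events s" if A: "range A \<subseteq> adapted_events s" for A :: "nat \<Rightarrow> 'w set"
  proof -
    have fin: "(\<Union>i<n. A i) \<in> adapted_events s" for n
      by (induction n) (use A empty un in \<open>auto simp: lessThan_Suc\<close>)
    have "indicator (\<Union>i. A i) \<in> adapted_factors s"
    proof (rule adapted_factors_limit)
      show "indicator (\<Union>i<n. A i) \<in> adapted_factors s" for n using fin by (simp add: adapted_events_def)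
      show "indicator (\<Union>i<n. A i) \<in> borel_measurable M" for n
        using fin[of n] by (intro borel_measurable_indicator) (simp add: adapted_events_def)
      show "(\<lambda>n. indicator (\<Union>i<n. A i) \<omega>) \<longlonglongrightarrow> (indicator (\<Union>i. A i) \<omega> :: real)" for \<omega>
        by (rule LIMSEQ_indicator_UN)
    qed
    moreover have "(\<Union>i. A i) \<in> sets M" using A by (auto simp: adapted_events_def)
    ultimately show ?thesis by (simp add: adapted_events_def)
  qed
  show ?thesis
    unfolding sigma_algebra_iff2
    using compl empty union by (auto simp: adapted_events_def dest: sets.sets_into_space)
qed

text \<open>By the sigma-algebra property it suffices to treat the generators, and for each
  coordinate of \<open>X\<close> the half-lines, which generate the Borel sets.\<close>

lemma filt_adapted_events:
  assumes s: "s \<in> {0..T}"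
  shows "sets (filt (ereal s)) \<subseteq> adapted_events s"
proof -
  interpret sigma_algebra "space M" "adapted_events s" by (rule adapted_events_sigma_algebra)
  have "A \<in> adapted_events s" if A: "A \<in> filt_generator (ereal s)" for A
  proof -
    obtain r w B where A_def: "A = {\<omega> \<in> space M. X r \<omega> w \<in> B}" and r: "r \<in> {0..T}" "r \<le> s" and B: "B \<in> sets borel"
      using filt_generatorE[OF A] by (metis ereal_less_eq(3))
    define V where "V = (\<lambda>\<omega>. X r \<omega> w)"
    have Vm: "V \<in> borel_measurable M" unfolding V_def by (rule X_measurable[OF r(1)])
    have Vf: "V \<in> adapted_factors s"
    proof (cases "length w \<le> nat \<lfloor>p\<rfloor>")
      case True
      show ?thesis
        by (rule adapted_factors_cong[OF adapted_factors_sig[of r s w]]) (use r s True in \<open>auto simp: V_def sig_low\<close>)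
    next
      case False
      have "V \<omega> = 0" if "\<omega> \<in> space M" for \<omega>
        using incr_eq_X[OF that r(1), of w] False by (simp add: V_def incr_def trunc_def)
      then show ?thesis by (intro adapted_factors_cong[OF adapted_factors_const[of 0]]) auto
    qed
    have "B \<in> sigma_sets UNIV (range atMost)"
      using B unfolding borel_eq_atMost by (simp add: sets_measure_of)
    then have "{\<omega> \<in> space M. V \<omega> \<in> B} \<in> adapted_events s"
    proof (induction rule: sigma_sets.induct)
      case (Basic a)
      then obtain c where a: "a = {..c}" by auto
      have "indicator {\<omega> \<in> space M. V \<omega> \<in> a} \<in> adapted_factors s"
        by (rule adapted_factors_cong[OF adapted_factors_halfline[OF Vf Vm, of c]]) (auto simp: a indicator_def)
      moreover have "{\<omega> \<in> space M. V \<omega> \<in> a} \<in> sets M" using Vm unfolding a by auto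
      ultimately show ?case by (simp add: adapted_events_def)
    next
      case Empty
      then show ?case by simp
    next
      case (Compl a)
      have "{\<omega> \<in> space M. V \<omega> \<in> UNIV - a} = space M - {\<omega> \<in> space M. V \<omega> \<in> a}" by auto
      then show ?case using Compl by auto
    next
      case (Union a)
      have "{\<omega> \<in> space M. V \<omega> \<in> (\<Union>i. a i)} = (\<Union>i. {\<omega> \<in> space M. V \<omega> \<in> a i})" by auto
      then show ?case using Union by auto
    qed
    then show ?thesis by (simp add: A_def V_def)
  qed
  then have "sigma_sets (space M) (filt_generator (ereal s)) \<subseteq> adapted_events s"
    by (intro sigma_sets_subset) auto
  then show ?thesis by (simp add: sets_filt)
qed

end

section \<open>Stopping times as limits of hitting times\<close>

context rough_process
begin

section \<open>Stopped processes\<close>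

definition stop_at :: "('w \<Rightarrow> ereal) \<Rightarrow> 'w \<Rightarrow> real" where
  "stop_at \<tau> \<omega> = real_of_ereal (min (\<tau> \<omega>) (ereal T))"

lemma stopping_time_cases:
  assumes "\<tau> \<in> rp_stopping_times p T M X" "\<omega> \<in> space M"
  obtains r where "\<tau> \<omega> = ereal r" "r \<in> {0..T}" "stop_at \<tau> \<omega> = r" | "\<tau> \<omega> = \<infinity>" "stop_at \<tau> \<omega> = T"
proof -
  have "\<tau> \<omega> \<in> ereal ` {0..T} \<union> {\<infinity>}" using assms by (auto simp: rp_stopping_times_def)
  then show ?thesis
  proof
    assume "\<tau> \<omega> \<in> ereal ` {0..T}"
    then obtain r where "\<tau> \<omega> = ereal r" "r \<in> {0..T}" by auto
    then show ?thesis using that(1)[of r] by (auto simp: stop_at_def min_def)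
  next
    assume "\<tau> \<omega> \<in> {\<infinity>}"
    then show ?thesis using that(2) by (simp add: stop_at_def min_def)
  qed
qed

lemma stop_at_range:
  assumes "\<tau> \<in> rp_stopping_times p T M X" "\<omega> \<in> space M"
  shows "stop_at \<tau> \<omega> \<in> {0..T}"
  using assms by (cases rule: stopping_time_cases) (use T0 in auto)

lemma stopping_time_event:
  assumes "\<tau> \<in> rp_stopping_times p T M X"
  shows "{\<omega> \<in> space M. \<tau> \<omega> \<le> t} \<in> sets (filt t)"
proof -
  have "Measurable.pred (filt t) (\<lambda>\<omega>. \<tau> \<omega> \<le> t)"
    using assms by (simp add: rp_stopping_times_def stopping_time_def)
  then show ?thesis by (simp add: pred_def)
qed

lemma stop_at_measurable:
  assumes "\<tau> \<in> rp_stopping_times p T M X"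
  shows "stop_at \<tau> \<in> borel_measurable M"
proof -
  have "\<tau> \<in> borel_measurable M"
    by (rule borel_measurableI_le)
      (use stopping_time_event[OF assms] subalgebra_filt in \<open>auto simp: subalgebra_def\<close>)
  then show ?thesis unfolding stop_at_def[abs_def] by measurable
qed

text \<open>The stopping time is rounded down to a grid of mesh \<open>T / (n + 1)\<close>. The
  rounded time takes countably many values, so evaluating \<open>Y\<close> there is measurable, and
  continuity of the paths gives the limit.\<close>

lemma stopped_value_measurable:
  assumes \<tau>: "\<tau> \<in> rp_stopping_times p T M X"
    and c: "\<And>\<omega>. \<omega> \<in> space M \<Longrightarrow> continuous_on {0..T} (\<lambda>t. Y t \<omega>)"
    and m: "\<And>t. t \<in> {0..T} \<Longrightarrow> Y t \<in> borel_measurable M"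
  shows "stopped_value T Y \<tau> \<in> borel_measurable M"
proof (rule borel_measurable_LIMSEQ_real)
  define k where "k = (\<lambda>n \<omega>. nat \<lfloor>stop_at \<tau> \<omega> * real (Suc n) / T\<rfloor>)"
  define s where "s = (\<lambda>n i. min T (T * real i / real (Suc n)))"
  have s: "s n i \<in> {0..T}" for n i using T0 by (auto simp: s_def)
  fix n
  have sm: "stop_at \<tau> \<in> borel_measurable M" by (rule stop_at_measurable[OF \<tau>])
  show "(\<lambda>\<omega>. Y (s n (k n \<omega>)) \<omega>) \<in> borel_measurable M"
  proof (rule measurable_compose_countable)
    show "(\<lambda>\<omega>. Y (s n i) \<omega>) \<in> borel_measurable M" for i using m[OF s] .
    show "k n \<in> measurable M (count_space UNIV)" unfolding k_def using sm by measurable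
  qed
next
  define k where "k = (\<lambda>n \<omega>. nat \<lfloor>stop_at \<tau> \<omega> * real (Suc n) / T\<rfloor>)"
  define s where "s = (\<lambda>n i. min T (T * real i / real (Suc n)))"
  have s: "s n i \<in> {0..T}" for n i using T0 by (auto simp: s_def)
  fix \<omega> assume w: "\<omega> \<in> space M"
  define x where "x = stop_at \<tau> \<omega>"
  have x: "x \<in> {0..T}" unfolding x_def by (rule stop_at_range[OF \<tau> w])
  have near: "\<bar>s n (k n \<omega>) - x\<bar> \<le> T / real (Suc n)" for n
  proof -
    define y where "y = x * real (Suc n) / T"
    have y0: "y \<ge> 0" using x T0 by (simp add: y_def)
    have k: "real (k n \<omega>) \<le> y" "y \<le> real (k n \<omega>) + 1"
      using y0 unfolding k_def x_def[symmetric] y_def[symmetric] by linarith+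
    have xy: "x = T * y / real (Suc n)" using T0 by (simp add: y_def)
    have 1: "T * real (k n \<omega>) / real (Suc n) \<le> x"
      unfolding xy using k T0 by (intro divide_right_mono mult_left_mono) auto
    have "x \<le> T * (real (k n \<omega>) + 1) / real (Suc n)"
      unfolding xy using k T0 by (intro divide_right_mono mult_left_mono) auto
    then have 2: "x \<le> T * real (k n \<omega>) / real (Suc n) + T / real (Suc n)"
      by (simp add: distrib_left add_divide_distrib)
    show ?thesis using 1 2 x by (auto simp: s_def min_def)
  qed
  have "(\<lambda>n. T / real (Suc n)) \<longlonglongrightarrow> 0"
    using tendsto_mult[OF tendsto_const[of T] LIMSEQ_inverse_real_of_nat] by (simp add: divide_inverse)
  then have "(\<lambda>n. \<bar>s n (k n \<omega>) - x\<bar>) \<longlonglongrightarrow> 0"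
    by (rule tendsto_sandwich[OF always_eventually always_eventually tendsto_const, rotated 2]) (use near in auto)
  then have "(\<lambda>n. s n (k n \<omega>)) \<longlonglongrightarrow> x" by (simp add: tendsto_rabs_zero_iff LIM_zero_iff)
  then have "(\<lambda>n. Y (s n (k n \<omega>)) \<omega>) \<longlonglongrightarrow> Y x \<omega>"
    by (rule continuous_on_tendsto_compose[OF c[OF w]]) (use x s in auto)
  then show "(\<lambda>n. Y (s n (k n \<omega>)) \<omega>) \<longlonglongrightarrow> stopped_value T Y \<tau> \<omega>"
    by (simp add: stopped_value_def x_def stop_at_def)
qed

section \<open>Approximation of a stopping time\<close>

lemma approximable_sum:
  "(\<And>j. j < n \<Longrightarrow> approximable (h j)) \<Longrightarrow> approximable (\<lambda>t \<omega>. \<Sum>j<(n::nat). h j t \<omega>)"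
proof (induction n)
  case 0
  show ?case using approximable_deterministic[OF continuous_on_const[of _ 0]] by simp
next
  case (Suc n)
  then show ?case by (simp add: approximable_add)
qed

text \<open>The positive part of \<open>t - \<tau>\<close> is the integral over
  \<open>u \<le> t\<close> of the indicator of \<open>\<tau> \<le> u\<close>. A Riemann sum for it
  consists of terms \<open>\<phi> t * indicator (A j) \<omega>\<close> in which \<open>A j\<close>
  is known at the grid time \<open>tj j\<close> and \<open>\<phi>\<close> vanishes up to
  \<open>tj j\<close>.\<close>

lemma approximable_time_since:
  assumes \<tau>: "\<tau> \<in> rp_stopping_times p T M X"
  shows "approximable (\<lambda>t \<omega>. max 0 (t - stop_at \<tau> \<omega>))"
proof (rule approximable_limit)
  fix \<epsilon> :: real assume "\<epsilon> > 0"
  obtain n where n: "inverse (real (Suc n)) < \<epsilon> / T" using reals_Archimedean[of "\<epsilon> / T"] \<open>\<epsilon> > 0\<close> T0 by auto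
  define m where "m = Suc n"
  have m: "m > 0" "T / real m < \<epsilon>" using n T0 by (auto simp: m_def field_simps)
  define tj where "tj = (\<lambda>j. T * real j / real m)"
  define A where "A = (\<lambda>j. {\<omega> \<in> space M. \<tau> \<omega> \<le> ereal (tj j)})"
  have tj_range: "tj j \<in> {0..T}" if "j \<le> m" for j
  proof -
    have "T * real j \<le> T * real m" using that T0 by (intro mult_left_mono) auto
    then show ?thesis using T0 m by (simp add: tj_def field_simps)
  qed
  have tj_mono: "tj j \<le> tj (Suc j)" for j using T0 by (simp add: tj_def divide_right_mono)
  let ?g = "\<lambda>t \<omega>. \<Sum>j<m. (min t (tj (Suc j)) - min t (tj j)) * indicator (A j) \<omega>"
  have "approximable ?g"
  proof (rule approximable_sum)
    fix j assume j: "j < m"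
    have "A j \<in> adapted_events (tj j)"
      using filt_adapted_events[of "tj j"] stopping_time_event[OF \<tau>, of "ereal (tj j)"] tj_range[of j] j
      by (auto simp: A_def)
    then have "indicator (A j) \<in> adapted_factors (tj j)" by (simp add: adapted_events_def)
    then show "approximable (\<lambda>t \<omega>. (min t (tj (Suc j)) - min t (tj j)) * indicator (A j) \<omega>)"
      by (rule adapted_factorsD) (use tj_mono[of j] in \<open>auto intro!: continuous_intros\<close>)
  qed
  moreover have "close_within \<epsilon> ?g (\<lambda>t \<omega>. max 0 (t - stop_at \<tau> \<omega>))"
  proof (rule close_within_uniform[OF \<open>\<epsilon> > 0\<close>])
    fix \<omega> t assume w: "\<omega> \<in> space M" and t: "t \<in> {0..T}"
    define x where "x = stop_at \<tau> \<omega>"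
    have x: "x \<in> {0..T}" unfolding x_def by (rule stop_at_range[OF \<tau> w])
    define j0 where "j0 = nat \<lceil>x * real m / T\<rceil>"
    have le_iff: "x \<le> tj j \<longleftrightarrow> j0 \<le> j" for j
    proof -
      have "x \<le> tj j \<longleftrightarrow> x * real m / T \<le> real j" using T0 m by (simp add: tj_def field_simps)
      also have "\<dots> \<longleftrightarrow> j0 \<le> j" unfolding j0_def by (simp add: nat_le_iff ceiling_le_iff)
      finally show ?thesis .
    qed
    have "tj m = T" using m by (simp add: tj_def)
    then have "j0 \<le> m" using le_iff[of m] x by simp
    \<comment> \<open>For \<open>j < m\<close> the grid time lies below \<open>T\<close>, so it
      makes no difference that \<open>stop_at\<close> is \<open>T\<close> where
      \<open>\<tau>\<close> is infinite.\<close>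
    have A: "\<omega> \<in> A j \<longleftrightarrow> j0 \<le> j" if "j < m" for j
    proof -
      have "tj j < T" using that T0 m by (simp add: tj_def field_simps)
      from \<tau> w have "\<tau> \<omega> \<le> ereal (tj j) \<longleftrightarrow> x \<le> tj j"
        unfolding x_def by (cases rule: stopping_time_cases) (use \<open>tj j < T\<close> in auto)
      then show ?thesis using w le_iff by (simp add: A_def)
    qed
    have "?g t \<omega> = (\<Sum>j\<in>{j0..<m}. min t (tj (Suc j)) - min t (tj j))"
      by (rule sum.mono_neutral_cong_right) (use A in \<open>auto simp: indicator_def\<close>)
    also have "\<dots> = min t (tj m) - min t (tj j0)" using \<open>j0 \<le> m\<close> by (rule sum_Suc_diff')
    also have "\<dots> = t - min t (tj j0)" using \<open>tj m = T\<close> t by simp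
    finally have g: "?g t \<omega> = t - min t (tj j0)" .
    have "x \<le> tj j0" using le_iff by simp
    moreover have "tj j0 \<le> x + T / real m"
    proof -
      have "real j0 \<le> x * real m / T + 1"
        unfolding j0_def using x T0 by (simp add: of_nat_nat)
      then have "T * real j0 \<le> T * (x * real m / T + 1)" using T0 by (intro mult_left_mono) auto
      then have "tj j0 \<le> T * (x * real m / T + 1) / real m" unfolding tj_def using m by (intro divide_right_mono) auto
      also have "\<dots> = x + T / real m" using T0 m by (simp add: field_simps)
      finally show ?thesis .
    qed
    ultimately show "\<bar>?g t \<omega> - max 0 (t - stop_at \<tau> \<omega>)\<bar> < \<epsilon>"
      unfolding g x_def[symmetric] using m(2) by (auto simp: min_def max_def)
  qed
  ultimately show "\<exists>g. approximable g \<and> close_within \<epsilon> g (\<lambda>t \<omega>. max 0 (t - stop_at \<tau> \<omega>))" by blast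
qed

text \<open>
  The process \<open>K (t - \<tau>)\<^sup>+\<close> vanishes up to \<open>\<tau>\<close> and equals \<open>2\<close> at \<open>\<tau> + 2/K\<close>, so a functional
  uniformly within \<open>1/2\<close> of it first reaches level \<open>1\<close> in between.
\<close>

lemma hitting_time_near:
  assumes \<tau>: "\<tau> \<in> rp_stopping_times p T M X" and w: "\<omega> \<in> space M" and "K > 0"
    and close: "\<And>t. t \<in> {0..T} \<Longrightarrow> \<bar>lin l t \<omega> - K * max 0 (t - stop_at \<tau> \<omega>)\<bar> < 1 / 2"
  shows "\<bar>stop_at (hitting_time p T X l) \<omega> - stop_at \<tau> \<omega>\<bar> \<le> 2 / K"
proof -
  define x where "x = stop_at \<tau> \<omega>"
  have x: "x \<in> {0..T}" unfolding x_def by (rule stop_at_range[OF \<tau> w])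
  have early: "x < t" if "t \<in> {0..T}" "lin l t \<omega> \<ge> 1" for t
    using close[OF that(1)] that(2) unfolding x_def[symmetric] by (cases "x < t") auto
  have late: "lin l (x + 2 / K) \<omega> \<ge> 1" if "x + 2 / K \<le> T"
  proof -
    have "x + 2 / K \<in> {0..T}" using that x \<open>K > 0\<close> by simp
    from close[OF this] have "\<bar>lin l (x + 2 / K) \<omega> - 2\<bar> < 1 / 2"
      unfolding x_def[symmetric] using \<open>K > 0\<close> by simp
    then show ?thesis by linarith
  qed
  have "stop_at (hitting_time p T X l) \<omega> \<in> {0..T}" by (rule stop_at_range[OF hitting_time_stopping w])
  from w show ?thesis
  proof (cases rule: hitting_time_cases[where l = l])
    case never
    have "\<not> x + 2 / K \<le> T"
    proof
      assume *: "x + 2 / K \<le> T"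
      then have "x + 2 / K \<in> {0..T}" using x \<open>K > 0\<close> by simp
      then show False using never(2) late[OF *] by fastforce
    qed
    moreover have "stop_at (hitting_time p T X l) \<omega> = T" by (simp add: stop_at_def never(1) min_def)
    ultimately show ?thesis using x unfolding x_def[symmetric] by simp
  next
    case (hit t)
    have "stop_at (hitting_time p T X l) \<omega> = t" using hit by (simp add: stop_at_def min_def)
    moreover have "x < t" using early hit by blast
    moreover have "t \<le> x + 2 / K"
    proof (cases "x + 2 / K \<le> T")
      case True
      then have "x + 2 / K \<in> {0..T}" using x \<open>K > 0\<close> by simp
      then show ?thesis using hit(4) late[OF True] by blast
    next
      case False
      then show ?thesis using hit(2) by simp
    qed
    ultimately show ?thesis unfolding x_def[symmetric] by simp
  qed
qed

text \<open>Slope \<open>n + 1\<close> brings the hitting time within \<open>2 / (n + 1)\<close> of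
  \<open>\<tau>\<close> off an event of probability below \<open>(1 / 2) ^ n\<close>; by
  Borel--Cantelli almost every sample point lies in finitely many of these events.\<close>

lemma hitting_times_dense:
  assumes \<tau>: "\<tau> \<in> rp_stopping_times p T M X"
  obtains l where "AE \<omega> in M. (\<lambda>n. stop_at (hitting_time p T X (l n)) \<omega>) \<longlonglongrightarrow> stop_at \<tau> \<omega>"
proof -
  have "\<exists>l. \<exists>E\<in>sets M. prob E < (1 / 2) ^ n \<and> (\<forall>\<omega>\<in>space M - E.
      \<bar>stop_at (hitting_time p T X l) \<omega> - stop_at \<tau> \<omega>\<bar> \<le> 2 / real (Suc n))" for n
  proof -
    define K where "K = real (Suc n)"
    have K: "K > 0" by (simp add: K_def)
    have "approximable (\<lambda>t \<omega>. K * max 0 (t - stop_at \<tau> \<omega>))"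
      by (intro approximable_mult approximable_time_since[OF \<tau>] approximable_deterministic continuous_on_const)
    \<comment> \<open>The first entry is the uniform error for which the crossing argument works,
      the second makes the probabilities summable.\<close>
    moreover have "min (1 / 2) ((1 / 2) ^ n) > (0::real)" by simp
    ultimately obtain l where "close_within (min (1 / 2) ((1 / 2) ^ n)) (lin l) (\<lambda>t \<omega>. K * max 0 (t - stop_at \<tau> \<omega>))"
      unfolding approximable_def by blast
    then obtain E where E: "E \<in> sets M" "prob E < (1 / 2) ^ n"
      "\<And>\<omega> t. \<omega> \<in> space M - E \<Longrightarrow> t \<in> {0..T} \<Longrightarrow> \<bar>lin l t \<omega> - K * max 0 (t - stop_at \<tau> \<omega>)\<bar> < 1 / 2"
      unfolding close_within_def by (metis min_less_iff_conj)
    have "\<bar>stop_at (hitting_time p T X l) \<omega> - stop_at \<tau> \<omega>\<bar> \<le> 2 / K" if "\<omega> \<in> space M - E" for \<omega>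
      by (rule hitting_time_near[OF \<tau> _ K]) (use E(3) that in auto)
    then show ?thesis using E(1,2) unfolding K_def by blast
  qed
  then obtain l E where E: "\<And>n. E n \<in> sets M" "\<And>n. prob (E n) < (1 / 2) ^ n"
    "\<And>n \<omega>. \<omega> \<in> space M - E n \<Longrightarrow> \<bar>stop_at (hitting_time p T X (l n)) \<omega> - stop_at \<tau> \<omega>\<bar> \<le> 2 / real (Suc n)"
    by metis
  have "summable (\<lambda>n. prob (E n))"
  proof (rule summable_comparison_test')
    show "summable (\<lambda>n. (1 / 2 :: real) ^ n)" by (rule summable_geometric) simp
    show "norm (prob (E n)) \<le> (1 / 2) ^ n" for n using E(2)[of n] by simp
  qed
  then have "AE \<omega> in M. eventually (\<lambda>n. \<omega> \<in> space M - E n) sequentially"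
    using E(1) by (intro borel_cantelli_AE1) (auto simp: emeasure_eq_measure)
  then have "AE \<omega> in M. (\<lambda>n. stop_at (hitting_time p T X (l n)) \<omega>) \<longlonglongrightarrow> stop_at \<tau> \<omega>"
  proof (rule AE_mp[OF _ AE_I2], intro impI)
    fix \<omega> assume ev: "eventually (\<lambda>n. \<omega> \<in> space M - E n) sequentially"
    have lim: "(\<lambda>n. 2 / real (Suc n)) \<longlonglongrightarrow> 0"
      using tendsto_mult[OF tendsto_const[of 2] LIMSEQ_inverse_real_of_nat] by (simp add: divide_inverse)
    have "eventually (\<lambda>n. norm (stop_at (hitting_time p T X (l n)) \<omega> - stop_at \<tau> \<omega>) \<le> 2 / real (Suc n)) sequentially"
      using ev by (rule eventually_mono) (use E(3) in auto)
    then have "(\<lambda>n. stop_at (hitting_time p T X (l n)) \<omega> - stop_at \<tau> \<omega>) \<longlonglongrightarrow> 0"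
      using lim by (rule Lim_null_comparison)
    then show "(\<lambda>n. stop_at (hitting_time p T X (l n)) \<omega>) \<longlonglongrightarrow> stop_at \<tau> \<omega>" by (rule LIM_zero_cancel)
  qed
  then show ?thesis by (rule that)
qed

text \<open>The integral of \<open>N\<close> bounds all expected values from above, which the
  real-valued suprema require, and \<open>N\<close> also serves as the dominating function.
  Convergence of the times carries over to the stopped values by continuity of the paths of
  \<open>Y\<close>.\<close>

lemma stopping_values:
  assumes c: "\<And>\<omega>. \<omega> \<in> space M \<Longrightarrow> continuous_on {0..T} (\<lambda>t. Y t \<omega>)"
    and m: "\<And>t. t \<in> {0..T} \<Longrightarrow> Y t \<in> borel_measurable M"
    and int: "integrable M (\<lambda>\<omega>. SUP t\<in>{0..T}. \<bar>Y t \<omega>\<bar>)"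
  shows "(SUP \<tau>\<in>rp_stopping_times p T M X. \<integral>\<omega>. stopped_value T Y \<tau> \<omega> \<partial>M) =
    (SUP l. \<integral>\<omega>. stopped_value T Y (hitting_time p T X l) \<omega> \<partial>M)"
proof -
  define N where "N = (\<lambda>\<omega>. SUP t\<in>{0..T}. \<bar>Y t \<omega>\<bar>)"
  define J where "J = (\<lambda>\<tau>. \<integral>\<omega>. stopped_value T Y \<tau> \<omega> \<partial>M)"
  let ?S = "rp_stopping_times p T M X"
  have val: "stopped_value T Y \<tau> \<omega> = Y (stop_at \<tau> \<omega>) \<omega>" for \<tau> \<omega>
    by (simp add: stopped_value_def stop_at_def)
  have bound: "\<bar>stopped_value T Y \<tau> \<omega>\<bar> \<le> N \<omega>" if \<tau>: "\<tau> \<in> ?S" and w: "\<omega> \<in> space M" for \<tau> \<omega>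
  proof -
    obtain B where "\<And>t. t \<in> {0..T} \<Longrightarrow> \<bar>Y t \<omega>\<bar> \<le> B" using continuous_interval_bound[OF c[OF w]] by blast
    then have "bdd_above ((\<lambda>t. \<bar>Y t \<omega>\<bar>) ` {0..T})" by (rule bdd_aboveI2)
    then show ?thesis unfolding val N_def using stop_at_range[OF \<tau> w] by (intro cSUP_upper)
  qed
  have N: "integrable M N" using int by (simp add: N_def)
  have J_bound: "J \<tau> \<le> integral\<^sup>L M N" if "\<tau> \<in> ?S" for \<tau>
    unfolding J_def
  proof (rule integral_mono_AE)
    show "integrable M (stopped_value T Y \<tau>)"
    proof (rule Bochner_Integration.integrable_bound[OF N])
      show "stopped_value T Y \<tau> \<in> borel_measurable M" by (rule stopped_value_measurable[OF that c m])
      show "AE \<omega> in M. norm (stopped_value T Y \<tau> \<omega>) \<le> norm (N \<omega>)"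
        using bound[OF that] by (intro AE_I2) (auto intro: order_trans[OF _ abs_ge_self])
    qed
    show "AE \<omega> in M. stopped_value T Y \<tau> \<omega> \<le> N \<omega>"
      using bound[OF that] by (intro AE_I2) (auto intro: order_trans[OF abs_ge_self])
  qed (rule N)
  have hit: "hitting_time p T X l \<in> ?S" for l by (rule hitting_time_stopping)
  have bdd1: "bdd_above (J ` ?S)" by (rule bdd_aboveI2[OF J_bound])
  have bdd2: "bdd_above (range (\<lambda>l. J (hitting_time p T X l)))" by (rule bdd_aboveI2[OF J_bound[OF hit]])
  have "J \<tau> \<le> (SUP l. J (hitting_time p T X l))" if \<tau>: "\<tau> \<in> ?S" for \<tau>
  proof -
    obtain l where l: "AE \<omega> in M. (\<lambda>n. stop_at (hitting_time p T X (l n)) \<omega>) \<longlonglongrightarrow> stop_at \<tau> \<omega>"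
      using hitting_times_dense[OF \<tau>] by blast
    have "(\<lambda>n. J (hitting_time p T X (l n))) \<longlonglongrightarrow> J \<tau>"
      unfolding J_def
    proof (rule integral_dominated_convergence[where w = N])
      show "AE \<omega> in M. (\<lambda>n. stopped_value T Y (hitting_time p T X (l n)) \<omega>) \<longlonglongrightarrow> stopped_value T Y \<tau> \<omega>"
        using l
      proof (rule AE_mp[OF _ AE_I2], intro impI)
        fix \<omega> assume w: "\<omega> \<in> space M" and lim: "(\<lambda>n. stop_at (hitting_time p T X (l n)) \<omega>) \<longlonglongrightarrow> stop_at \<tau> \<omega>"
        show "(\<lambda>n. stopped_value T Y (hitting_time p T X (l n)) \<omega>) \<longlonglongrightarrow> stopped_value T Y \<tau> \<omega>"
          unfolding val
          by (rule continuous_on_tendsto_compose[OF c[OF w] lim])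
            (use stop_at_range[OF \<tau> w] stop_at_range[OF hit w] in auto)
      qed
      show "AE \<omega> in M. norm (stopped_value T Y (hitting_time p T X (l n)) \<omega>) \<le> N \<omega>" for n
        using bound[OF hit] by (intro AE_I2) auto
    qed (use stopped_value_measurable[OF _ c m] \<tau> hit N in auto)
    then show ?thesis
      by (rule LIMSEQ_le_const2) (use bdd2 in \<open>auto intro!: cSUP_upper\<close>)
  qed
  moreover have "J (hitting_time p T X l) \<le> (SUP \<tau>\<in>?S. J \<tau>)" for l
    using bdd1 hit by (intro cSUP_upper)
  moreover have "?S \<noteq> {}" using hit by blast
  ultimately have "(SUP \<tau>\<in>?S. J \<tau>) = (SUP l. J (hitting_time p T X l))"
    by (intro antisym cSUP_least) auto
  then show ?thesis by (simp add: J_def)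
qed

end

theorem theorem1:
  fixes M :: "'w measure"
    and p T :: real
    and X :: "real \<Rightarrow> 'w \<Rightarrow> 'd::finite option tseries"
    and Y :: "real \<Rightarrow> 'w \<Rightarrow> real"
  assumes "p \<ge> 1" and "T > 0"
    and "prob_space M"
    and X_measurable: "\<And>t w. t \<in> {0..T} \<Longrightarrow> (\<lambda>\<omega>. X t \<omega> w) \<in> borel_measurable M"
    and X_paths: "\<And>\<omega>. \<omega> \<in> space M \<Longrightarrow> (\<lambda>t. X t \<omega>) \<in> Omega_hat p T"
    and Y_continuous: "\<And>\<omega>. \<omega> \<in> space M \<Longrightarrow> continuous_on {0..T} (\<lambda>t. Y t \<omega>)"
    and Y_adapted: "\<And>t. t \<in> {0..T} \<Longrightarrow>
      Y t \<in> borel_measurable (rp_filtration p T M X (ereal t))"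
    and Y_integrable: "integrable M (\<lambda>\<omega>. SUP t\<in>{0..T}. \<bar>Y t \<omega>\<bar>)"
  shows "(SUP \<tau>\<in>rp_stopping_times p T M X. \<integral>\<omega>. stopped_value T Y \<tau> \<omega> \<partial>M) =
    (SUP l. \<integral>\<omega>. stopped_value T Y (hitting_time p T X l) \<omega> \<partial>M)"
proof -
  interpret rough_process M p T X
    using assms(1-5) by (simp add: rough_process_def rough_process_axioms_def)
  show ?thesis
    by (rule stopping_values[OF Y_continuous measurable_filt_M[OF Y_adapted] Y_integrable])
qed

end
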